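(* For the decorated hypercubic lattice model described in the context with $d\ge2$, there are finite constants $c_2>0$, $c_3>0$, $\mu_1>0$ and $\mu_2<0$, depending only on $d$ (not on $L$, nor on $t,\lambda,U,U'$), such that, with $S_{\max}=N_{\rm d}/2=L^d/2$: (i) for every $\mu\ge\mu_1$, $$S_{\max}(S_{\max}+1)\ \ge\ \langle({\bf S}_{\rm tot})^2\rangle_\mu\ \ge\ S_{\max}(S_{\max}+1)\,(1-c_2e^{-\mu});$$ (ii) for every $\mu\le\mu_2$, $$\tfrac34\langle\hat N_{\rm e}\rangle_\mu\ \le\ \langle({\bf S}_{\rm tot})^2\rangle_\mu\ \le\ \tfrac34\langle\hat N_{\rm e}\rangle_\mu+c_3|V|e^{2\mu}.$$
   Context: Let $d\ge1$ and let $L\ge4$ be an even integer. Let $V=(\mathbb Z/L\mathbb Z)^d$ be the $d$-dimensional $L\times\cdots\times L$ hypercubic lattice with periodic boundary conditions, and let $B$ be the set of nearest-neighbour bonds $\{v,w\}$ ($v,w\in V$ at (periodic) Euclidean distance $1$). For each bond $\{v,w\}\in B$ introduce a new site $m(v,w)$ (the midpoint of the bond); let $M$ be the set of these midpoints and $\Lambda=V\cup M$. With fermion operators $c_{x\sigma}$, $x\in\Lambda$, $\sigma\in\{\uparrow,\downarrow\}$, satisfying the canonical anticommutation relations on the fermionic Fock space, $n_{x\sigma}=c^\dagger_{x\sigma}c_{x\sigma}$ and $\hat N_{\rm e}=\sum_x(n_{x\uparrow}+n_{x\downarrow})$, the Hamiltonian is $H=H_{\rm hop}+H_{\rm int}$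 with $$H_{\rm hop}=\sum_{\sigma}\sum_{\{v,w\}\in B}t\,(c^\dagger_{v\sigma}+c^\dagger_{w\sigma}+\lambda c^\dagger_{m(v,w)\sigma})(c_{v\sigma}+c_{w\sigma}+\lambda c_{m(v,w)\sigma}),$$ $$H_{\rm int}=U\sum_{u\in V}n_{u\uparrow}n_{u\downarrow}+U'\sum_{x\in M}n_{x\uparrow}n_{x\downarrow},$$ where $t>0$, $\lambda>0$, $U>0$, $U'>0$. Spin operators: $S^{(\alpha)}_x=\frac12\sum_{\sigma,\tau}c^\dagger_{x\sigma}p^{(\alpha)}_{\sigma\tau}c_{x\tau}$ with $p^{(\alpha)}$ the Pauli matrices, $S^{(\alpha)}_{\rm tot}=\sum_xS^{(\alpha)}_x$, $({\bf S}_{\rm tot})^2=\sum_{\alpha=1}^3(S^{(\alpha)}_{\rm tot})^2$. Let $P_0$ be the orthogonal projection (on the whole Fock space) onto the eigenspace of $H$ with eigenvalue $0$, and for an operator $O$ and $\mu\in\mathbb R$ let $$\langle O\rangle_\mu=\frac{\mathrm{Tr}[O\,e^{\mu\hat N_{\rm e}}P_0]}{\mathrm{Tr}[e^{\mu\hat N_{\rm e}}P_0]}.$$ *)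

theory Defs
  imports Complex_Main "HOL-Library.List_Lexorder" "HOL-Library.Function_Algebras"
begin

text \<open>A state is a coefficient function on occupation configurations (sets of occupied modes);
  the Fock space over the finite mode set Ms consists of the states supported on subsets of Ms.
  The mode type is linearly ordered; the order fixes the Jordan-Wigner sign convention.\<close>

type_synonym 'm fstate = "'m set \<Rightarrow> complex"
type_synonym 'm fop = "'m fstate \<Rightarrow> 'm fstate"

definition fsign :: "'m::linorder \<Rightarrow> 'm set \<Rightarrow> complex" where
  "fsign x S = (-1) ^ card {y \<in> S. y < x}"

definition ann :: "'m::linorder \<Rightarrow> 'm fop" where
  "ann x \<psi> = (\<lambda>S. if x \<notin> S then fsign x S * \<psi> (insert x S) else 0)"

definition cre :: "'m::linorder \<Rightarrow> 'm fop" where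
  "cre x \<psi> = (\<lambda>S. if x \<in> S then fsign x S * \<psi> (S - {x}) else 0)"

definition numop :: "'m::linorder \<Rightarrow> 'm fop" where
  "numop x = cre x \<circ> ann x"

definition smul :: "complex \<Rightarrow> 'm fop \<Rightarrow> 'm fop" where
  "smul a A = (\<lambda>\<psi> S. a * A \<psi> S)"

definition fock :: "'m set \<Rightarrow> 'm fstate set" where
  "fock Ms = {\<psi>. \<forall>S. \<not> S \<subseteq> Ms \<longrightarrow> \<psi> S = 0}"

definition finner :: "'m set \<Rightarrow> 'm fstate \<Rightarrow> 'm fstate \<Rightarrow> complex" where
  "finner Ms \<phi> \<psi> = (\<Sum>S\<in>Pow Ms. cnj (\<phi> S) * \<psi> S)"

definition basisv :: "'m set \<Rightarrow> 'm fstate" where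
  "basisv S = (\<lambda>T. if T = S then 1 else 0)"

definition ftrace :: "'m set \<Rightarrow> 'm fop \<Rightarrow> complex" where
  "ftrace Ms A = (\<Sum>S\<in>Pow Ms. A (basisv S) S)"

definition zero_proj :: "'m set \<Rightarrow> 'm fop \<Rightarrow> 'm fop" where
  "zero_proj Ms H \<psi> = (THE \<phi>. \<phi> \<in> fock Ms \<and> H \<phi> = (\<lambda>_. 0) \<and>
      (\<forall>\<chi>\<in>fock Ms. H \<chi> = (\<lambda>_. 0) \<longrightarrow> finner Ms \<chi> (\<lambda>S. \<psi> S - \<phi> S) = 0))"

text \<open>exp(mu N_e): N_e is diagonal in the occupation basis with eigenvalue card S.\<close>
definition expN :: "real \<Rightarrow> 'm fop" where
  "expN \<mu> \<psi> = (\<lambda>S. complex_of_real (exp (\<mu> * real (card S))) * \<psi> S)"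

definition gexp :: "'m set \<Rightarrow> 'm fop \<Rightarrow> real \<Rightarrow> 'm fop \<Rightarrow> complex" where
  "gexp Ms H \<mu> Ob = ftrace Ms (Ob \<circ> expN \<mu> \<circ> zero_proj Ms H) / ftrace Ms (expN \<mu> \<circ> zero_proj Ms H)"

definition verts :: "nat \<Rightarrow> nat \<Rightarrow> nat list set" where
  "verts d L = {v. length v = d \<and> (\<forall>i<d. v ! i < L)}"

text \<open>neighbour of v in (positive) direction j; the bond set is
  B = { {v, nbr L j v} | v in verts, j < d }, each bond (L >= 3) arising from exactly one (v,j).\<close>
definition nbr :: "nat \<Rightarrow> nat \<Rightarrow> nat list \<Rightarrow> nat list" where
  "nbr L j v = v[j := Suc (v ! j) mod L]"

definition bonds :: "nat \<Rightarrow> nat \<Rightarrow> nat list set set" where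
  "bonds d L = {{v, nbr L j v} | v j. v \<in> verts d L \<and> j < d}"

text \<open>Spin: True = up, False = down. Modes are encoded as nat lists:
  vertex v with spin s is  sp s # 0 # v ;  midpoint of bond {v, nbr L j v} with spin s is  sp s # 1 # j # v.\<close>
definition sp :: "bool \<Rightarrow> nat" where "sp s = (if s then 0 else 1)"

definition vmode :: "nat list \<Rightarrow> bool \<Rightarrow> nat list" where
  "vmode v s = sp s # 0 # v"

definition mmode :: "nat list \<Rightarrow> nat \<Rightarrow> bool \<Rightarrow> nat list" where
  "mmode v j s = sp s # 1 # j # v"

text \<open>sites of Lambda = V union M, each site given as the map spin -> mode\<close>
definition sites :: "nat \<Rightarrow> nat \<Rightarrow> (bool \<Rightarrow> nat list) set" where
  "sites d L = {vmode v | v. v \<in> verts d L} \<union> {mmode v j | v j. v \<in> verts d L \<and> j < d}"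

definition modes :: "nat \<Rightarrow> nat \<Rightarrow> nat list set" where
  "modes d L = {x s | x s. x \<in> sites d L}"

definition Hhop :: "nat \<Rightarrow> nat \<Rightarrow> real \<Rightarrow> real \<Rightarrow> nat list fop" where
  "Hhop d L t lam = (\<Sum>s\<in>(UNIV::bool set). \<Sum>v\<in>verts d L. \<Sum>j<d.
      smul (complex_of_real t)
        ((cre (vmode v s) + cre (vmode (nbr L j v) s) + smul (complex_of_real lam) (cre (mmode v j s)))
         \<circ> (ann (vmode v s) + ann (vmode (nbr L j v) s) + smul (complex_of_real lam) (ann (mmode v j s)))))"

definition Hint :: "nat \<Rightarrow> nat \<Rightarrow> real \<Rightarrow> real \<Rightarrow> nat list fop" where
  "Hint d L U U' =
     smul (complex_of_real U) (\<Sum>v\<in>verts d L. numop (vmode v True) \<circ> numop (vmode v False))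
   + smul (complex_of_real U') (\<Sum>v\<in>verts d L. \<Sum>j<d. numop (mmode v j True) \<circ> numop (mmode v j False))"

definition Ham :: "nat \<Rightarrow> nat \<Rightarrow> real \<Rightarrow> real \<Rightarrow> real \<Rightarrow> real \<Rightarrow> nat list fop" where
  "Ham d L t lam U U' = Hhop d L t lam + Hint d L U U'"

definition Nel :: "nat \<Rightarrow> nat \<Rightarrow> nat list fop" where
  "Nel d L = (\<Sum>x\<in>modes d L. numop x)"

definition pauli :: "nat \<Rightarrow> bool \<Rightarrow> bool \<Rightarrow> complex" where
  "pauli a s r =
     (if a = 1 then (if s \<noteq> r then 1 else 0)
      else if a = 2 then (if s \<and> \<not> r then - \<i> else if \<not> s \<and> r then \<i> else 0)
      else if a = 3 then (if s = r then (if s then 1 else -1) else 0)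
      else 0)"

definition spin_op :: "nat \<Rightarrow> (bool \<Rightarrow> nat list) \<Rightarrow> nat list fop" where
  "spin_op a x = smul (1/2) (\<Sum>s\<in>(UNIV::bool set). \<Sum>r\<in>(UNIV::bool set).
      smul (pauli a s r) (cre (x s) \<circ> ann (x r)))"

definition Stot :: "nat \<Rightarrow> nat \<Rightarrow> nat \<Rightarrow> nat list fop" where
  "Stot d L a = (\<Sum>x\<in>sites d L. spin_op a x)"

definition Stot_sq :: "nat \<Rightarrow> nat \<Rightarrow> nat list fop" where
  "Stot_sq d L = (\<Sum>a\<in>{1,2,3}. Stot d L a \<circ> Stot d L a)"

end

theory Submission
  imports Defs "HOL-Library.FuncSet"
begin

text \<open>A zero-energy state is annihilated by every bond operator and has no doubly occupied site. The
  first condition puts all electrons into the flat band, spanned by states localized around the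
  vertices; the second forbids double occupancy of these states and forces the amplitude to be
  symmetric in the spins of neighbouring occupied vertices. So the space of zero-energy states with
  occupied set \<open>A\<close> is a product of spins \<open>|C|/2\<close> over the components \<open>C\<close> of \<open>A\<close>, and the
  expectations become those of the percolation measure with weight
  \<open>exp (\<mu> |A|) \<Prod>\<^sub>C (|C| + 1)\<close>, where the squared spin is \<open>\<Sum>\<^sub>C |C| (|C| + 2) / 4\<close>.

  At low density, deleting a vertex at most halves the product over components, so a self-avoiding
  path of \<open>n\<close> vertices is occupied with probability at most \<open>(2 exp \<mu>)\<^sup>n\<close>.

  At high density one fills a cluster \<open>K\<close> of empty vertices. A component touching \<open>K\<close>, other than
  the largest, is separated from the largest one by a minimal cut. By the Poincare lemma on the
  torus the part of this cut at \<open>K\<close> is the whole cut or winds around the torus, and isoperimetry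
  bounds the size of the component by a power of the number of its edges to \<open>K\<close>. Thus filling \<open>K\<close>
  changes the product by at most \<open>exp (2 d\<^sup>2 |K|)\<close>, and a Peierls sum over \<open>K\<close> shows that a pair of
  vertices is disconnected with average probability \<open>O(exp (- \<mu>))\<close>.\<close>

section \<open>Components and cluster weights\<close>

text \<open>Every term of the Hamiltonian is positive semidefinite, so zero energy means that each
  term vanishes separately. The localized states spanning the kernel are not orthogonal; traces are
  therefore computed with dual coordinates, read off at configurations of vertex modes, instead of a
  Gram matrix. Cyclicity of the trace reduces the squared total spin to three times the square of
  its third component, which is a sum of independent uniform variables, one per component. The
  obstacle at high density is entropic: one empty cluster may cut off many components, and each
  multiplies the weight by its size plus 1. The largest touched component is exempt, because filling
  the cluster absorbs it in a component at least as large. The others are small because their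
  boundary edges compete for the 2 d edges at each vertex of the cluster; this is where the exponent
  2 d^2 arises. Charging disconnected pairs to clusters costs a second factor with exponent 2 d^2,
  whence 4 d^2 in the threshold for mu.\<close>

definition ccomp :: "('a \<times> 'a) set \<Rightarrow> 'a set \<Rightarrow> 'a \<Rightarrow> 'a set" where
  "ccomp R A x = {y. (x, y) \<in> (R \<inter> A \<times> A)\<^sup>*}"

definition ccomps :: "('a \<times> 'a) set \<Rightarrow> 'a set \<Rightarrow> 'a set set" where
  "ccomps R A = ccomp R A ` A"

lemma ccomp_self [simp]: "x \<in> ccomp R A x"
  by (simp add: ccomp_def)

lemma ccomp_step:
  assumes "y \<in> ccomp R A x" "(y, z) \<in> R" "y \<in> A" "z \<in> A"
  shows "z \<in> ccomp R A x"
proof -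
  have "(y, z) \<in> R \<inter> A \<times> A" using assms by simp
  with assms(1) show ?thesis unfolding ccomp_def mem_Collect_eq by (rule rtrancl_into_rtrancl)
qed

lemma ccomp_induct [consumes 1, case_names base step]:
  assumes "y \<in> ccomp R A x" "P x"
    and "\<And>y z. y \<in> ccomp R A x \<Longrightarrow> P y \<Longrightarrow> (y, z) \<in> R \<Longrightarrow> y \<in> A \<Longrightarrow> z \<in> A \<Longrightarrow> P z"
  shows "P y"
proof -
  have "(x, y) \<in> (R \<inter> A \<times> A)\<^sup>*" using assms(1) by (simp add: ccomp_def)
  then show ?thesis
  proof (induction rule: rtrancl_induct)
    case base then show ?case by (rule assms(2))
  next
    case (step y z) then show ?case using assms(3)[of y z] by (auto simp: ccomp_def)
  qed
qed

lemma ccomp_subset: "x \<in> A \<Longrightarrow> ccomp R A x \<subseteq> A"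
proof
  fix y assume "x \<in> A" "y \<in> ccomp R A x"
  from this(2,1) show "y \<in> A" by (induction rule: ccomp_induct) auto
qed

lemma ccomp_closed:
  assumes "x \<in> S" "\<And>y z. y \<in> S \<Longrightarrow> y \<in> A \<Longrightarrow> z \<in> A \<Longrightarrow> (y, z) \<in> R \<Longrightarrow> z \<in> S"
  shows "ccomp R A x \<subseteq> S"
proof
  fix y assume "y \<in> ccomp R A x"
  then show "y \<in> S" by (induction rule: ccomp_induct) (use assms in auto)
qed

lemma ccomp_mono: "A \<subseteq> B \<Longrightarrow> ccomp R A x \<subseteq> ccomp R B x"
  unfolding ccomp_def using rtrancl_mono[of "R \<inter> A \<times> A" "R \<inter> B \<times> B"] by auto

lemma ccomp_sym:
  assumes "sym R" "y \<in> ccomp R A x" shows "x \<in> ccomp R A y"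
proof -
  have "sym ((R \<inter> A \<times> A)\<^sup>*)" using assms(1) by (intro sym_rtrancl) (auto simp: sym_def)
  then show ?thesis using assms(2) by (auto simp: ccomp_def sym_def)
qed

lemma ccomp_trans: "y \<in> ccomp R A x \<Longrightarrow> z \<in> ccomp R A y \<Longrightarrow> z \<in> ccomp R A x"
  by (auto simp: ccomp_def)

lemma ccomp_eq:
  assumes "sym R" "y \<in> ccomp R A x" shows "ccomp R A y = ccomp R A x"
  using ccomp_trans[OF assms(2)] ccomp_trans[OF ccomp_sym[OF assms]] by blast

lemma ccompsD:
  assumes "sym R" "C \<in> ccomps R A" "x \<in> C"
  shows "C = ccomp R A x" "x \<in> A"
proof -
  obtain y where y: "y \<in> A" "C = ccomp R A y" using assms(2) by (auto simp: ccomps_def)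
  then show "C = ccomp R A x" using ccomp_eq[OF assms(1), of x A y] assms(3) by simp
  show "x \<in> A" using ccomp_subset[OF y(1)] y(2) assms(3) by auto
qed

lemma ccomps_ne: "C \<in> ccomps R A \<Longrightarrow> C \<noteq> {}"
  unfolding ccomps_def using ccomp_self by fast

lemma ccomps_sub: "C \<in> ccomps R A \<Longrightarrow> C \<subseteq> A"
  by (auto simp: ccomps_def dest: ccomp_subset[THEN subsetD, rotated])

lemma ccomps_disj:
  assumes "sym R" "C \<in> ccomps R A" "D \<in> ccomps R A" "C \<noteq> D" shows "C \<inter> D = {}"
proof (rule ccontr)
  assume "C \<inter> D \<noteq> {}"
  then obtain x where "x \<in> C" "x \<in> D" by auto
  then show False using ccompsD(1)[OF assms(1,2)] ccompsD(1)[OF assms(1,3)] assms(4) by metis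
qed

lemma ccomps_Union: "\<Union> (ccomps R A) = A"
proof
  show "\<Union> (ccomps R A) \<subseteq> A" using ccomps_sub by fast
  show "A \<subseteq> \<Union> (ccomps R A)" unfolding ccomps_def using ccomp_self by fast
qed

lemma ccomps_finite [simp]: "finite A \<Longrightarrow> finite (ccomps R A)"
  by (simp add: ccomps_def)

lemma ccomps_finite_mem: "finite A \<Longrightarrow> C \<in> ccomps R A \<Longrightarrow> finite C"
  by (rule finite_subset[OF ccomps_sub])

lemma ccomps_adj:
  assumes "sym R" "C \<in> ccomps R A" "x \<in> C" "(x, y) \<in> R" "y \<in> A" shows "y \<in> C"
  using ccompsD[OF assms(1-3)] ccomp_step[of x R A x y] assms by auto

lemma ccomp_within:
  assumes "sym R" "C \<in> ccomps R A" "x \<in> C" shows "ccomp R C x = C"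
proof
  show "ccomp R C x \<subseteq> C" using assms(3) by (rule ccomp_subset)
  have "y \<in> ccomp R C x" if "y \<in> ccomp R A x" for y
    using that
  proof (induction rule: ccomp_induct)
    case (step y z)
    have "C = ccomp R A x" using ccompsD[OF assms] by simp
    then have "y \<in> C" "z \<in> C" using step.hyps ccomp_step[of y R A x z] by auto
    then show ?case using step ccomp_step[of y R C x z] by auto
  qed simp
  then show "C \<subseteq> ccomp R C x" using ccompsD[OF assms] by auto
qed

lemma ccompsI:
  assumes "C \<subseteq> A" "x \<in> C" "ccomp R C x = C"
    and "\<And>y z. y \<in> C \<Longrightarrow> z \<in> A \<Longrightarrow> (y, z) \<in> R \<Longrightarrow> z \<in> C"
  shows "C \<in> ccomps R A"
proof -
  have "ccomp R A x \<subseteq> C" using assms by (intro ccomp_closed) auto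
  moreover have "C \<subseteq> ccomp R A x" using ccomp_mono[OF assms(1), of R x] assms(3) by simp
  ultimately have "C = ccomp R A x" by auto
  moreover have "x \<in> A" using assms(1,2) by auto
  ultimately show ?thesis unfolding ccomps_def by (rule image_eqI)
qed

text \<open>A component is recognized locally (\<open>ccompsI\<close>): it is connected inside
  itself and has no further neighbour in the ambient set. It therefore survives changes of that set
  away from its own vertices and neighbours.\<close>

lemma ccomps_transfer:
  assumes "sym R" "C \<in> ccomps R A" "C \<subseteq> B"
    and "\<And>y z. y \<in> C \<Longrightarrow> z \<in> B - A \<Longrightarrow> (y, z) \<notin> R"
  shows "C \<in> ccomps R B"
proof -
  obtain x where x: "x \<in> C" using ccomps_ne[OF assms(2)] by auto
  show ?thesis
    using assms(3) x ccomp_within[OF assms(1,2) x]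
  proof (rule ccompsI)
    fix y z assume "y \<in> C" "z \<in> B" "(y, z) \<in> R"
    then show "z \<in> C" using assms(4) ccomps_adj[OF assms(1,2)] by blast
  qed
qed

lemma sum_card_ccomps:
  assumes "sym R" "finite A" shows "(\<Sum>C\<in>ccomps R A. card C) = card A"
proof -
  have "card (\<Union> (ccomps R A)) = sum card (ccomps R A)"
    using assms ccomps_disj[OF assms(1)] ccomps_finite_mem
    by (intro card_Union_disjoint) (auto simp: pairwise_def disjnt_def)
  then show ?thesis by (simp add: ccomps_Union)
qed

section \<open>The weight of a configuration under deleting a vertex or filling a set\<close>

definition cweight :: "('a \<times> 'a) set \<Rightarrow> 'a set \<Rightarrow> nat" where
  "cweight R A = (\<Prod>C\<in>ccomps R A. card C + 1)"

lemma cweight_pos: "cweight R A > 0"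
  unfolding cweight_def by (intro prod_pos) auto

lemma one_plus_sum_le_prod:
  fixes g :: "'b \<Rightarrow> nat"
  assumes "finite X" shows "1 + (\<Sum>x\<in>X. g x) \<le> (\<Prod>x\<in>X. g x + 1)"
  using assms
proof (induction rule: finite_induct)
  case (insert x F)
  have "1 + (\<Sum>x\<in>insert x F. g x) = (1 + (\<Sum>x\<in>F. g x)) + g x" using insert by simp
  also have "\<dots> \<le> (\<Prod>x\<in>F. g x + 1) + g x * (\<Prod>x\<in>F. g x + 1)"
    using insert.IH insert(1) by (intro add_mono) (simp_all add: prod_pos Suc_leI)
  also have "\<dots> = (\<Prod>x\<in>insert x F. g x + 1)" using insert by (simp add: algebra_simps)
  finally show ?case .
qed simp

text \<open>Removing \<open>x\<close> changes only its component \<open>C\<close>, whose remainder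
  is covered by the new components \<open>Y\<close>. A product of factors 1 + n is at least 1 plus
  the sum of the n, so the new factors give at least |C|, and |C| + 1 <= 2 |C|.\<close>

lemma cweight_delete:
  assumes "sym R" "finite A" "x \<in> A"
  shows "cweight R A \<le> 2 * cweight R (A - {x})"
proof -
  define B where "B = A - {x}"
  define C where "C = ccomp R A x"
  define X where "X = ccomps R A - {C}"
  have finB: "finite B" using assms by (simp add: B_def)
  have CA: "C \<in> ccomps R A" using assms by (simp add: C_def ccomps_def)
  have xC: "x \<in> C" by (simp add: C_def)
  have XB: "X \<subseteq> ccomps R B"
  proof
    fix D assume D: "D \<in> X"
    then have DA: "D \<in> ccomps R A" "D \<noteq> C" by (auto simp: X_def)
    have "x \<notin> D"
      using ccompsD(1)[OF assms(1) DA(1), of x] ccompsD(1)[OF assms(1) CA xC] DA(2) by auto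
    then have "D \<subseteq> B" using ccomps_sub[OF DA(1)] by (auto simp: B_def)
    then show "D \<in> ccomps R B" using ccomps_transfer[OF assms(1) DA(1)] by (auto simp: B_def)
  qed
  define Y where "Y = ccomps R B - X"
  have finY: "finite Y" using finB by (simp add: Y_def)
  have "C - {x} \<subseteq> \<Union> Y"
  proof
    fix y assume y: "y \<in> C - {x}"
    then have yB: "y \<in> B" using ccomps_sub[OF CA] by (auto simp: B_def)
    then obtain D where D: "D \<in> ccomps R B" "y \<in> D" using ccomps_Union[of R B] by auto
    have "D \<notin> X"
      using ccompsD(1)[OF assms(1) _ D(2), of A] ccompsD(1)[OF assms(1) CA, of y] y unfolding X_def by auto
    then show "y \<in> \<Union> Y" using D by (auto simp: Y_def)
  qed
  then have "card (C - {x}) \<le> card (\<Union> Y)"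
    using finB by (intro card_mono) (auto simp: Y_def dest: ccomps_finite_mem)
  also have "\<dots> \<le> (\<Sum>D\<in>Y. card D)" by (rule card_Union_le_sum_card)
  finally have "1 + card (C - {x}) \<le> (\<Prod>D\<in>Y. card D + 1)"
    using one_plus_sum_le_prod[OF finY, of card] by linarith
  moreover have "finite C" using CA assms(2) ccomps_finite_mem by blast
  then have "card C = 1 + card (C - {x})" using xC by (metis card.remove plus_1_eq_Suc)
  ultimately have Y: "card C + 1 \<le> 2 * (\<Prod>D\<in>Y. card D + 1)" by linarith
  have "cweight R A = (card C + 1) * (\<Prod>D\<in>X. card D + 1)"
    unfolding cweight_def X_def using CA assms(2) by (simp add: prod.remove)
  also have "\<dots> \<le> (2 * (\<Prod>D\<in>Y. card D + 1)) * (\<Prod>D\<in>X. card D + 1)"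
    using Y by (rule mult_right_mono) simp
  also have "\<dots> = 2 * cweight R B"
    unfolding cweight_def Y_def using XB finB by (simp add: prod.subset_diff[of X "ccomps R B"])
  finally show ?thesis by (simp add: B_def)
qed

lemma prod_mono_subset_nat:
  fixes g :: "'b \<Rightarrow> nat"
  assumes "finite B" "A \<subseteq> B" "\<And>b. b \<in> B \<Longrightarrow> g b > 0"
  shows "prod g A \<le> prod g B"
  using assms by (intro dvd_imp_le prod_dvd_prod_subset prod_pos) auto

definition touching :: "('a \<times> 'a) set \<Rightarrow> 'a set \<Rightarrow> 'a set \<Rightarrow> 'a set set" where
  "touching R A K = {C \<in> ccomps R A. \<exists>k\<in>K. \<exists>c\<in>C. (k, c) \<in> R}"

lemma touching_finite [simp]: "finite A \<Longrightarrow> finite (touching R A K)"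
  by (simp add: touching_def)

lemma untouched_ccomps:
  assumes "sym R" "K \<inter> A = {}"
  shows "ccomps R A - touching R A K \<subseteq> ccomps R (A \<union> K)"
proof
  fix D assume D: "D \<in> ccomps R A - touching R A K"
  then show "D \<in> ccomps R (A \<union> K)"
  proof (intro ccomps_transfer[OF assms(1), of D A "A \<union> K"])
    fix y z assume "y \<in> D" "z \<in> A \<union> K - A"
    then show "(y, z) \<notin> R" using D assms(1) by (auto simp: touching_def sym_def)
  qed (use ccomps_sub[of D R A] in auto)
qed

lemma cweight_fill_isolated:
  assumes "sym R" "finite A" "finite K" "K \<inter> A = {}" "touching R A K = {}"
  shows "cweight R A \<le> cweight R (A \<union> K)"
proof -
  have "ccomps R A \<subseteq> ccomps R (A \<union> K)" using untouched_ccomps[OF assms(1,4)] assms(5) by simp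
  then show ?thesis unfolding cweight_def using assms(2,3) by (intro prod_mono_subset_nat) auto
qed

text \<open>Untouched components keep their factors, and the component \<open>N\<close> of
  \<open>A \<union> K\<close> that contains \<open>M\<close> pays for the factor of
  \<open>M\<close>. The factors of the other touched components are the price, which is why
  \<open>M\<close> is later chosen largest.\<close>

lemma cweight_fill:
  assumes "sym R" "finite A" "finite K" "K \<inter> A = {}" "M \<in> touching R A K"
  shows "cweight R A \<le> cweight R (A \<union> K) * (\<Prod>C\<in>touching R A K - {M}. card C + 1)"
proof -
  define X where "X = ccomps R A - touching R A K"
  define B where "B = A \<union> K"
  have finB: "finite B" using assms by (simp add: B_def)
  have XB: "X \<subseteq> ccomps R B" using untouched_ccomps[OF assms(1,4)] by (simp add: X_def B_def)
  obtain k m where km: "k \<in> K" "m \<in> M" "(k, m) \<in> R" and MA: "M \<in> ccomps R A"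
    using assms(5) by (auto simp: touching_def)
  define N where "N = ccomp R B m"
  have mA: "m \<in> A" using ccomps_sub[OF MA] km by auto
  have NB: "N \<in> ccomps R B" using mA by (auto simp: N_def ccomps_def B_def)
  have kN: "k \<in> N" unfolding N_def
    using km mA assms(1) by (intro ccomp_step[of m R B m k]) (auto simp: B_def sym_def)
  then have NX: "N \<notin> X" using km(1) assms(4) ccomps_sub by (fastforce simp: X_def)
  have "M \<subseteq> N" using ccompsD[OF assms(1) MA km(2)] ccomp_mono[of A B R m] by (auto simp: N_def B_def)
  then have cMN: "card M + 1 \<le> card N + 1"
    using ccomps_finite_mem[OF finB NB] by (simp add: card_mono)
  have "(\<Prod>C\<in>X. card C + 1) * (card M + 1) \<le> (\<Prod>C\<in>X. card C + 1) * (card N + 1)"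
    using cMN by (rule mult_left_mono) simp
  also have "\<dots> = (\<Prod>C\<in>insert N X. card C + 1)"
    using NX assms(2) by (simp add: X_def mult.commute)
  also have "\<dots> \<le> cweight R B" unfolding cweight_def using XB NB finB by (intro prod_mono_subset_nat) auto
  finally have le: "(\<Prod>C\<in>X. card C + 1) * (card M + 1) \<le> cweight R B" .
  have "cweight R A = (\<Prod>C\<in>X. card C + 1) * (\<Prod>C\<in>touching R A K. card C + 1)"
    unfolding cweight_def X_def
    using assms(2) by (intro prod.subset_diff) (auto simp: touching_def)
  also have "(\<Prod>C\<in>touching R A K. card C + 1) = (card M + 1) * (\<Prod>C\<in>touching R A K - {M}. card C + 1)"
    using assms(2,5) by (simp add: prod.remove)
  also have "(\<Prod>C\<in>X. card C + 1) * \<dots> =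
      ((\<Prod>C\<in>X. card C + 1) * (card M + 1)) * (\<Prod>C\<in>touching R A K - {M}. card C + 1)"
    by (simp only: mult.assoc)
  also have "\<dots> \<le> cweight R B * (\<Prod>C\<in>touching R A K - {M}. card C + 1)"
    using le by (rule mult_right_mono) simp
  finally show ?thesis by (simp add: B_def)
qed

section \<open>Walks and the number of connected sets\<close>

primrec walks :: "('a \<times> 'a) set \<Rightarrow> nat \<Rightarrow> 'a \<Rightarrow> 'a list set" where
  "walks R 0 x = {[x]}"
| "walks R (Suc n) x = (\<Union>y\<in>R `` {x}. (#) x ` walks R n y)"

declare walks.simps(2) [simp del]

lemma walks_Cons: "(x, y) \<in> R \<Longrightarrow> q \<in> walks R n y \<Longrightarrow> x # q \<in> walks R (Suc n) x"
  by (auto simp: walks.simps)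

lemma walks_SucE:
  assumes "p \<in> walks R (Suc n) x"
  obtains y q where "(x, y) \<in> R" "q \<in> walks R n y" "p = x # q"
  using assms by (auto simp: walks.simps)

lemma walks_length: "p \<in> walks R n x \<Longrightarrow> length p = Suc n"
  by (induction n arbitrary: p x) (auto elim: walks_SucE)

lemma walks_hd: "p \<in> walks R n x \<Longrightarrow> p \<noteq> [] \<and> hd p = x"
  by (cases n) (auto elim: walks_SucE)

lemma walks_card:
  assumes "\<And>x. finite (R `` {x}) \<and> card (R `` {x}) \<le> m"
  shows "finite (walks R n x) \<and> card (walks R n x) \<le> m ^ n"
proof (induction n arbitrary: x)
  case (Suc n)
  have "card (walks R (Suc n) x) \<le> (\<Sum>y\<in>R `` {x}. card ((#) x ` walks R n y))"
    using assms by (auto simp: walks.simps intro: card_UN_le)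
  also have "\<dots> \<le> (\<Sum>y\<in>R `` {x}. m ^ n)"
    using Suc by (intro sum_mono) (meson card_image_le le_trans)
  also have "\<dots> = card (R `` {x}) * m ^ n" by simp
  also have "\<dots> \<le> m * m ^ n" using assms by (intro mult_right_mono) auto
  finally show ?case using assms Suc by (auto simp: walks.simps)
qed auto

lemma walks_insert:
  assumes "p \<in> walks R n x" "z \<in> set p" "(z, y) \<in> R" "(y, z) \<in> R"
  shows "\<exists>q\<in>walks R (n + 2) x. set q = insert y (set p)"
  using assms
proof (induction n arbitrary: p x)
  case 0
  then have "[x, y, x] \<in> walks R (0 + 2) x"
    by (auto simp: numeral_2_eq_2 intro!: walks_Cons[of x y] walks_Cons[of y x])
  then show ?case using 0 by (intro bexI[of _ "[x, y, x]"]) auto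
next
  case (Suc n)
  then obtain u q where q: "(x, u) \<in> R" "q \<in> walks R n u" "p = x # q"
    by (blast elim: walks_SucE)
  show ?case
  proof (cases "z = x")
    case True
    have "x # y # x # q \<in> walks R (Suc n + 2) x"
      using walks_Cons[OF q(1,2)] True Suc.prems by (auto intro: walks_Cons)
    then show ?thesis using q by (intro bexI[of _ "x # y # x # q"]) auto
  next
    case False
    then obtain r where r: "r \<in> walks R (n + 2) u" "set r = insert y (set q)"
      using Suc.IH[OF q(2)] Suc.prems q by auto
    then have "x # r \<in> walks R (Suc n + 2) x" using q walks_Cons by fastforce
    then show ?thesis using r q by (intro bexI[of _ "x # r"]) auto
  qed
qed

text \<open>A detour \<open>z, y, z\<close> is inserted for every new vertex \<open>y\<close>.\<close>

lemma connected_covering_walk: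
  assumes "sym R" "finite K" "x \<in> K" "ccomp R K x = K"
  shows "\<exists>p\<in>walks R (2 * (card K - 1)) x. set p = K"
proof -
  \<comment> \<open>A covered set \<open>T\<close> can grow until it is all of \<open>K\<close>:
    without an edge into \<open>K - T\<close> it would be closed inside the connected set
    \<open>K\<close>.\<close>
  have "\<exists>T p. T \<subseteq> K \<and> card T = Suc m \<and> p \<in> walks R (2 * m) x \<and> set p = T" if "m < card K" for m
    using that
  proof (induction m)
    case 0
    then show ?case using assms(3) by (intro exI[of _ "{x}"] exI[of _ "[x]"]) auto
  next
    case (Suc m)
    then obtain T p where T: "T \<subseteq> K" "card T = Suc m" "p \<in> walks R (2 * m) x" "set p = T" by auto
    have xT: "x \<in> T" using walks_hd[OF T(3)] T(4) by (cases p) auto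
    have "\<exists>z\<in>T. \<exists>y\<in>K - T. (z, y) \<in> R"
    proof (rule ccontr)
      assume "\<not> ?thesis"
      then have "ccomp R K x \<subseteq> T" using xT by (intro ccomp_closed) auto
      then have "K = T" using assms(4) T(1) by auto
      then show False using T(2) Suc.prems by simp
    qed
    then obtain z y where zy: "z \<in> T" "y \<in> K - T" "(z, y) \<in> R" by auto
    then obtain q where "q \<in> walks R (2 * m + 2) x" "set q = insert y T"
      using walks_insert[OF T(3), of z y] T(4) assms(1) by (auto simp: sym_def)
    moreover have "card (insert y T) = Suc (Suc m)"
      using zy T(1,2) finite_subset[OF T(1) assms(2)] by simp
    ultimately show ?case using zy T(1) by (intro exI[of _ "insert y T"] exI[of _ q]) auto
  qed
  moreover have "card K > 0" using assms by (auto simp: card_gt_0_iff)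
  then have "card K - 1 < card K" "Suc (card K - 1) = card K" by auto
  ultimately obtain T p where "T \<subseteq> K" "card T = card K" "p \<in> walks R (2 * (card K - 1)) x" "set p = T"
    by metis
  then show ?thesis using card_subset_eq[OF assms(2)] by blast
qed

lemma walks_suffix:
  assumes "p \<in> walks R n u" "x \<in> set p"
  shows "\<exists>m q. q \<in> walks R m x \<and> last q = last p \<and> set q \<subseteq> set p \<and> (distinct p \<longrightarrow> distinct q)"
  using assms
proof (induction n arbitrary: p u)
  case 0
  then show ?case by (intro exI[of _ 0] exI[of _ "[x]"]) auto
next
  case (Suc n)
  then obtain w q where q: "(u, w) \<in> R" "q \<in> walks R n w" "p = u # q"
    by (blast elim: walks_SucE)
  show ?case
  proof (cases "x = u")
    case True
    then show ?thesis using Suc.prems by (intro exI[of _ "Suc n"] exI[of _ p]) auto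
  next
    case False
    then obtain m r where "r \<in> walks R m x" "last r = last q" "set r \<subseteq> set q" "distinct q \<longrightarrow> distinct r"
      using Suc.IH[OF q(2)] Suc.prems q by auto
    then show ?thesis using q walks_hd[OF q(2)] by (intro exI[of _ m] exI[of _ r]) auto
  qed
qed

text \<open>The path is grown backwards from \<open>w\<close>. A new first vertex is prepended; if
  it already lies on the path, \<open>walks_suffix\<close> cuts off the loop, so the vertices stay
  distinct.\<close>

lemma simple_path:
  assumes "sym R" "w \<in> ccomp R A v" "v \<in> A"
  shows "\<exists>n p. p \<in> walks R n v \<and> last p = w \<and> set p \<subseteq> A \<and> distinct p"
proof -
  have "v \<in> ccomp R A w" using assms by (auto intro: ccomp_sym)
  moreover have "w \<in> A" using ccomp_subset[OF assms(3)] assms(2) by auto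
  ultimately show ?thesis
  proof (induction rule: ccomp_induct)
    case base
    then show ?case by (intro exI[of _ 0] exI[of _ "[w]"]) auto
  next
    case (step y z)
    then obtain n p where p: "p \<in> walks R n y" "last p = w" "set p \<subseteq> A" "distinct p" by auto
    show ?case
    proof (cases "z \<in> set p")
      case True
      then show ?thesis using walks_suffix[OF p(1) True] p by (metis order.trans)
    next
      case False
      have "(z, y) \<in> R" using step assms(1) by (auto simp: sym_def)
      then have "z # p \<in> walks R (Suc n) z" using p by (auto intro: walks_Cons)
      then show ?thesis using False p step walks_hd[OF p(1)]
        by (intro exI[of _ "Suc n"] exI[of _ "z # p"]) auto
    qed
  qed
qed

text \<open>The lattice animals of \<open>V\<close>; every cluster of empty vertices is one by
  \<open>ccomps_animals\<close>.\<close>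

definition animals :: "('a \<times> 'a) set \<Rightarrow> 'a set \<Rightarrow> 'a set set" where
  "animals R V = {K. K \<subseteq> V \<and> K \<noteq> {} \<and> (\<forall>x\<in>K. ccomp R K x = K)}"

lemma ccomps_animals: "sym R \<Longrightarrow> A \<subseteq> V \<Longrightarrow> ccomps R A \<subseteq> animals R V"
  unfolding animals_def using ccomps_ne ccomps_sub by (fastforce simp: ccomp_within)

text \<open>A connected set of k vertices is the range of a walk with 2 (k - 1) steps, and with
  degree at most m each start admits at most m^(2 (k - 1)) such walks.\<close>

lemma card_animals_le:
  assumes "sym R" "finite V" "\<And>x. finite (R `` {x}) \<and> card (R `` {x}) \<le> m"
  shows "card {K \<in> animals R V. card K = k} \<le> card V * m ^ (2 * (k - 1))"
proof -
  have "{K \<in> animals R V. card K = k} \<subseteq> (\<Union>x\<in>V. set ` walks R (2 * (k - 1)) x)"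
  proof
    fix K assume "K \<in> {K \<in> animals R V. card K = k}"
    then have K: "K \<subseteq> V" "K \<noteq> {}" "\<forall>x\<in>K. ccomp R K x = K" "card K = k" by (auto simp: animals_def)
    then obtain x where x: "x \<in> K" by auto
    then obtain p where "p \<in> walks R (2 * (k - 1)) x" "set p = K"
      using connected_covering_walk[OF assms(1) finite_subset[OF K(1) assms(2)] x] K by auto
    then show "K \<in> (\<Union>x\<in>V. set ` walks R (2 * (k - 1)) x)" using x K(1) by blast
  qed
  then have "card {K \<in> animals R V. card K = k} \<le> card (\<Union>x\<in>V. set ` walks R (2 * (k - 1)) x)"
    using assms(2) walks_card[OF assms(3)] by (intro card_mono) auto
  also have "\<dots> \<le> (\<Sum>x\<in>V. card (set ` walks R (2 * (k - 1)) x))"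
    using assms(2) by (rule card_UN_le)
  also have "\<dots> \<le> (\<Sum>x\<in>V. m ^ (2 * (k - 1)))"
    using walks_card[OF assms(3)] by (intro sum_mono) (meson card_image_le le_trans)
  finally show ?thesis by simp
qed

section \<open>Cuts of the discrete torus\<close>

definition adjT :: "nat \<Rightarrow> nat \<Rightarrow> (nat list \<times> nat list) set" where
  "adjT d L = {(v, w). v \<in> verts d L \<and> w \<in> verts d L \<and>
     (\<exists>j<d. w = nbr L j v \<or> v = nbr L j w)}"

text \<open>An edge is named by its base vertex and its positive direction, so that a set of edges
  is a 1-cochain modulo 2, the form in which \<open>poincare_torus\<close> is stated.\<close>

definition cut :: "nat \<Rightarrow> nat \<Rightarrow> nat list set \<Rightarrow> (nat list \<times> nat) set" where
  "cut d L R = {(v, j). v \<in> verts d L \<and> j < d \<and> (v \<in> R) \<noteq> (nbr L j v \<in> R)}"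

definition edges_btw :: "nat \<Rightarrow> nat \<Rightarrow> nat list set \<Rightarrow> nat list set \<Rightarrow> (nat list \<times> nat) set" where
  "edges_btw d L C K = {(v, j). v \<in> verts d L \<and> j < d \<and>
     (v \<in> C \<and> nbr L j v \<in> K \<or> v \<in> K \<and> nbr L j v \<in> C)}"

lemma verts_eq_lists: "verts d L = {xs. set xs \<subseteq> {..<L} \<and> length xs = d}"
  by (fastforce simp: verts_def set_conv_nth)

lemma finite_verts [simp]: "finite (verts d L)"
  unfolding verts_eq_lists by (rule finite_lists_length_eq) simp

lemma card_verts: "card (verts d L) = L ^ d"
  unfolding verts_eq_lists by (subst card_lists_length_eq) auto

lemma verts_upd: "v \<in> verts d L \<Longrightarrow> k < L \<Longrightarrow> v[j := k] \<in> verts d L"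
  unfolding verts_eq_lists using set_update_subset_insert[of v j k] by auto

lemma verts_length: "v \<in> verts d L \<Longrightarrow> length v = d"
  by (simp add: verts_def)

lemma verts_nth: "v \<in> verts d L \<Longrightarrow> j < d \<Longrightarrow> v ! j < L"
  by (simp add: verts_def)

lemma nbr_nth_neq [simp]: "i \<noteq> j \<Longrightarrow> nbr L i v ! j = v ! j"
  by (simp add: nbr_def)

lemma nbr_nth_eq: "i < length v \<Longrightarrow> nbr L i v ! i = Suc (v ! i) mod L"
  by (simp add: nbr_def)

lemma nbr_commute: "i \<noteq> j \<Longrightarrow> nbr L i (nbr L j v) = nbr L j (nbr L i v)"
  by (simp add: nbr_def list_update_swap)

lemma nbr_upd: "i \<noteq> j \<Longrightarrow> nbr L i (v[j := k]) = (nbr L i v)[j := k]"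
  by (simp add: nbr_def list_update_swap)

lemma nbr_step: "Suc (v ! j) < L \<Longrightarrow> nbr L j v = v[j := Suc (v ! j)]"
  by (simp add: nbr_def)

lemma sym_adjT: "sym (adjT d L)"
  by (auto simp: adjT_def sym_def)

locale torus =
  fixes d L :: nat
  assumes d2: "d \<ge> 2" and L2: "L \<ge> 2"
begin

abbreviation "V \<equiv> verts d L"
abbreviation "N \<equiv> nbr L"
abbreviation "adj \<equiv> adjT d L"

lemma nbr_verts: "v \<in> V \<Longrightarrow> N j v \<in> V"
  using L2 by (auto simp: nbr_def intro!: verts_upd)

lemma adj_nbr: "v \<in> V \<Longrightarrow> j < d \<Longrightarrow> (v, N j v) \<in> adj" "v \<in> V \<Longrightarrow> j < d \<Longrightarrow> (N j v, v) \<in> adj"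
  using nbr_verts by (auto simp: adjT_def)

lemma nbr_inj: "inj_on (N j) V"
proof (rule inj_onI)
  fix v w assume vw: "v \<in> V" "w \<in> V" "N j v = N j w"
  then have len: "length v = d" "length w = d" by (auto simp: verts_def)
  show "v = w"
  proof (rule nth_equalityI)
    fix i assume i: "i < length v"
    show "v ! i = w ! i"
    proof (cases "i = j")
      case True
      then have "Suc (v ! j) mod L = Suc (w ! j) mod L"
        using vw(3) len i nbr_nth_eq[of j v L] nbr_nth_eq[of j w L] by simp
      moreover have "v ! j < L" "w ! j < L" using vw(1,2) True i len by (auto simp: verts_def)
      ultimately show ?thesis using True by (auto simp: mod_Suc split: if_splits)
    next
      case False
      then show ?thesis using vw(3) nbr_nth_neq by metis
    qed
  qed (simp add: len)
qed

text \<open>\<open>v\<close> is turned into \<open>w\<close> one coordinate at a time through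
  \<open>take n w @ drop n v\<close>, each replacement passing through the value 0. Only steps that
  do not wrap around are used, because gauge fixing in \<open>poincare_torus\<close> has no control
  over the wrapping ones before its last stage.\<close>

lemma coord_invariance:
  assumes step: "\<And>v j. v \<in> V \<Longrightarrow> j \<in> J \<Longrightarrow> Suc (v ! j) < L \<Longrightarrow> P (N j v) = P v"
    and J: "J \<subseteq> {..<d}"
    and vw: "v \<in> V" "w \<in> V" "\<And>j. j < d \<Longrightarrow> j \<notin> J \<Longrightarrow> v ! j = w ! j"
  shows "P v = P w"
proof -
  have zero: "P (u[j := k]) = P (u[j := 0])" if u: "u \<in> V" "j \<in> J" "k < L" for u j k
    using u(3)
  proof (induction k)
    case (Suc k)
    have jd: "j < length u" using u J by (auto simp: verts_def)
    have "N j (u[j := k]) = u[j := Suc k]" using Suc.prems jd by (simp add: nbr_def)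
    moreover have "P (N j (u[j := k])) = P (u[j := k])"
      using Suc.prems u jd by (intro step verts_upd) auto
    ultimately show ?case using Suc by simp
  qed simp
  have single: "P (u[j := k]) = P u" if u: "u \<in> V" "j \<in> J" "k < L" for u j k
    using zero[OF u] zero[OF u(1,2), of "u ! j"] u(1) J that(2) by (auto simp: verts_def)
  have "P (take n w @ drop n v) = P v \<and> take n w @ drop n v \<in> V" if "n \<le> d" for n
    using that
  proof (induction n)
    case (Suc n)
    let ?u = "take n w @ drop n v"
    have len: "length v = d" "length w = d" using vw by (auto simp: verts_def)
    have uV: "?u \<in> V" and Pu: "P ?u = P v" using Suc by auto
    have wn: "w ! n < L" using vw(2) Suc.prems by (auto simp: verts_def)
    have eq: "take (Suc n) w @ drop (Suc n) v = ?u[n := w ! n]"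
      using len Suc.prems
      by (simp add: take_Suc_conv_app_nth list_update_append Cons_nth_drop_Suc[symmetric])
    have "P (?u[n := w ! n]) = P ?u"
    proof (cases "n \<in> J")
      case True then show ?thesis using single[OF uV _ wn] by blast
    next
      case False
      then have "?u ! n = w ! n" using vw(3)[of n] Suc.prems len by (simp add: nth_append)
      then show ?thesis by (metis list_update_id)
    qed
    then show ?case using eq Pu verts_upd[OF uV wn] by simp
  qed (use vw in auto)
  from this[of d] show ?thesis using vw by (simp add: verts_def)
qed

lemma torus_connected:
  assumes "v \<in> V" shows "ccomp adj V v = V"
proof
  show "ccomp adj V v \<subseteq> V" using assms by (rule ccomp_subset)
  show "V \<subseteq> ccomp adj V v"
  proof
    fix w assume w: "w \<in> V"
    have "(v \<in> ccomp adj V v) = (w \<in> ccomp adj V v)"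
    proof (rule coord_invariance[where J = "{..<d}" and P = "\<lambda>u. u \<in> ccomp adj V v"])
      fix u j assume u: "u \<in> V" "j \<in> {..<d}" "Suc (u ! j) < L"
      then show "(N j u \<in> ccomp adj V v) = (u \<in> ccomp adj V v)"
        using adj_nbr[of u j] nbr_verts[of u j] ccomp_step[of u adj V v "N j u"]
          ccomp_step[of "N j u" adj V v u] by auto
    qed (use assms w in auto)
    then show "w \<in> ccomp adj V v" by simp
  qed
qed

lemma boundary_nonempty:
  assumes "R \<subseteq> V" "R \<noteq> {}" "R \<noteq> V"
  shows "\<exists>x\<in>R. \<exists>y\<in>V - R. (x, y) \<in> adj"
proof (rule ccontr)
  assume neg: "\<not> ?thesis"
  obtain x where "x \<in> R" using assms(2) by auto
  then have "ccomp adj V x \<subseteq> R" using neg by (intro ccomp_closed) auto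
  then show False using torus_connected[of x] \<open>x \<in> R\<close> assms by auto
qed

text \<open>Successive gauge fixing: once \<open>F\<close> is exact on all non-wrapping edges in the first \<open>m\<close>
  directions, the remainder in direction \<open>m\<close> does not depend on the first \<open>m\<close> coordinates.\<close>

lemma poincare_torus:
  assumes plaq: "\<And>v i j. v \<in> V \<Longrightarrow> i < d \<Longrightarrow> j < d \<Longrightarrow> i \<noteq> j \<Longrightarrow>
      (F v i \<noteq> F (N i v) j) = (F v j \<noteq> F (N j v) i)"
    and loops: "\<And>j. j < d \<Longrightarrow> \<exists>u\<in>V. \<forall>k<L. \<not> F (u[j := k]) j"
  shows "\<exists>g :: nat list \<Rightarrow> bool. \<forall>v\<in>V. \<forall>j<d. F v j = (g v \<noteq> g (N j v))"
proof -
  \<comment> \<open>The remainder of \<open>F\<close> after subtracting the coboundary of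
    \<open>g\<close> modulo 2; it is again closed.\<close>
  define F' where "F' g v j \<longleftrightarrow> F v j \<noteq> (g v \<noteq> g (N j v))" for g :: "nat list \<Rightarrow> bool" and v j
  have plaq': "(F' g v i \<noteq> F' g (N i v) j) = (F' g v j \<noteq> F' g (N j v) i)"
    if "v \<in> V" "i < d" "j < d" "i \<noteq> j" for g v i j
    using plaq[OF that] nbr_commute[OF that(4), of L v] unfolding F'_def by auto
  have "\<exists>g. \<forall>v\<in>V. \<forall>i<m. Suc (v ! i) < L \<longrightarrow> \<not> F' g v i" if "m \<le> d" for m
    using that
  proof (induction m)
    case (Suc m)
    then obtain g where g: "\<forall>v\<in>V. \<forall>i<m. Suc (v ! i) < L \<longrightarrow> \<not> F' g v i" by auto
    have md: "m < d" using Suc.prems by simp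
    have indep: "F' g (N i v) m = F' g v m" if v: "v \<in> V" "i < m" "Suc (v ! i) < L" for v i
    proof -
      have "\<not> F' g v i" using g v by auto
      moreover have "\<not> F' g (N m v) i" using g v nbr_verts[OF v(1), of m] by auto
      ultimately show ?thesis using plaq'[OF v(1), of i m g] v md by auto
    qed
    \<comment> \<open>Discrete integral modulo 2 of the remainder along direction \<open>m\<close>,
      from coordinate 0 up to \<open>k\<close>. It corrects the gauge in direction
      \<open>m\<close>.\<close>
    define hh where "hh v k = rec_nat False (\<lambda>k b. b \<noteq> F' g (v[m := k]) m) k" for v k
    have hh0: "hh v 0 = False" and hhS: "hh v (Suc k) = (hh v k \<noteq> F' g (v[m := k]) m)" for v k
      by (simp_all add: hh_def)
    define h where "h v = hh v (v ! m)" for v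
    have hm: "F' g v m = (h v \<noteq> h (N m v))" if v: "v \<in> V" "Suc (v ! m) < L" for v
    proof -
      have len: "m < length v" using v md by (simp add: verts_def)
      have upd: "hh (v[m := x]) k = hh v k" for x k by (induction k) (simp_all add: hh0 hhS)
      have "h (N m v) = hh v (Suc (v ! m))" using len v(2) upd by (simp add: h_def nbr_step)
      then show ?thesis by (auto simp: hhS h_def)
    qed
    have hi: "h (N i v) = h v" if v: "v \<in> V" "i < m" "Suc (v ! i) < L" for v i
    proof -
      have "hh (N i v) k = hh v k" if "k \<le> L" for k
        using that
      proof (induction k)
        case (Suc k)
        have "F' g ((N i v)[m := k]) m = F' g (v[m := k]) m"
          using indep[of "v[m := k]" i] v Suc.prems verts_upd[OF v(1), of k m] nbr_upd[of i m L v k]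
          by auto
        then show ?case using Suc by (simp add: hhS)
      qed (simp add: hh0)
      moreover have "v ! m \<le> L" using verts_nth[OF v(1) md] by simp
      ultimately show ?thesis using v by (simp add: h_def)
    qed
    have "\<not> F' (\<lambda>v. g v \<noteq> h v) v i" if v: "v \<in> V" "i < Suc m" "Suc (v ! i) < L" for v i
    proof (cases "i = m")
      case True
      then show ?thesis using hm[of v] v unfolding F'_def by auto
    next
      case False
      then have "i < m" using v by simp
      then show ?thesis using hi[of v i] g v unfolding F'_def by auto
    qed
    then show ?case by auto
  qed auto
  from this[of d] obtain g where g: "\<forall>v\<in>V. \<forall>i<d. Suc (v ! i) < L \<longrightarrow> \<not> F' g v i" by auto
  have "\<not> F' g v j" if v: "v \<in> V" "j < d" for v j
  proof (cases "Suc (v ! j) < L")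
    case True then show ?thesis using g v by auto
  next
    case False
    then have vL: "v ! j = L - 1" using verts_nth[OF v] by simp
    obtain u where u: "u \<in> V" "\<forall>k<L. \<not> F (u[j := k]) j" using loops[OF v(2)] by auto
    have len: "j < length u" using u v by (simp add: verts_def)
    define w where "w = u[j := L - 1]"
    have wV: "w \<in> V" using u L2 by (auto simp: w_def intro: verts_upd)
    \<comment> \<open>On wrapping edges in direction \<open>j\<close> the remainder does not depend
      on the other coordinates. It may thus be evaluated on the loop through \<open>u\<close>, where
      \<open>F\<close> vanishes and \<open>g\<close> is constant.\<close>
    have "F' g v j = F' g w j"
    proof (rule coord_invariance[where J = "{..<d} - {j}" and P = "\<lambda>v. F' g v j"])
      fix x i assume x: "x \<in> V" "i \<in> {..<d} - {j}" "Suc (x ! i) < L"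
      have "\<not> F' g x i" "\<not> F' g (N j x) i" using g x nbr_verts[of x j] by auto
      then show "F' g (N i x) j = F' g x j" using plaq'[of x i j g] x v by auto
    qed (use v wV vL len in \<open>auto simp: w_def\<close>)
    moreover have "g (u[j := k]) = g (u[j := 0])" if "k < L" for k
      using that
    proof (induction k)
      case (Suc k)
      have "\<not> F' g (u[j := k]) j" using g verts_upd[OF u(1), of k j] Suc.prems v len by auto
      moreover have "\<not> F (u[j := k]) j" using u(2) Suc.prems by simp
      moreover have "N j (u[j := k]) = u[j := Suc k]" using Suc.prems len by (simp add: nbr_step)
      ultimately have "g (u[j := Suc k]) = g (u[j := k])" unfolding F'_def by simp
      then show ?case using Suc.IH Suc.prems by simp
    qed simp
    from this[of "L - 1"] have "g w = g (u[j := 0])" using L2 by (simp add: w_def)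
    then have "\<not> F' g w j" using u(2) L2 len unfolding F'_def w_def by (simp add: nbr_def)
    ultimately show ?thesis by simp
  qed
  then have "\<forall>v\<in>V. \<forall>j<d. F v j = (g v \<noteq> g (N j v))" unfolding F'_def by simp
  then show ?thesis by (intro exI[of _ g])
qed

text \<open>Pigeonhole: each edge rules out a single value of coordinate \<open>c\<close>.\<close>

lemma free_coordinate:
  assumes "finite X" "card X < L"
  shows "\<exists>i<L. \<forall>(v, j)\<in>X. v ! c \<noteq> i"
proof (rule ccontr)
  assume "\<not> ?thesis"
  then have "{..<L} \<subseteq> (\<lambda>(v, j). v ! c) ` X" by (fastforce simp: image_iff)
  then have "card {..<L} \<le> card X" using assms(1) surj_card_le by blast
  then show False using assms(2) by simp
qed

lemma cut_finite [simp]: "finite (cut d L R)"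
  by (rule finite_subset[of _ "V \<times> {..<d}"]) (auto simp: cut_def)

lemma edges_btw_finite [simp]: "finite (edges_btw d L C K)"
  by (rule finite_subset[of _ "V \<times> {..<d}"]) (auto simp: edges_btw_def)

text \<open>The hyperplane of a free coordinate contains no base vertex of a cut edge, and the
  directions other than \<open>c\<close> connect it, so it lies on one side.\<close>

lemma hyperplane_pure:
  assumes "R \<subseteq> V" "card (cut d L R) < L" "c < d"
  shows "\<exists>i<L. \<forall>v\<in>V. \<forall>w\<in>V. v ! c = i \<longrightarrow> w ! c = i \<longrightarrow> (v \<in> R) = (w \<in> R)"
proof -
  obtain i where i: "i < L" "\<forall>(v, j)\<in>cut d L R. v ! c \<noteq> i"
    using free_coordinate[OF cut_finite assms(2)] by blast
  have "(v \<in> R) = (w \<in> R)" if vw: "v \<in> V" "w \<in> V" "v ! c = i" "w ! c = i" for v w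
  proof -
    have "(v ! c = i \<longrightarrow> v \<in> R) = (w ! c = i \<longrightarrow> w \<in> R)"
    proof (rule coord_invariance[where J = "{..<d} - {c}" and P = "\<lambda>v. v ! c = i \<longrightarrow> v \<in> R"])
      fix x j assume x: "x \<in> V" "j \<in> {..<d} - {c}" "Suc (x ! j) < L"
      show "(N j x ! c = i \<longrightarrow> N j x \<in> R) = (x ! c = i \<longrightarrow> x \<in> R)"
        using i(2) x by (auto simp: cut_def)
    qed (use vw in auto)
    then show ?thesis using vw by simp
  qed
  then show ?thesis using i(1) by blast
qed

lemma cut_on_line:
  assumes "R \<subseteq> V" "x \<in> V" "c < d" "i < L" "(x \<in> R) \<noteq> (x[c := i] \<in> R)"
  shows "\<exists>k<L. (x[c := k], c) \<in> cut d L R"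
proof (rule ccontr)
  assume neg: "\<not> ?thesis"
  have len: "c < length x" using assms by (simp add: verts_def)
  have "(x[c := k] \<in> R) = (x[c := 0] \<in> R)" if "k < L" for k
    using that
  proof (induction k)
    case (Suc k)
    have "x[c := k] \<in> V" using assms(2) Suc.prems by (auto intro: verts_upd)
    moreover have "(x[c := k], c) \<notin> cut d L R" using neg Suc.prems by simp
    ultimately show ?case using Suc assms(3) len by (simp add: cut_def nbr_step)
  qed simp
  from this[OF assms(4)] this[OF verts_nth[OF assms(2,3)]] assms(5) show False by simp
qed

text \<open>A cut with fewer than \<open>L\<close> edges misses a hyperplane in each of two directions. These meet, so
  they lie on the same side, and every line in either direction through the other side is cut.\<close>

lemma isoperimetry:
  assumes R: "R \<subseteq> V"
  shows "min (card R) (card (V - R)) \<le> card (cut d L R) ^ d"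
proof (cases "card (cut d L R) < L")
  \<comment> \<open>With at least \<open>L\<close> cut edges the bound holds because |V| = L^d; this
    case dictates the exponent \<open>d\<close>.\<close>
  case False
  have "card R \<le> card V" using R by (simp add: card_mono)
  also have "\<dots> \<le> card (cut d L R) ^ d" using False by (simp add: card_verts power_mono)
  finally show ?thesis by simp
next
  case True
  obtain i where i: "i < L" "\<forall>v\<in>V. \<forall>w\<in>V. v ! 0 = i \<longrightarrow> w ! 0 = i \<longrightarrow> (v \<in> R) = (w \<in> R)"
    using hyperplane_pure[OF R True, of 0] d2 by auto
  obtain k where k: "k < L" "\<forall>v\<in>V. \<forall>w\<in>V. v ! 1 = k \<longrightarrow> w ! 1 = k \<longrightarrow> (v \<in> R) = (w \<in> R)"
    using hyperplane_pure[OF R True, of 1] d2 by auto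
  define z where "z = (replicate d 0)[0 := i, 1 := k]"
  have "replicate d 0 \<in> V" using L2 by (simp add: verts_def)
  then have zV: "z \<in> V" using i k by (simp add: z_def verts_upd)
  have z01: "z ! 0 = i" "z ! 1 = k" using d2 by (auto simp: z_def nth_list_update)
  define S where "S = {x \<in> V. (x \<in> R) \<noteq> (z \<in> R)}"
  have "S = R \<or> S = V - R" using R by (auto simp: S_def)
  have e0: "\<exists>m<L. (x[0 := m], 0) \<in> cut d L R" if x: "x \<in> S" for x
  proof (rule cut_on_line[OF R])
    show "x \<in> V" using x by (simp add: S_def)
    then have "x[0 := i] \<in> V" "x[0 := i] ! 0 = i"
      using i(1) d2 verts_upd by (auto simp: verts_length)
    then have "(x[0 := i] \<in> R) = (z \<in> R)" using i(2) zV z01 by blast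
    then show "(x \<in> R) \<noteq> (x[0 := i] \<in> R)" using x by (simp add: S_def)
  qed (use i d2 in auto)
  have e1: "\<exists>m<L. (x[1 := m], 1) \<in> cut d L R" if x: "x \<in> S" for x
  proof (rule cut_on_line[OF R])
    show "x \<in> V" using x by (simp add: S_def)
    then have "x[1 := k] \<in> V" "x[1 := k] ! 1 = k"
      using k(1) d2 verts_upd by (auto simp: verts_length)
    then have "(x[1 := k] \<in> R) = (z \<in> R)" using k(2) zV z01 by blast
    then show "(x \<in> R) \<noteq> (x[1 := k] \<in> R)" using x by (simp add: S_def)
  qed (use k d2 in auto)
  obtain f0 where f0: "\<And>x. x \<in> S \<Longrightarrow> (x[0 := f0 x], 0) \<in> cut d L R" using e0 by metis
  obtain f1 where f1: "\<And>x. x \<in> S \<Longrightarrow> (x[1 := f1 x], 1) \<in> cut d L R" using e1 by metis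
  \<comment> \<open>The first cut edge determines all coordinates of \<open>x\<close> except 0, the
    second all except 1. The pair determines \<open>x\<close>, so |S| is at most the square of the
    size of the cut.\<close>
  define \<phi> where "\<phi> x = ((x[0 := f0 x], 0::nat), (x[1 := f1 x], 1::nat))" for x
  have "inj_on \<phi> S"
  proof (rule inj_onI)
    fix x y assume xy: "x \<in> S" "y \<in> S" "\<phi> x = \<phi> y"
    then have len: "length x = d" "length y = d" by (auto simp: S_def verts_def)
    have eq: "x[0 := f0 x] = y[0 := f0 y]" "x[1 := f1 x] = y[1 := f1 y]"
      using xy(3) by (auto simp: \<phi>_def)
    show "x = y"
    proof (rule nth_equalityI)
      fix n assume "n < length x"
      show "x ! n = y ! n"
      proof (cases "n = 0")
        case True
        then show ?thesis using arg_cong[OF eq(2), of "\<lambda>l. l ! 0"] by simp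
      next
        case False
        then show ?thesis using arg_cong[OF eq(1), of "\<lambda>l. l ! n"] by simp
      qed
    qed (simp add: len)
  qed
  moreover have "\<phi> ` S \<subseteq> cut d L R \<times> cut d L R" using f0 f1 by (auto simp: \<phi>_def)
  ultimately have "card S \<le> card (cut d L R \<times> cut d L R)" by (intro card_inj_on_le) auto
  also have "\<dots> = card (cut d L R) ^ 2" by (simp add: card_cartesian_product power2_eq_square)
  finally have S2: "card S \<le> card (cut d L R) ^ 2" .
  have "card S \<le> card (cut d L R) ^ d"
  proof (cases "card (cut d L R) = 0")
    case True then show ?thesis using S2 by simp
  next
    case False
    then show ?thesis using S2 power_increasing[OF d2, of "card (cut d L R)"] by linarith
  qed
  then show ?thesis using \<open>S = R \<or> S = V - R\<close> by auto
qed

end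

section \<open>Closed clusters and the Peierls estimate\<close>

text \<open>Two boundary vertices of a cut that lie in a common plaquette are at distance at most 2; this
  is the adjacency used for clusters of empty vertices.\<close>

definition near :: "nat \<Rightarrow> nat \<Rightarrow> (nat list \<times> nat list) set" where
  "near d L = adjT d L \<union> adjT d L O adjT d L"

text \<open>Depends on \<open>K\<close> alone and not on the rest of the configuration, so that its
  size can enter the weight attached to \<open>K\<close> in the Peierls sum.\<close>

definition separated :: "nat \<Rightarrow> nat \<Rightarrow> nat list set \<Rightarrow> (nat list \<times> nat list) set" where
  "separated d L K = {(v, w). v \<in> verts d L - K \<and> w \<in> verts d L - K \<and>
     w \<notin> ccomp (adjT d L) (verts d L - K) v}"

text \<open>Pairs with an empty vertex are included, so that the complementary pairs number exactly
  the sum of |C|^2 over the components.\<close>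

definition disconnected :: "nat \<Rightarrow> nat \<Rightarrow> nat list set \<Rightarrow> (nat list \<times> nat list) set" where
  "disconnected d L A = {(v, w). v \<in> verts d L \<and> w \<in> verts d L \<and>
     \<not> (v \<in> A \<and> w \<in> A \<and> w \<in> ccomp (adjT d L) A v)}"

lemma sym_near: "sym (near d L)"
proof (rule symI)
  fix x y assume "(x, y) \<in> near d L"
  moreover have "(b, a) \<in> adjT d L" if "(a, b) \<in> adjT d L" for a b
    using sym_adjT that by (rule symD)
  ultimately show "(y, x) \<in> near d L" unfolding near_def by blast
qed

lemma adjT_subset: "adjT d L \<subseteq> verts d L \<times> verts d L"
  by (auto simp: adjT_def)

lemma sum_power_le_power_sum:
  fixes g :: "'b \<Rightarrow> nat"
  assumes "finite X" "n \<ge> 1"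
  shows "(\<Sum>x\<in>X. g x ^ n) \<le> (\<Sum>x\<in>X. g x) ^ n"
  using assms(1)
proof (induction rule: finite_induct)
  case (insert x F)
  have "a ^ n + b ^ n \<le> (a + b) ^ n" for a b :: nat
    using assms(2)
  proof (induction n rule: nat_induct_at_least)
    case (Suc n)
    have "a ^ Suc n + b ^ Suc n \<le> (a + b) * (a ^ n + b ^ n)" by (simp add: algebra_simps)
    also have "\<dots> \<le> (a + b) * (a + b) ^ n" using Suc by (intro mult_left_mono) auto
    finally show ?case by simp
  qed simp
  then show ?case using insert by (simp add: order_trans[OF add_left_mono])
qed (use assms in auto)

context torus
begin

abbreviation "near2 \<equiv> near d L"

lemma adj_sym: "(x, y) \<in> adj \<Longrightarrow> (y, x) \<in> adj"
  using sym_adjT by (auto simp: sym_def)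

text \<open>If \<open>F\<close> has fewer than \<open>L\<close> edges, it misses a straight loop in every direction, so its
  indicator, which is closed modulo 2, is a coboundary. Both \<open>R\<close> and its complement are connected,
  hence this coboundary is all of \<open>cut d L R\<close>.\<close>

lemma cut_dichotomy:
  assumes C: "C \<subseteq> V" "C \<noteq> {}" "\<And>c. c \<in> C \<Longrightarrow> ccomp adj C c = C"
    and w: "w \<in> V - C" and R: "R = ccomp adj (V - C) w"
    and cons: "\<And>x y x' y'. x \<in> R \<Longrightarrow> y \<in> R \<Longrightarrow> x' \<in> V - R \<Longrightarrow> y' \<in> V - R \<Longrightarrow>
      (x, x') \<in> adj \<Longrightarrow> (y, y') \<in> adj \<Longrightarrow> (x, y) \<in> near2 \<Longrightarrow> (x \<in> K) = (y \<in> K)"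
    and F: "F = {(v, j) \<in> cut d L R. (if v \<in> R then v else N j v) \<in> K}" "F \<noteq> {}"
  shows "F = cut d L R \<or> L \<le> card F"
proof (rule disjCI)
  assume "\<not> L \<le> card F"
  then have small: "card F < L" by simp
  have finF: "finite F" using F by (auto intro: finite_subset[of _ "cut d L R"])
  have RV: "R \<subseteq> V - C" unfolding R using w by (intro ccomp_subset) auto
  have out: "y \<in> C" if "x \<in> R" "y \<notin> R" "y \<in> V" "(x, y) \<in> adj" for x y
    using that RV ccomp_step[of x adj "V - C" w y] unfolding R by blast
  have "\<exists>g :: nat list \<Rightarrow> bool. \<forall>v\<in>V. \<forall>j<d. ((v, j) \<in> F) = (g v \<noteq> g (N j v))"
  proof (rule poincare_torus[where F = "\<lambda>v j. (v, j) \<in> F"])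
    fix v i j assume v: "v \<in> V" "i < d" "j < d" "i \<noteq> j"
    define p q r s where "p = v" "q = N i v" "r = N j v" "s = N j (N i v)"
    have s: "N i r = s" "N j q = s" using nbr_commute[OF v(4)] by (auto simp: p_q_r_s_def)
    have inV: "p \<in> V" "q \<in> V" "r \<in> V" "s \<in> V" using v nbr_verts by (auto simp: p_q_r_s_def)
    have e: "(p, q) \<in> adj" "(p, r) \<in> adj" "(q, s) \<in> adj" "(r, s) \<in> adj"
      using v inV adj_nbr s unfolding p_q_r_s_def by metis+
    note e' = e[THEN adj_sym]
    have n: "(p, q) \<in> near2" "(p, r) \<in> near2" "(q, s) \<in> near2" "(r, s) \<in> near2" "(p, s) \<in> near2" "(q, r) \<in> near2"
      using e e' by (auto simp: near_def)
    have pq: "p \<in> R \<Longrightarrow> q \<in> R \<Longrightarrow> r \<notin> R \<Longrightarrow> s \<notin> R \<Longrightarrow> (p \<in> K) = (q \<in> K)"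
      using cons[of p q r s] e e' inV n by blast
    have pr: "p \<in> R \<Longrightarrow> r \<in> R \<Longrightarrow> q \<notin> R \<Longrightarrow> s \<notin> R \<Longrightarrow> (p \<in> K) = (r \<in> K)"
      using cons[of p r q s] e e' inV n by blast
    have qs: "q \<in> R \<Longrightarrow> s \<in> R \<Longrightarrow> p \<notin> R \<Longrightarrow> r \<notin> R \<Longrightarrow> (q \<in> K) = (s \<in> K)"
      using cons[of q s p r] e e' inV n by blast
    have rs: "r \<in> R \<Longrightarrow> s \<in> R \<Longrightarrow> p \<notin> R \<Longrightarrow> q \<notin> R \<Longrightarrow> (r \<in> K) = (s \<in> K)"
      using cons[of r s p q] e e' inV n by blast
    have ps: "p \<in> R \<Longrightarrow> s \<in> R \<Longrightarrow> q \<notin> R \<or> r \<notin> R \<Longrightarrow> (p \<in> K) = (s \<in> K)"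
      using cons[of p s q q] cons[of p s r r] e e' inV n by blast
    have qr: "q \<in> R \<Longrightarrow> r \<in> R \<Longrightarrow> p \<notin> R \<or> s \<notin> R \<Longrightarrow> (q \<in> K) = (r \<in> K)"
      using cons[of q r p p] cons[of q r s s] e e' inV n by blast
    have mem: "(p, i) \<in> F \<longleftrightarrow> p \<in> R \<and> q \<notin> R \<and> p \<in> K \<or> q \<in> R \<and> p \<notin> R \<and> q \<in> K"
      "(q, j) \<in> F \<longleftrightarrow> q \<in> R \<and> s \<notin> R \<and> q \<in> K \<or> s \<in> R \<and> q \<notin> R \<and> s \<in> K"
      "(p, j) \<in> F \<longleftrightarrow> p \<in> R \<and> r \<notin> R \<and> p \<in> K \<or> r \<in> R \<and> p \<notin> R \<and> r \<in> K"
      "(r, i) \<in> F \<longleftrightarrow> r \<in> R \<and> s \<notin> R \<and> r \<in> K \<or> s \<in> R \<and> r \<notin> R \<and> s \<in> K"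
      using inV v s unfolding F(1) by (auto simp: cut_def p_q_r_s_def)
    \<comment> \<open>The cut crosses the four sides of a plaquette an even number of times. The
      ends in \<open>R\<close> of these crossings are near each other, hence all or none of them lie
      in \<open>K\<close>, and \<open>F\<close> inherits the even parity.\<close>
    have "((p, i) \<in> F) \<noteq> ((q, j) \<in> F) \<longleftrightarrow> ((p, j) \<in> F) \<noteq> ((r, i) \<in> F)"
      unfolding mem using pq pr qs rs ps qr
      by argo
    then show "(((v, i) \<in> F) \<noteq> ((N i v, j) \<in> F)) = (((v, j) \<in> F) \<noteq> ((N j v, i) \<in> F))"
      by (simp add: p_q_r_s_def)
  next
    fix j assume j: "j < d"
    \<comment> \<open>The loop in direction \<open>j\<close> is placed in a hyperplane of another
      direction \<open>c\<close> that is free of \<open>F\<close>; such a \<open>c\<close> exists by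
      \<open>d2\<close>.\<close>
    define c where "c = (if j = 0 then 1 else 0 :: nat)"
    have c: "c < d" "c \<noteq> j" using d2 by (auto simp: c_def)
    obtain i where i: "i < L" "\<forall>(v, j)\<in>F. v ! c \<noteq> i" using free_coordinate[OF finF small] by blast
    have "(replicate d 0)[c := i] \<in> V" using L2 i by (intro verts_upd) (auto simp: verts_def)
    moreover have "((replicate d 0)[c := i])[j := k] ! c = i" for k using c by simp
    ultimately show "\<exists>u\<in>V. \<forall>k<L. (u[j := k], j) \<notin> F" using i(2) by blast
  qed
  then obtain g :: "nat list \<Rightarrow> bool" where g: "\<forall>v\<in>V. \<forall>j<d. ((v, j) \<in> F) = (g v \<noteq> g (N j v))" by blast
  have same: "g x = g y" if xy: "(x, y) \<in> adj" "(x \<in> R) = (y \<in> R)" for x y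
  proof -
    have "x \<in> V" "y \<in> V" and "\<exists>j<d. y = N j x \<or> x = N j y" using xy(1) by (auto simp: adjT_def)
    moreover have "(u, j) \<notin> F" if "(u \<in> R) = (N j u \<in> R)" for u j using that by (auto simp: F(1) cut_def)
    ultimately show ?thesis using g xy(2) by metis
  qed
  have gR: "g x = g w" if "x \<in> R" for x
    using that unfolding R
  proof (induction rule: ccomp_induct)
    case (step y z)
    then have "y \<in> R" "z \<in> R" using ccomp_step[of y adj "V - C" w z] by (auto simp: R)
    then show ?case using same[of y z] step by auto
  qed simp
  obtain c where c: "c \<in> C" using C(2) by auto
  have gC: "g x = g c" if "x \<in> C" for x
  proof -
    have "x \<in> ccomp adj C c" using C(3)[OF c] that by simp
    then show ?thesis
    proof (induction rule: ccomp_induct)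
      case (step y z)
      then have "y \<notin> R" "z \<notin> R" using RV by auto
      then show ?case using same[of y z] step by auto
    qed simp
  qed
  \<comment> \<open>Any further component of \<open>V - C\<close> borders \<open>C\<close> along
    edges outside the cut of \<open>R\<close>, so it carries the value that \<open>g\<close> has on
    \<open>C\<close>.\<close>
  have gO: "g x = g c" if x: "x \<in> V - R" for x
  proof (cases "x \<in> C")
    case True then show ?thesis by (rule gC)
  next
    case False
    define Y where "Y = ccomp adj (V - C) x"
    have YV: "Y \<subseteq> V - C" using x False by (auto simp: Y_def dest: ccomp_subset[THEN subsetD, rotated])
    have YR: "Y \<inter> R = {}"
    proof (rule ccontr)
      assume "Y \<inter> R \<noteq> {}"
      then obtain y where "y \<in> Y" "y \<in> R" by auto
      then have "Y = R" using ccomp_eq[OF sym_adjT] unfolding Y_def R by metis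
      then show False using x ccomp_self[of x adj "V - C"] by (auto simp: Y_def)
    qed
    have "x \<in> Y" by (simp add: Y_def)
    moreover have "c \<notin> Y" "c \<in> V" using YV c C(1) by auto
    ultimately have "Y \<noteq> {}" "Y \<noteq> V" by auto
    then obtain y z where yz: "y \<in> Y" "z \<in> V - Y" "(y, z) \<in> adj"
      using boundary_nonempty[of Y] YV by blast
    have "z \<in> C"
    proof (rule ccontr)
      assume "z \<notin> C"
      then have "z \<in> Y" using yz YV ccomp_step[of y adj "V - C" x z] by (auto simp: Y_def)
      then show False using yz by simp
    qed
    have gY: "g u = g x" if "u \<in> Y" for u
      using that unfolding Y_def
    proof (induction rule: ccomp_induct)
      case (step a b)
      then have "a \<in> Y" "b \<in> Y" using ccomp_step[of a adj "V - C" x b] by (auto simp: Y_def)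
      then show ?case using same[of a b] step YR by auto
    qed simp
    have "g y = g z" using yz YR \<open>z \<in> C\<close> RV by (intro same) auto
    then show ?thesis using gY[OF yz(1)] gC[OF \<open>z \<in> C\<close>] by simp
  qed
  \<comment> \<open>A single edge in \<open>F\<close> forces different values of \<open>g\<close> on
    the two sides, and then every cut edge lies in \<open>F\<close>.\<close>
  obtain v j where vj: "(v, j) \<in> F" using F(2) by auto
  then have vj': "v \<in> V" "j < d" "(v \<in> R) \<noteq> (N j v \<in> R)" by (auto simp: F(1) cut_def)
  then have "g v \<noteq> g (N j v)" using g vj by auto
  then have wc: "g w \<noteq> g c" using vj' gR gO nbr_verts[OF vj'(1), of j] by (metis DiffI)
  show "F = cut d L R"
  proof
    show "F \<subseteq> cut d L R" by (auto simp: F(1))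
    show "cut d L R \<subseteq> F"
    proof (clarify)
      fix u k assume "(u, k) \<in> cut d L R"
      then have u: "u \<in> V" "k < d" "(u \<in> R) \<noteq> (N k u \<in> R)" by (auto simp: cut_def)
      then have "g u \<noteq> g (N k u)" using gR gO nbr_verts[OF u(1), of k] wc by (metis DiffI)
      then show "(u, k) \<in> F" using g u by auto
    qed
  qed
qed

text \<open>\<open>R\<close> is a component of \<open>V - C\<close>, so it can be left only into
  \<open>C\<close>; and an occupied neighbour of the component \<open>C\<close> would belong to
  \<open>C\<close>. Hence the cut runs between \<open>C\<close> and empty vertices.\<close>

lemma complement_component:
  assumes A: "A \<subseteq> V" "C \<in> ccomps adj A" and w: "w \<in> V - C" and R: "R = ccomp adj (V - C) w"
    and xy: "x \<in> R" "y \<in> V - R" "(x, y) \<in> adj"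
  shows "y \<in> C" "x \<in> V - A"
proof -
  have RV: "R \<subseteq> V - C" unfolding R using w by (intro ccomp_subset) auto
  show yC: "y \<in> C" using xy RV ccomp_step[of x adj "V - C" w y] unfolding R by blast
  show "x \<in> V - A"
    using ccomps_adj[OF sym_adjT A(2) yC adj_sym[OF xy(3)]] xy(1) RV by auto
qed

text \<open>The consistency condition of \<open>cut_dichotomy\<close> holds because the ends of the
  cut in \<open>R\<close> are empty and \<open>K\<close> is a full cluster for
  \<open>near2\<close>.\<close>

lemma cut_component_dichotomy:
  assumes A: "A \<subseteq> V" "C \<in> ccomps adj A" and w: "w \<in> V - C" and R: "R = ccomp adj (V - C) w"
    and K: "K \<in> ccomps near2 (V - A)"
    and F: "F = {(v, j) \<in> cut d L R. (if v \<in> R then v else N j v) \<in> K}" "F \<noteq> {}"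
  shows "F = cut d L R \<or> L \<le> card F"
proof (rule cut_dichotomy[OF _ _ _ w R _ F])
  show "C \<subseteq> V" "C \<noteq> {}" using ccomps_sub[OF A(2)] A(1) ccomps_ne[OF A(2)] by auto
  show "ccomp adj C c = C" if "c \<in> C" for c using ccomp_within[OF sym_adjT A(2) that] .
  fix x y x' y' assume h: "x \<in> R" "y \<in> R" "x' \<in> V - R" "y' \<in> V - R"
    "(x, x') \<in> adj" "(y, y') \<in> adj" "(x, y) \<in> near2"
  then have "x \<in> V - A" "y \<in> V - A" using complement_component(2)[OF A w R] by auto
  moreover have "(y, x) \<in> near2" using h(7) sym_near by (auto simp: sym_def)
  ultimately show "(x \<in> K) = (y \<in> K)" using ccomps_adj[OF sym_near K] h(7) by blast
qed

lemma part_of_cut_subset: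
  assumes A: "A \<subseteq> V" "C \<in> ccomps adj A" and w: "w \<in> V - C" and R: "R = ccomp adj (V - C) w"
    and F: "F = {(v, j) \<in> cut d L R. (if v \<in> R then v else N j v) \<in> K}"
  shows "F \<subseteq> edges_btw d L C K"
proof (clarify)
  fix v j assume "(v, j) \<in> F"
  then have vj: "v \<in> V" "j < d" "(v \<in> R) \<noteq> (N j v \<in> R)" "(if v \<in> R then v else N j v) \<in> K"
    by (auto simp: F cut_def)
  have NV: "N j v \<in> V" using vj nbr_verts by auto
  show "(v, j) \<in> edges_btw d L C K"
  proof (cases "v \<in> R")
    case True
    then have "N j v \<in> C" using complement_component(1)[OF A w R True] vj NV adj_nbr by auto
    then show ?thesis using True vj by (auto simp: edges_btw_def)
  next
    case False
    then have "v \<in> C" using complement_component(1)[OF A w R, of "N j v" v] vj NV adj_nbr by auto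
    then show ?thesis using False vj by (auto simp: edges_btw_def)
  qed
qed

text \<open>\<open>K\<close> is connected for \<open>near2\<close>, so some step of it leaves
  \<open>R\<close>. If this step passes through a middle vertex \<open>z\<close>, then
  \<open>z\<close> is already outside \<open>R\<close>, since from \<open>R\<close> one leaves only
  into \<open>C\<close>, which \<open>K\<close> avoids.\<close>

lemma near_path_hits_boundary:
  assumes A: "A \<subseteq> V" "C \<in> ccomps adj A" and w: "w \<in> V - C" and R: "R = ccomp adj (V - C) w"
    and K: "K \<in> ccomps near2 (V - A)"
    and k: "k0 \<in> K" "k0 \<in> R" "k1 \<in> K" "k1 \<notin> R"
  shows "\<exists>x\<in>K \<inter> R. \<exists>y\<in>V - R. (x, y) \<in> adj"
proof -
  have KV: "K \<subseteq> V - A" using ccomps_sub[OF K] .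
  have KC: "K \<inter> C = {}" using KV ccomps_sub[OF A(2)] by auto
  have "\<exists>x\<in>K \<inter> R. \<exists>y\<in>K - R. (x, y) \<in> near2"
  proof (rule ccontr)
    assume neg: "\<not> ?thesis"
    have "ccomp near2 K k0 \<subseteq> R" using neg k by (intro ccomp_closed) auto
    then show False using ccomp_within[OF sym_near K k(1)] k by auto
  qed
  then obtain x y where xy: "x \<in> K \<inter> R" "y \<in> K - R" "(x, y) \<in> near2" by auto
  show ?thesis
  proof (cases "(x, y) \<in> adj")
    case True then show ?thesis using xy KV by auto
  next
    case False
    then obtain z where z: "(x, z) \<in> adj" "(z, y) \<in> adj" using xy(3) by (auto simp: near_def)
    have zV: "z \<in> V" using z adjT_subset by auto
    have "z \<notin> R"
    proof
      assume "z \<in> R"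
      then have "y \<in> C" using complement_component(1)[OF A w R _ _ z(2)] xy KV by auto
      then show False using xy KC by auto
    qed
    then show ?thesis using xy z zV by auto
  qed
qed

text \<open>\<open>C\<close> lies on one side of the cut and \<open>M\<close>, which is no smaller,
  on the other, so both sides have at least |C| vertices.\<close>

lemma card_cut_ge:
  assumes A: "A \<subseteq> V" "C \<in> ccomps adj A" and w: "w \<in> V - C" and R: "R = ccomp adj (V - C) w"
    and M: "M \<subseteq> R" "card C \<le> card M"
  shows "card C \<le> card (cut d L R) ^ d"
proof -
  have RV: "R \<subseteq> V - C" unfolding R using w by (intro ccomp_subset) auto
  have "card M \<le> card R" using M(1) RV finite_subset[of R V] by (intro card_mono) auto
  moreover have "card C \<le> card (V - R)"
    using RV ccomps_sub[OF A(2)] A(1) by (intro card_mono) auto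
  ultimately have "card C \<le> min (card R) (card (V - R))" using M(2) by simp
  then show ?thesis using isoperimetry[of R] RV by (meson Diff_subset order_trans)
qed

text \<open>\<open>R\<close> is the component of \<open>V - C\<close> that contains
  \<open>M\<close>. Since \<open>K\<close> touches \<open>M\<close>, it meets \<open>R\<close>;
  since it also touches \<open>C\<close>, some cut edge lies at \<open>K\<close>. If all of the cut
  does, \<open>card_cut_ge\<close> bounds |C|; otherwise at least \<open>L\<close> edges do, and |C|
  <= L^d suffices.\<close>

lemma touching_size:
  assumes A: "A \<subseteq> V" and K: "K \<in> ccomps near2 (V - A)"
    and CM: "C \<in> touching adj A K" "M \<in> touching adj A K" "C \<noteq> M" "card C \<le> card M"
  shows "card C \<le> card (edges_btw d L C K) ^ d"
proof -
  have Cc: "C \<in> ccomps adj A" and Mc: "M \<in> ccomps adj A" using CM by (auto simp: touching_def)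
  have KV: "K \<subseteq> V - A" using ccomps_sub[OF K] .
  obtain k0 m where km: "k0 \<in> K" "m \<in> M" "(k0, m) \<in> adj" using CM by (auto simp: touching_def)
  obtain k1 c where kc: "k1 \<in> K" "c \<in> C" "(k1, c) \<in> adj" using CM by (auto simp: touching_def)
  have disj: "C \<inter> M = {}" using ccomps_disj[OF sym_adjT Cc Mc CM(3)] .
  have w: "m \<in> V - C" using km disj ccomps_sub[OF Mc] A by auto
  define R where "R = ccomp adj (V - C) m"
  have RV: "R \<subseteq> V - C" unfolding R_def using w by (intro ccomp_subset) auto
  have "M = ccomp adj M m" using ccomp_within[OF sym_adjT Mc km(2)] by simp
  also have "\<dots> \<subseteq> R" unfolding R_def using disj ccomps_sub[OF Mc] A by (intro ccomp_mono) auto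
  finally have MR: "M \<subseteq> R" .
  have AC: "C \<subseteq> A" using ccomps_sub[OF Cc] .
  have k0R: "k0 \<in> R" unfolding R_def
    using km KV AC w by (intro ccomp_step[OF ccomp_self adj_sym]) auto
  have "\<exists>x\<in>K \<inter> R. \<exists>y\<in>V - R. (x, y) \<in> adj"
  proof (cases "k1 \<in> R")
    case True
    then show ?thesis using kc RV AC A by (intro bexI[of _ k1] bexI[of _ c]) auto
  next
    case False
    then show ?thesis using near_path_hits_boundary[OF A Cc w R_def K km(1) k0R kc(1)] by simp
  qed
  then obtain x y where xy: "x \<in> K \<inter> R" "y \<in> V - R" "(x, y) \<in> adj" by auto
  define F where "F = {(v, j) \<in> cut d L R. (if v \<in> R then v else N j v) \<in> K}"
  have xV: "x \<in> V" using xy(1) KV by auto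
  obtain j where "j < d" "y = N j x \<or> x = N j y" using xy(3) by (auto simp: adjT_def)
  then have "(x, j) \<in> F \<or> (y, j) \<in> F" using xy xV by (auto simp: F_def cut_def)
  then have Fne: "F \<noteq> {}" by auto
  have FE: "F \<subseteq> edges_btw d L C K" by (rule part_of_cut_subset[OF A Cc w R_def F_def])
  have "card C \<le> card F ^ d"
    using cut_component_dichotomy[OF A Cc w R_def K F_def Fne]
  proof
    assume "F = cut d L R"
    then show ?thesis using card_cut_ge[OF A Cc w R_def MR CM(4)] by simp
  next
    assume "L \<le> card F"
    then have "L ^ d \<le> card F ^ d" by (rule power_mono) simp
    moreover have "card C \<le> card V" using AC A by (intro card_mono) auto
    ultimately show ?thesis by (simp add: card_verts)
  qed
  also have "\<dots> \<le> card (edges_btw d L C K) ^ d" using FE by (intro power_mono card_mono) auto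
  finally show ?thesis .
qed

text \<open>Each edge is charged to its end in \<open>K\<close>, which has \<open>d\<close> edges
  going out and at most \<open>d\<close> coming in. Different components use different edges, being
  disjoint from each other and from \<open>K\<close>.\<close>

lemma sum_edges_btw:
  assumes A: "A \<subseteq> V" and K: "K \<subseteq> V - A" and X: "X \<subseteq> ccomps adj A"
  shows "(\<Sum>C\<in>X. card (edges_btw d L C K)) \<le> 2 * d * card K"
proof -
  have finA: "finite A" "finite K"
    using A K finite_subset[OF A] finite_subset[of K V] by auto
  have finX: "finite X" using X finA finite_subset by fastforce
  have "(\<Sum>C\<in>X. card (edges_btw d L C K)) = card (\<Union>C\<in>X. edges_btw d L C K)"
  proof (rule card_UN_disjoint[symmetric])
    show "\<forall>C\<in>X. \<forall>D\<in>X. C \<noteq> D \<longrightarrow> edges_btw d L C K \<inter> edges_btw d L D K = {}"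
    proof (intro ballI impI)
      fix C D assume CD: "C \<in> X" "D \<in> X" "C \<noteq> D"
      then have Cc: "C \<in> ccomps adj A" "D \<in> ccomps adj A" using X by auto
      have "C \<inter> D = {}" by (rule ccomps_disj[OF sym_adjT Cc CD(3)])
      moreover have "C \<inter> K = {}" "D \<inter> K = {}" using ccomps_sub[OF Cc(1)] ccomps_sub[OF Cc(2)] K by auto
      ultimately have "C \<inter> D = {}" "C \<inter> K = {}" "D \<inter> K = {}" by auto
      then show "edges_btw d L C K \<inter> edges_btw d L D K = {}" unfolding edges_btw_def by fast
    qed
  qed (use finX in auto)
  also have "\<dots> \<le> card (K \<times> {..<d} \<union> {(v, j). v \<in> V \<and> j < d \<and> N j v \<in> K})"
  proof (intro card_mono)
    show "finite (K \<times> {..<d} \<union> {(v, j). v \<in> V \<and> j < d \<and> N j v \<in> K})"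
      using finA by (auto intro: finite_subset[of _ "V \<times> {..<d}"])
  qed (auto simp: edges_btw_def)
  also have "\<dots> \<le> card (K \<times> {..<d}) + card {(v, j). v \<in> V \<and> j < d \<and> N j v \<in> K}"
    by (rule card_Un_le)
  also have "card {(v, j). v \<in> V \<and> j < d \<and> N j v \<in> K} \<le> card (K \<times> {..<d})"
  proof (rule card_inj_on_le)
    show "inj_on (\<lambda>(v, j). (N j v, j)) {(v, j). v \<in> V \<and> j < d \<and> N j v \<in> K}"
      using nbr_inj by (auto simp: inj_on_def)
  qed (use finA in auto)
  finally show ?thesis by (simp add: card_cartesian_product algebra_simps)
qed

text \<open>Let \<open>M\<close> be the largest touched component. For any other one, with e edges
  to \<open>K\<close>, \<open>touching_size\<close> gives |C| + 1 <= e^d + 1 <= (e + 1)^d <= exp (d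
  e), and these e sum to at most 2 d |K|.\<close>

lemma cweight_fill_cluster:
  assumes A: "A \<subseteq> V" and K: "K \<in> ccomps near2 (V - A)"
  shows "real (cweight adj A) \<le> exp (2 * real d ^ 2 * card K) * real (cweight adj (A \<union> K))"
proof -
  have KV: "K \<subseteq> V - A" using ccomps_sub[OF K] .
  have fin: "finite A" "finite K"
    using A KV finite_subset[OF A] finite_subset[of K V] by auto
  have KA: "K \<inter> A = {}" using KV by auto
  show ?thesis
  proof (cases "touching adj A K = {}")
    case True
    have "real (cweight adj A) \<le> 1 * real (cweight adj (A \<union> K))"
      using cweight_fill_isolated[OF sym_adjT fin KA True] by simp
    also have "\<dots> \<le> exp (2 * real d ^ 2 * card K) * real (cweight adj (A \<union> K))"
      by (intro mult_right_mono) auto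
    finally show ?thesis .
  next
    case False
    have finT: "finite (touching adj A K)" using fin by simp
    obtain M where M: "M \<in> touching adj A K" "\<And>C. C \<in> touching adj A K \<Longrightarrow> card C \<le> card M"
      using Max_in[of "card ` touching adj A K"] Max_ge[of "card ` touching adj A K"] False finT
      by fastforce
    define X where "X = touching adj A K - {M}"
    define e where "e C = card (edges_btw d L C K)" for C
    have "real (\<Prod>C\<in>X. card C + 1) \<le> (\<Prod>C\<in>X. exp (d * real (e C)))"
      unfolding of_nat_prod
    proof (rule prod_mono)
      fix C assume "C \<in> X"
      then have "card C \<le> e C ^ d"
        using touching_size[OF A K, of C M] M by (auto simp: X_def e_def)
      then have "card C + 1 \<le> e C ^ d + 1" by simp
      also have "\<dots> \<le> (e C + 1) ^ d"
        using sum_power_le_power_sum[of "{0,1::nat}" d "\<lambda>x. if x = 0 then e C else 1"] d2 by simp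
      finally have "real (card C + 1) \<le> real ((e C + 1) ^ d)" by (rule of_nat_mono)
      also have "\<dots> = (1 + real (e C)) ^ d" by (simp add: add.commute)
      also have "\<dots> \<le> exp (real (e C)) ^ d" by (intro power_mono) auto
      also have "\<dots> = exp (d * real (e C))" by (simp add: exp_of_nat_mult)
      finally show "0 \<le> real (card C + 1) \<and> real (card C + 1) \<le> exp (d * real (e C))" by simp
    qed
    also have "\<dots> = exp (d * real (\<Sum>C\<in>X. e C))"
      using finT by (simp add: exp_sum X_def sum_distrib_left)
    also have "(\<Sum>C\<in>X. e C) \<le> 2 * d * card K"
      unfolding e_def by (rule sum_edges_btw[OF A KV]) (auto simp: X_def touching_def)
    then have "exp (d * real (\<Sum>C\<in>X. e C)) \<le> exp (d * real (2 * d * card K))"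
      by (simp only: exp_le_cancel_iff) (intro mult_left_mono of_nat_mono, auto)
    finally have P: "real (\<Prod>C\<in>X. card C + 1) \<le> exp (2 * real d ^ 2 * card K)"
      by (simp add: power2_eq_square mult_ac)
    have "real (cweight adj A) \<le> real (cweight adj (A \<union> K) * (\<Prod>C\<in>X. card C + 1))"
      using cweight_fill[OF sym_adjT fin KA M(1)] unfolding X_def by (rule of_nat_mono)
    also have "\<dots> = real (\<Prod>C\<in>X. card C + 1) * real (cweight adj (A \<union> K))" by simp
    also have "\<dots> \<le> exp (2 * real d ^ 2 * card K) * real (cweight adj (A \<union> K))"
      using P by (rule mult_right_mono) simp
    finally show ?thesis .
  qed
qed

end

section \<open>Pairs of vertices disconnected by a cluster of empty vertices\<close>

context torus
begin

text \<open>In the configuration \<open>V - K\<close> every empty vertex belongs to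
  \<open>K\<close>, so the whole cut around a component consists of edges to \<open>K\<close> and no
  winding case arises. All components but the largest have together at most (2 d |K|)^d vertices,
  and a separated pair has a vertex in one of them.\<close>

lemma separated_card:
  assumes K: "K \<subseteq> V"
  shows "card (separated d L K) \<le> 2 * card V * (2 * d * card K) ^ d"
proof -
  define B where "B = V - K"
  have BV: "B \<subseteq> V" and KB: "K \<subseteq> V - B" using K by (auto simp: B_def)
  have finB: "finite B" using BV by (rule finite_subset) simp
  show ?thesis
  proof (cases "B = {}")
    case True
    then have "separated d L K = {}" by (auto simp: separated_def B_def)
    then show ?thesis by simp
  next
    case False
    then have "ccomps adj B \<noteq> {}" by (auto simp: ccomps_def)
    then obtain M where M: "M \<in> ccomps adj B" "\<And>C. C \<in> ccomps adj B \<Longrightarrow> card C \<le> card M"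
      using Max_in[of "card ` ccomps adj B"] Max_ge[of "card ` ccomps adj B"] finB by fastforce
    define X where "X = ccomps adj B - {M}"
    have size: "card C \<le> card (edges_btw d L C K) ^ d" if C: "C \<in> X" for C
    proof -
      have Cc: "C \<in> ccomps adj B" "C \<noteq> M" using C by (auto simp: X_def)
      obtain m where m: "m \<in> M" using ccomps_ne[OF M(1)] by auto
      have disj: "C \<inter> M = {}" using ccomps_disj[OF sym_adjT Cc(1) M(1) Cc(2)] .
      have w: "m \<in> V - C" using m disj ccomps_sub[OF M(1)] BV by auto
      define R where "R = ccomp adj (V - C) m"
      have RV: "R \<subseteq> V - C" unfolding R_def using w by (intro ccomp_subset) auto
      have "M = ccomp adj M m" using ccomp_within[OF sym_adjT M(1) m] by simp
      also have "\<dots> \<subseteq> R" unfolding R_def using disj ccomps_sub[OF M(1)] BV by (intro ccomp_mono) auto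
      finally have MR: "M \<subseteq> R" .
      define F where "F = {(v, j) \<in> cut d L R. (if v \<in> R then v else N j v) \<in> K}"
      have "cut d L R \<subseteq> F"
      proof (clarify)
        fix v j assume vj: "(v, j) \<in> cut d L R"
        then have v: "v \<in> V" "j < d" "(v \<in> R) \<noteq> (N j v \<in> R)" by (auto simp: cut_def)
        have "(if v \<in> R then v else N j v) \<in> V - B"
          using complement_component(2)[OF BV Cc(1) w R_def, of v "N j v"]
            complement_component(2)[OF BV Cc(1) w R_def, of "N j v" v] v adj_nbr nbr_verts by auto
        then show "(v, j) \<in> F" using vj K by (auto simp: F_def B_def)
      qed
      also have "F \<subseteq> edges_btw d L C K" by (rule part_of_cut_subset[OF BV Cc(1) w R_def F_def])
      finally have sub: "cut d L R \<subseteq> edges_btw d L C K" .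
      have "card C \<le> card (cut d L R) ^ d" using card_cut_ge[OF BV Cc(1) w R_def MR] M(2)[OF Cc(1)] .
      also have "\<dots> \<le> card (edges_btw d L C K) ^ d" using sub by (intro power_mono card_mono) auto
      finally show ?thesis .
    qed
    have finX: "finite X" using finB by (simp add: X_def)
    have "B - M \<subseteq> \<Union> X" using ccomps_Union[of adj B] by (auto simp: X_def)
    moreover have "\<Union> X \<subseteq> B" using ccomps_Union[of adj B] by (auto simp: X_def)
    then have "finite (\<Union> X)" using finB by (rule finite_subset)
    ultimately have "card (B - M) \<le> card (\<Union> X)" by (intro card_mono)
    also have "\<dots> \<le> (\<Sum>C\<in>X. card C)" by (rule card_Union_le_sum_card)
    also have "\<dots> \<le> (\<Sum>C\<in>X. card (edges_btw d L C K) ^ d)" using size by (rule sum_mono)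
    also have "\<dots> \<le> (\<Sum>C\<in>X. card (edges_btw d L C K)) ^ d"
      using finX d2 by (intro sum_power_le_power_sum) auto
    also have "\<dots> \<le> (2 * d * card K) ^ d"
      using sum_edges_btw[OF BV KB, of X] by (intro power_mono) (auto simp: X_def)
    finally have small: "card (B - M) \<le> (2 * d * card K) ^ d" .
    have "separated d L K \<subseteq> (B - M) \<times> V \<union> V \<times> (B - M)"
    proof (clarify)
      fix v w assume vw: "(v, w) \<in> separated d L K" "\<not> (v \<in> V \<and> w \<in> B - M)"
      then have h: "v \<in> B" "w \<in> B" "w \<notin> ccomp adj B v" by (auto simp: separated_def B_def)
      then have "w \<in> M" using vw(2) BV by auto
      then have "v \<notin> M" using h ccompsD(1)[OF sym_adjT M(1)] by metis
      then show "v \<in> B - M \<and> w \<in> V" using h BV by auto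
    qed
    then have "card (separated d L K) \<le> card ((B - M) \<times> V \<union> V \<times> (B - M))"
      using finB by (intro card_mono) auto
    also have "\<dots> \<le> card ((B - M) \<times> V) + card (V \<times> (B - M))" by (rule card_Un_le)
    also have "\<dots> = 2 * card V * card (B - M)" by (simp add: card_cartesian_product)
    also have "\<dots> \<le> 2 * card V * (2 * d * card K) ^ d" using small by (rule mult_left_mono) simp
    finally show ?thesis .
  qed
qed

text \<open>\<open>K\<close> is the cluster of an empty vertex on the boundary of the side
  \<open>R\<close> of \<open>w\<close>. If the whole cut lies at \<open>K\<close>, then
  \<open>K\<close> alone separates \<open>v\<close> from \<open>w\<close>; otherwise at least
  \<open>L\<close> cut edges lie at \<open>K\<close>, which has at most 2 d |K| edges to
  \<open>C\<close>.\<close>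

lemma disconnected_pair_separated:
  assumes A: "A \<subseteq> V" and vw: "v \<in> A" "w \<in> A" "w \<notin> ccomp adj A v"
  shows "\<exists>K\<in>ccomps near2 (V - A). L \<le> 2 * d * card K \<or> (v, w) \<in> separated d L K"
proof -
  define C where "C = ccomp adj A v"
  have Cc: "C \<in> ccomps adj A" using vw by (auto simp: C_def ccomps_def)
  have vC: "v \<in> C" by (simp add: C_def)
  have w: "w \<in> V - C" using vw A by (auto simp: C_def)
  define R where "R = ccomp adj (V - C) w"
  have RV: "R \<subseteq> V - C" unfolding R_def using w by (intro ccomp_subset) auto
  have wR: "w \<in> R" by (simp add: R_def)
  have vR: "v \<notin> R" using RV vC by auto
  have "\<exists>x\<in>R. \<exists>y\<in>V - R. (x, y) \<in> adj"
    using RV wR vR vw A by (intro boundary_nonempty) auto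
  then obtain x y where xy: "x \<in> R" "y \<in> V - R" "(x, y) \<in> adj" by auto
  have xA: "x \<in> V - A" using complement_component(2)[OF A Cc w R_def xy] .
  define K where "K = ccomp near2 (V - A) x"
  have Kc: "K \<in> ccomps near2 (V - A)" using xA by (auto simp: K_def ccomps_def)
  have KV: "K \<subseteq> V - A" using ccomps_sub[OF Kc] .
  have xK: "x \<in> K" by (simp add: K_def)
  define F where "F = {(v, j) \<in> cut d L R. (if v \<in> R then v else N j v) \<in> K}"
  obtain j where "j < d" "y = N j x \<or> x = N j y" using xy(3) by (auto simp: adjT_def)
  then have "(x, j) \<in> F \<or> (y, j) \<in> F" using xy xA xK by (auto simp: F_def cut_def)
  then have Fne: "F \<noteq> {}" by auto
  have FE: "F \<subseteq> edges_btw d L C K" by (rule part_of_cut_subset[OF A Cc w R_def F_def])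
  have "L \<le> 2 * d * card K \<or> (v, w) \<in> separated d L K"
    using cut_component_dichotomy[OF A Cc w R_def Kc F_def Fne]
  proof
    assume "L \<le> card F"
    also have "\<dots> \<le> card (edges_btw d L C K)" using FE by (intro card_mono) auto
    also have "\<dots> \<le> 2 * d * card K" using sum_edges_btw[OF A KV, of "{C}"] Cc by simp
    finally show ?thesis by simp
  next
    assume Fcut: "F = cut d L R"
    have "ccomp adj (V - K) v \<subseteq> V - R"
    proof (rule ccomp_closed)
      show "v \<in> V - R" using vR vw A by auto
      fix a b assume ab: "a \<in> V - R" "a \<in> V - K" "b \<in> V - K" "(a, b) \<in> adj"
      show "b \<in> V - R"
      proof (rule ccontr)
        assume "b \<notin> V - R"
        then have bR: "b \<in> R" using ab by auto
        obtain i where "i < d" "b = N i a \<or> a = N i b" using ab(4) by (auto simp: adjT_def)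
        then have "(a, i) \<in> F \<and> b = N i a \<or> (b, i) \<in> F" using ab bR by (auto simp: Fcut cut_def)
        then have "b \<in> K" using ab bR by (auto simp: F_def)
        then show False using ab by auto
      qed
    qed
    then show ?thesis using wR vw KV A by (auto simp: separated_def)
  qed
  then show ?thesis using Kc by blast
qed

text \<open>Pairs lost to a winding cluster need no geometry: \<open>L \<le> 2 d |K|\<close> gives \<open>|V| \<le> (2 d |K|)\<^sup>d\<close>.\<close>

lemma disconnected_card:
  assumes A: "A \<subseteq> V"
  shows "card (disconnected d L A) \<le> (\<Sum>K\<in>ccomps near2 (V - A). 5 * card V * (2 * d * card K) ^ d)"
proof -
  define bad where "bad K = K \<times> V \<union> V \<times> K \<union> separated d L K \<union> (if L \<le> 2 * d * card K then V \<times> V else {})" for K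
  let ?X = "ccomps near2 (V - A)"
  have finX: "finite ?X" by simp
  have KV: "K \<subseteq> V" if "K \<in> ?X" for K using ccomps_sub[OF that] by auto
  have finsep: "finite (separated d L K)" for K
    by (rule finite_subset[of _ "V \<times> V"]) (auto simp: separated_def)
  have "disconnected d L A \<subseteq> (\<Union>K\<in>?X. bad K)"
  proof (clarify)
    fix v w assume "(v, w) \<in> disconnected d L A"
    then have vw: "v \<in> V" "w \<in> V" "v \<notin> A \<or> w \<notin> A \<or> w \<notin> ccomp adj A v"
      by (auto simp: disconnected_def)
    have cl: "\<exists>K\<in>?X. u \<in> K" if "u \<in> V - A" for u
      using that by (auto simp: ccomps_def intro!: bexI[of _ u])
    show "(v, w) \<in> (\<Union>K\<in>?X. bad K)"
    proof (cases "v \<in> A \<and> w \<in> A")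
      case True
      then obtain K where "K \<in> ?X" "L \<le> 2 * d * card K \<or> (v, w) \<in> separated d L K"
        using disconnected_pair_separated[OF A, of v w] vw by auto
      then show ?thesis using vw by (intro UN_I[of K]) (auto simp: bad_def)
    next
      case False
      then obtain K where "K \<in> ?X" "v \<in> K \<or> w \<in> K" using cl[of v] cl[of w] vw by blast
      then show ?thesis using vw by (intro UN_I[of K]) (auto simp: bad_def)
    qed
  qed
  then have "card (disconnected d L A) \<le> card (\<Union>K\<in>?X. bad K)"
    using finX KV finsep finite_subset[OF KV] by (intro card_mono finite_UN_I) (auto simp: bad_def)
  also have "\<dots> \<le> (\<Sum>K\<in>?X. card (bad K))" using finX by (rule card_UN_le)
  also have "\<dots> \<le> (\<Sum>K\<in>?X. 5 * card V * (2 * d * card K) ^ d)"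
  proof (rule sum_mono)
    fix K assume K: "K \<in> ?X"
    let ?h = "(2 * d * card K) ^ d"
    have "card K \<le> 2 * d * card K" using d2 by simp
    also have "K \<noteq> {}" "finite K" using ccomps_ne[OF K] finite_subset[OF KV[OF K]] by auto
    then have "2 * d * card K \<le> ?h" using d2 by (intro self_le_power) (auto simp: card_gt_0_iff Suc_le_eq)
    finally have k: "card V * card K \<le> card V * ?h" by (rule mult_left_mono) simp
    have w: "card (if L \<le> 2 * d * card K then V \<times> V else {}) \<le> card V * ?h"
    proof (cases "L \<le> 2 * d * card K")
      case True
      then have "card V \<le> ?h" by (simp add: card_verts power_mono)
      then show ?thesis using True by (simp add: card_cartesian_product)
    qed simp
    have "card (bad K) \<le> card (K \<times> V) + card (V \<times> K) + card (separated d L K)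
        + card (if L \<le> 2 * d * card K then V \<times> V else {})"
      unfolding bad_def by (intro order_trans[OF card_Un_le] add_right_mono order_refl)
    \<comment> \<open>The constant is 1 + 1 + 2 + 1 = 5: pairs with first or second vertex in
      \<open>K\<close>, separated pairs, and all pairs if \<open>K\<close> is long enough to
      wind.\<close>
    also have "\<dots> \<le> card V * ?h + card V * ?h + 2 * card V * ?h + card V * ?h"
      using k w separated_card[OF KV[OF K]]
      by (intro add_mono) (auto simp: card_cartesian_product mult.commute)
    finally show "card (bad K) \<le> 5 * card V * ?h" by simp
  qed
  finally show ?thesis .
qed

lemma adj_degree: "finite (adj `` {x}) \<and> card (adj `` {x}) \<le> 2 * d"
proof -
  have "adj `` {x} \<subseteq> (\<lambda>j. N j x) ` {..<d} \<union> (\<Union>j<d. {w \<in> V. x = N j w})"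
    by (auto simp: adjT_def)
  moreover have fin: "finite ((\<lambda>j. N j x) ` {..<d} \<union> (\<Union>j<d. {w \<in> V. x = N j w}))" by auto
  moreover have "card ((\<lambda>j. N j x) ` {..<d} \<union> (\<Union>j<d. {w \<in> V. x = N j w})) \<le> d + d"
  proof -
    have one: "card {w \<in> V. x = N j w} \<le> 1" for j
      using nbr_inj[of j] by (auto simp: card_le_Suc0_iff_eq inj_on_def)
    have "card (\<Union>j<d. {w \<in> V. x = N j w}) \<le> (\<Sum>j<d. card {w \<in> V. x = N j w})" by (rule card_UN_le) simp
    also have "\<dots> \<le> (\<Sum>j<d. 1)" using one by (intro sum_mono) auto
    finally have "card (\<Union>j<d. {w \<in> V. x = N j w}) \<le> d" by simp
    moreover have "card ((\<lambda>j. N j x) ` {..<d}) \<le> d" using card_image_le[of "{..<d}"] by simp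
    ultimately show ?thesis by (intro order_trans[OF card_Un_le] add_mono)
  qed
  ultimately show ?thesis
    using card_mono[OF fin, of "adj `` {x}"] finite_subset[OF _ fin, of "adj `` {x}"] by simp
qed

lemma near_degree: "finite (near2 `` {x}) \<and> card (near2 `` {x}) \<le> 2 * d + 4 * d ^ 2"
proof -
  have eq: "near2 `` {x} = adj `` {x} \<union> (\<Union>z\<in>adj `` {x}. adj `` {z})" by (auto simp: near_def)
  have "card (\<Union>z\<in>adj `` {x}. adj `` {z}) \<le> (\<Sum>z\<in>adj `` {x}. card (adj `` {z}))"
    using adj_degree by (intro card_UN_le) auto
  also have "\<dots> \<le> (\<Sum>z\<in>adj `` {x}. 2 * d)" using adj_degree by (intro sum_mono) auto
  also have "\<dots> = card (adj `` {x}) * (2 * d)" by simp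
  also have "\<dots> \<le> (2 * d) * (2 * d)" using adj_degree by (intro mult_right_mono) auto
  finally have "card (\<Union>z\<in>adj `` {x}. adj `` {z}) \<le> 4 * d ^ 2" by (simp add: power2_eq_square)
  moreover have "card (near2 `` {x}) \<le> card (adj `` {x}) + card (\<Union>z\<in>adj `` {x}. adj `` {z})"
    unfolding eq by (rule card_Un_le)
  ultimately have "card (near2 `` {x}) \<le> 2 * d + 4 * d ^ 2" using adj_degree[of x] by linarith
  moreover have "finite (near2 `` {x})" unfolding eq using adj_degree by auto
  ultimately show ?thesis by simp
qed

end

section \<open>The percolation measure at low and high density\<close>

definition gibbs :: "('a \<times> 'a) set \<Rightarrow> real \<Rightarrow> 'a set \<Rightarrow> real" where
  "gibbs R \<mu> A = exp (\<mu> * card A) * real (cweight R A)"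

lemma gibbs_pos: "gibbs R \<mu> A > 0"
  by (simp add: gibbs_def cweight_pos)

lemma geometric_tail:
  fixes r :: real
  assumes "0 \<le> r" "r \<le> 1/2" "finite S" "\<And>k. k \<in> S \<Longrightarrow> k0 \<le> k"
  shows "(\<Sum>k\<in>S. r ^ k) \<le> 2 * r ^ k0"
proof -
  have part: "(\<Sum>k=k0..<k0+n. r ^ k) \<le> 2 * r ^ k0 * (1 - (1/2) ^ n)" for n
  proof (induction n)
    case (Suc n)
    have "r ^ (k0 + n) \<le> r ^ k0 * (1/2) ^ n"
      unfolding power_add using assms by (intro mult_left_mono power_mono) auto
    then show ?case using Suc by (simp add: algebra_simps)
  qed simp
  obtain n where n: "\<And>k. k \<in> S \<Longrightarrow> k < n" using assms(3) unfolding finite_nat_set_iff_bounded by auto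
  have "(\<Sum>k\<in>S. r ^ k) \<le> (\<Sum>k=k0..<k0+n. r ^ k)"
    using n assms by (intro sum_mono2) force+
  also have "\<dots> \<le> 2 * r ^ k0 * (1 - (1/2) ^ n)" by (rule part)
  also have "\<dots> \<le> 2 * r ^ k0 * 1" using assms by (intro mult_left_mono) auto
  finally show ?thesis by simp
qed

lemma card_connected_pairs:
  assumes "sym R" "finite A"
  shows "card {(v, w). v \<in> A \<and> w \<in> A \<and> w \<in> ccomp R A v} = (\<Sum>C\<in>ccomps R A. card C ^ 2)"
proof -
  have "{(v, w). v \<in> A \<and> w \<in> A \<and> w \<in> ccomp R A v} = (\<Union>C\<in>ccomps R A. C \<times> C)"
  proof
    show "{(v, w). v \<in> A \<and> w \<in> A \<and> w \<in> ccomp R A v} \<subseteq> (\<Union>C\<in>ccomps R A. C \<times> C)"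
      by (auto simp: ccomps_def)
    show "(\<Union>C\<in>ccomps R A. C \<times> C) \<subseteq> {(v, w). v \<in> A \<and> w \<in> A \<and> w \<in> ccomp R A v}"
      using ccompsD[OF assms(1)] by blast
  qed
  moreover have "card (\<Union>C\<in>ccomps R A. C \<times> C) = (\<Sum>C\<in>ccomps R A. card (C \<times> C))"
  proof (rule card_UN_disjoint)
    show "\<forall>C\<in>ccomps R A. finite (C \<times> C)" using assms(2) ccomps_finite_mem by blast
    show "\<forall>C\<in>ccomps R A. \<forall>D\<in>ccomps R A. C \<noteq> D \<longrightarrow> C \<times> C \<inter> D \<times> D = {}"
    proof (intro ballI impI)
      fix C D assume "C \<in> ccomps R A" "D \<in> ccomps R A" "C \<noteq> D"
      then have "C \<inter> D = {}" by (rule ccomps_disj[OF assms(1)])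
      then show "C \<times> C \<inter> D \<times> D = {}" by auto
    qed
  qed (use assms in auto)
  ultimately show ?thesis by (simp add: card_cartesian_product power2_eq_square)
qed

subsection \<open>Low density\<close>

lemma gibbs_delete:
  assumes "sym R" "finite A" "B \<subseteq> A"
  shows "gibbs R \<mu> A \<le> (2 * exp \<mu>) ^ card B * gibbs R \<mu> (A - B)"
proof -
  have "finite B" using assms finite_subset by blast
  then show ?thesis using assms(3)
  proof (induction rule: finite_induct)
    case (insert x B)
    let ?D = "A - B"
    have x: "x \<in> ?D" "finite ?D" using insert assms(2) by auto
    have cD: "card ?D = Suc (card (?D - {x}))" using x by (metis card.remove)
    have "gibbs R \<mu> ?D \<le> exp (\<mu> * card ?D) * (2 * real (cweight R (?D - {x})))"
      unfolding gibbs_def using cweight_delete[OF assms(1) x(2,1)]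
      by (intro mult_left_mono) (auto simp flip: of_nat_mult)
    also have "\<dots> = 2 * exp \<mu> * gibbs R \<mu> (?D - {x})"
      by (simp add: gibbs_def cD algebra_simps exp_add)
    finally have "(2 * exp \<mu>) ^ card B * gibbs R \<mu> ?D \<le>
        (2 * exp \<mu>) ^ card B * (2 * exp \<mu> * gibbs R \<mu> (?D - {x}))"
      by (intro mult_left_mono) auto
    moreover have "gibbs R \<mu> A \<le> (2 * exp \<mu>) ^ card B * gibbs R \<mu> ?D" using insert by simp
    ultimately have "gibbs R \<mu> A \<le> (2 * exp \<mu>) ^ card B * (2 * exp \<mu> * gibbs R \<mu> (?D - {x}))"
      by (rule order_trans[rotated])
    moreover have "A - insert x B = ?D - {x}" by auto
    ultimately show ?case using card_insert_disjoint[OF insert(1,2)] by (simp add: mult_ac)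
  qed simp
qed

text \<open>Deleting \<open>B\<close> is injective on the configurations that contain
  \<open>B\<close>, so the reduced weights sum to at most the full partition function.\<close>

lemma gibbs_contains:
  assumes "sym R" "finite V" "B \<subseteq> V"
  shows "(\<Sum>A\<in>{A \<in> Pow V. B \<subseteq> A}. gibbs R \<mu> A) \<le> (2 * exp \<mu>) ^ card B * (\<Sum>A\<in>Pow V. gibbs R \<mu> A)"
proof -
  let ?S = "{A \<in> Pow V. B \<subseteq> A}"
  have "(\<Sum>A\<in>?S. gibbs R \<mu> A) \<le> (\<Sum>A\<in>?S. (2 * exp \<mu>) ^ card B * gibbs R \<mu> (A - B))"
    using assms by (intro sum_mono gibbs_delete) (auto intro: finite_subset)
  also have "\<dots> = (2 * exp \<mu>) ^ card B * (\<Sum>A\<in>?S. gibbs R \<mu> (A - B))" by (simp add: sum_distrib_left)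
  also have "(\<Sum>A\<in>?S. gibbs R \<mu> (A - B)) = (\<Sum>A\<in>(\<lambda>A. A - B) ` ?S. gibbs R \<mu> A)"
    by (subst sum.reindex) (auto simp: inj_on_def)
  also have "\<dots> \<le> (\<Sum>A\<in>Pow V. gibbs R \<mu> A)"
    using assms by (intro sum_mono2) (auto intro: less_imp_le gibbs_pos)
  finally show ?thesis by (simp add: mult_left_mono)
qed

text \<open>|C| (|C| - 1) counts ordered pairs of distinct connected vertices, each joined by an
  occupied self-avoiding path. With q = 2 exp mu, a path of n >= 1 steps has n + 1 vertices and
  probability at most q^(n + 1), and each start has at most m^n of them. The geometric sum is at
  most twice its first term, which gives 2 m |V| q^2.\<close>

lemma low_density_pairs:
  assumes R: "sym R" "R \<subseteq> V \<times> V" and V: "finite V"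
    and deg: "\<And>x. finite (R `` {x}) \<and> card (R `` {x}) \<le> m"
    and small: "real m * (2 * exp \<mu>) \<le> 1/2"
  shows "(\<Sum>A\<in>Pow V. gibbs R \<mu> A * (\<Sum>C\<in>ccomps R A. real (card C * (card C - 1))))
    \<le> (\<Sum>A\<in>Pow V. gibbs R \<mu> A) * (8 * real m * card V * exp (2 * \<mu>))"
proof -
  define q where "q = 2 * exp \<mu>"
  define Z where "Z = (\<Sum>A\<in>Pow V. gibbs R \<mu> A)"
  have Z: "Z \<ge> 0" unfolding Z_def by (intro sum_nonneg less_imp_le gibbs_pos)
  define P where "P = (\<Union>n\<in>{1..<card V}. \<Union>v\<in>V. {p \<in> walks R n v. distinct p \<and> set p \<subseteq> V})"
  have finW: "finite (walks R n v)" for n v using walks_card[OF deg] by blast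
  have finP: "finite P" unfolding P_def using V finW by auto
  have pairs: "(\<Sum>C\<in>ccomps R A. card C * (card C - 1)) \<le> card {p \<in> P. set p \<subseteq> A}" if A: "A \<subseteq> V" for A
  proof -
    have finA: "finite A" using A V finite_subset by blast
    define T where "T = {(v, w). v \<in> A \<and> w \<in> A \<and> w \<in> ccomp R A v}"
    have finT: "finite T" unfolding T_def by (rule finite_subset[of _ "A \<times> A"]) (use finA in auto)
    have diag: "(\<lambda>v. (v, v)) ` A \<subseteq> T" by (auto simp: T_def)
    have "(\<Sum>C\<in>ccomps R A. card C * (card C - 1)) + card A = (\<Sum>C\<in>ccomps R A. card C * (card C - 1) + card C)"
      using sum_card_ccomps[OF R(1) finA] by (simp add: sum.distrib)
    also have "\<dots> = card T" unfolding T_def card_connected_pairs[OF R(1) finA]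
      by (intro sum.cong) (auto simp: power2_eq_square algebra_simps diff_mult_distrib2)
    also have "\<dots> = card (T - (\<lambda>v. (v, v)) ` A) + card A"
      using card_Diff_subset[OF _ diag] finA card_mono[OF finT diag] by (simp add: card_image inj_on_def)
    finally have "(\<Sum>C\<in>ccomps R A. card C * (card C - 1)) = card (T - (\<lambda>v. (v, v)) ` A)" by simp
    also have "\<dots> \<le> card ((\<lambda>p. (hd p, last p)) ` {p \<in> P. set p \<subseteq> A})"
    proof (rule card_mono)
      show "T - (\<lambda>v. (v, v)) ` A \<subseteq> (\<lambda>p. (hd p, last p)) ` {p \<in> P. set p \<subseteq> A}"
      proof (clarify)
        fix v w assume vw: "(v, w) \<in> T" "(v, w) \<notin> (\<lambda>v. (v, v)) ` A"
        then have h: "v \<in> A" "w \<in> ccomp R A v" "v \<noteq> w" by (auto simp: T_def)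
        obtain n p where p: "p \<in> walks R n v" "last p = w" "set p \<subseteq> A" "distinct p"
          using simple_path[OF R(1) h(2,1)] by auto
        have "n \<noteq> 0" using p h by (cases n) auto
        moreover have "Suc n \<le> card V"
          using distinct_card[OF p(4)] walks_length[OF p(1)] card_mono[OF V, of "set p"] p(3) A by auto
        ultimately have "p \<in> P" unfolding P_def using p h A by fastforce
        then show "(v, w) \<in> (\<lambda>p. (hd p, last p)) ` {p \<in> P. set p \<subseteq> A}"
          using p walks_hd[OF p(1)] by (intro image_eqI[of _ _ p]) auto
      qed
    qed (use finP in auto)
    also have "\<dots> \<le> card {p \<in> P. set p \<subseteq> A}" using finP by (intro card_image_le) auto
    finally show ?thesis .
  qed
  have "(\<Sum>A\<in>Pow V. gibbs R \<mu> A * (\<Sum>C\<in>ccomps R A. real (card C * (card C - 1))))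
      \<le> (\<Sum>A\<in>Pow V. gibbs R \<mu> A * real (card {p \<in> P. set p \<subseteq> A}))"
    using pairs less_imp_le[OF gibbs_pos] by (intro sum_mono mult_left_mono) (auto simp flip: of_nat_sum simp del: of_nat_mult)
  also have "\<dots> = (\<Sum>A\<in>Pow V. \<Sum>p\<in>P. if set p \<subseteq> A then gibbs R \<mu> A else 0)"
    using finP by (intro sum.cong refl) (simp add: sum.inter_filter[symmetric] mult.commute)
  also have "\<dots> = (\<Sum>p\<in>P. \<Sum>A\<in>Pow V. if set p \<subseteq> A then gibbs R \<mu> A else 0)" by (rule sum.swap)
  also have "\<dots> = (\<Sum>p\<in>P. \<Sum>A\<in>{A \<in> Pow V. set p \<subseteq> A}. gibbs R \<mu> A)"
    using V by (intro sum.cong refl sum.inter_filter[symmetric]) auto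
  also have "\<dots> \<le> (\<Sum>p\<in>P. q ^ length p * Z)"
  proof (rule sum_mono)
    fix p assume "p \<in> P"
    then have "distinct p" "set p \<subseteq> V" by (auto simp: P_def)
    then show "(\<Sum>A\<in>{A \<in> Pow V. set p \<subseteq> A}. gibbs R \<mu> A) \<le> q ^ length p * Z"
      using gibbs_contains[OF R(1) V, of "set p" \<mu>] by (simp add: q_def Z_def distinct_card)
  qed
  also have "\<dots> = (\<Sum>p\<in>P. q ^ length p) * Z" by (simp add: sum_distrib_right)
  also have "(\<Sum>p\<in>P. q ^ length p) \<le> (\<Sum>n\<in>{1..<card V}. \<Sum>v\<in>V. real (card (walks R n v)) * q ^ Suc n)"
  proof -
    have "(\<Sum>p\<in>P. q ^ length p) \<le> (\<Sum>x\<in>Sigma {1..<card V} (\<lambda>n. Sigma V (walks R n)). q ^ length (snd (snd x)))"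
    proof -
      let ?S = "Sigma {1..<card V} (\<lambda>n. Sigma V (walks R n))"
      have "P \<subseteq> (\<lambda>x. snd (snd x)) ` ?S" by (force simp: P_def)
      then have "(\<Sum>p\<in>P. q ^ length p) \<le> (\<Sum>p\<in>(\<lambda>x. snd (snd x)) ` ?S. q ^ length p)"
        using V finW by (intro sum_mono2) (auto simp: q_def)
      also have "\<dots> \<le> (\<Sum>x\<in>?S. q ^ length (snd (snd x)))"
        using V finW sum_image_le[of ?S "\<lambda>p. q ^ length p" "\<lambda>x. snd (snd x)"] by (auto simp: q_def o_def)
      finally show ?thesis .
    qed
    also have "\<dots> = (\<Sum>n\<in>{1..<card V}. \<Sum>v\<in>V. \<Sum>p\<in>walks R n v. q ^ length p)"
      using V finW by (simp add: sum.Sigma split_def)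
    also have "\<dots> = (\<Sum>n\<in>{1..<card V}. \<Sum>v\<in>V. real (card (walks R n v)) * q ^ Suc n)"
      by (intro sum.cong) (auto simp: walks_length)
    finally show ?thesis .
  qed
  also have "\<dots> \<le> (\<Sum>n\<in>{1..<card V}. \<Sum>v\<in>V. real (m ^ n) * q ^ Suc n)"
    using walks_card[OF deg] by (intro sum_mono mult_right_mono of_nat_mono) (auto simp: q_def)
  also have "\<dots> = card V * q * (\<Sum>n\<in>{1..<card V}. (real m * q) ^ n)"
    by (simp add: sum_distrib_left power_mult_distrib mult_ac)
  also have "\<dots> \<le> card V * q * (2 * (real m * q) ^ 1)"
    using small by (intro mult_left_mono geometric_tail) (auto simp: q_def)
  also have "\<dots> = 8 * real m * card V * exp (2 * \<mu>)"
    by (simp add: q_def power2_eq_square[symmetric] exp_double[symmetric] mult_ac)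
  finally show ?thesis using Z by (simp add: Z_def mult.commute mult_right_mono)
qed

subsection \<open>High density\<close>

context torus
begin

lemma gibbs_fill_cluster:
  assumes A: "A \<subseteq> V" and K: "K \<in> ccomps near2 (V - A)"
  shows "gibbs adj \<mu> A \<le> exp (2 * real d ^ 2 - \<mu>) ^ card K * gibbs adj \<mu> (A \<union> K)"
proof -
  have KV: "K \<subseteq> V - A" using ccomps_sub[OF K] .
  have fin: "finite A" "finite K"
    using A KV finite_subset[OF A] finite_subset[of K V] by auto
  have card: "card (A \<union> K) = card A + card K" using fin KV by (intro card_Un_disjoint) auto
  have "gibbs adj \<mu> A \<le> exp (\<mu> * card A) * (exp (2 * real d ^ 2 * card K) * real (cweight adj (A \<union> K)))"
    unfolding gibbs_def using cweight_fill_cluster[OF A K] by (intro mult_left_mono) auto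
  also have "exp (\<mu> * card A) * (exp (2 * real d ^ 2 * card K) * real (cweight adj (A \<union> K)))
      = (exp (\<mu> * card A) * exp (2 * real d ^ 2 * card K)) * real (cweight adj (A \<union> K))"
    by (simp only: mult.assoc)
  also have "exp (\<mu> * card A) * exp (2 * real d ^ 2 * card K) = exp (\<mu> * card A + 2 * real d ^ 2 * card K)"
    by (simp only: exp_add)
  also have "\<mu> * card A + 2 * real d ^ 2 * card K = card K * (2 * real d ^ 2 - \<mu>) + \<mu> * card (A \<union> K)"
    by (simp add: card algebra_simps)
  also have "exp \<dots> = exp (2 * real d ^ 2 - \<mu>) ^ card K * exp (\<mu> * card (A \<union> K))"
    by (simp only: exp_add exp_of_nat_mult)
  also have "\<dots> * real (cweight adj (A \<union> K)) = exp (2 * real d ^ 2 - \<mu>) ^ card K * gibbs adj \<mu> (A \<union> K)"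
    by (simp only: gibbs_def mult.assoc)
  finally show ?thesis .
qed

text \<open>After exchanging the sums, filling a fixed \<open>K\<close> is injective on the
  configurations having \<open>K\<close> as a cluster, since these are disjoint from
  \<open>K\<close>. So \<open>K\<close> is a cluster with probability at most exp (2 d^2 -
  mu)^|K|.\<close>

lemma peierls:
  assumes h: "\<And>K. h K \<ge> 0"
  shows "(\<Sum>A\<in>Pow V. gibbs adj \<mu> A * (\<Sum>K\<in>ccomps near2 (V - A). h K))
    \<le> (\<Sum>A\<in>Pow V. gibbs adj \<mu> A) * (\<Sum>K\<in>animals near2 V. h K * exp (2 * real d ^ 2 - \<mu>) ^ card K)"
proof -
  define q where "q = exp (2 * real d ^ 2 - \<mu>)"
  define Z where "Z = (\<Sum>A\<in>Pow V. gibbs adj \<mu> A)"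
  have finN: "finite (animals near2 V)" by (rule finite_subset[of _ "Pow V"]) (auto simp: animals_def)
  have sub: "ccomps near2 (V - A) \<subseteq> animals near2 V" for A by (rule ccomps_animals[OF sym_near]) auto
  have "(\<Sum>A\<in>Pow V. gibbs adj \<mu> A * (\<Sum>K\<in>ccomps near2 (V - A). h K))
      = (\<Sum>A\<in>Pow V. \<Sum>K\<in>animals near2 V. if K \<in> ccomps near2 (V - A) then gibbs adj \<mu> A * h K else 0)"
    using finN sub by (intro sum.cong) (auto simp: sum_distrib_left sum.If_cases Int_absorb1)
  also have "\<dots> = (\<Sum>K\<in>animals near2 V. \<Sum>A\<in>Pow V. if K \<in> ccomps near2 (V - A) then gibbs adj \<mu> A * h K else 0)"
    by (rule sum.swap)
  also have "\<dots> \<le> (\<Sum>K\<in>animals near2 V. h K * q ^ card K * Z)"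
  proof (rule sum_mono)
    fix K
    define S where "S = {A \<in> Pow V. K \<in> ccomps near2 (V - A)}"
    have finS: "finite S" by (simp add: S_def)
    have "(\<Sum>A\<in>Pow V. if K \<in> ccomps near2 (V - A) then gibbs adj \<mu> A * h K else 0) = (\<Sum>A\<in>S. gibbs adj \<mu> A * h K)"
      unfolding S_def by (auto simp: sum.If_cases Int_def)
    also have "\<dots> \<le> (\<Sum>A\<in>S. (q ^ card K * gibbs adj \<mu> (A \<union> K)) * h K)"
      using h gibbs_fill_cluster unfolding S_def q_def by (intro sum_mono mult_right_mono) auto
    also have "\<dots> = h K * q ^ card K * (\<Sum>A\<in>S. gibbs adj \<mu> (A \<union> K))"
      by (simp add: sum_distrib_left mult_ac)
    also have "(\<Sum>A\<in>S. gibbs adj \<mu> (A \<union> K)) = (\<Sum>A\<in>(\<lambda>A. A \<union> K) ` S. gibbs adj \<mu> A)"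
    proof (subst sum.reindex)
      have "A \<inter> K = {}" if "A \<in> S" for A using that ccomps_sub[of K near2 "V - A"] by (auto simp: S_def)
      then show "inj_on (\<lambda>A. A \<union> K) S" by (intro inj_onI) blast
    qed simp
    also have "\<dots> \<le> Z" unfolding Z_def
    proof (rule sum_mono2)
      show "(\<lambda>A. A \<union> K) ` S \<subseteq> Pow V" using ccomps_sub[of K near2] by (fastforce simp: S_def)
    qed (auto intro: less_imp_le gibbs_pos)
    then have "h K * q ^ card K * (\<Sum>A\<in>(\<lambda>A. A \<union> K) ` S. gibbs adj \<mu> A) \<le> h K * q ^ card K * Z"
      using h by (intro mult_left_mono) (auto simp: q_def)
    finally show "(\<Sum>A\<in>Pow V. if K \<in> ccomps near2 (V - A) then gibbs adj \<mu> A * h K else 0) \<le> h K * q ^ card K * Z" .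
  qed
  also have "\<dots> = Z * (\<Sum>K\<in>animals near2 V. h K * q ^ card K)" by (simp add: sum_distrib_left mult_ac)
  finally show ?thesis by (simp add: Z_def q_def)
qed

text \<open>The ratio \<open>r\<close> collects m^2 for the walks enumerating animals, exp (2 d^2 -
  mu) per filled vertex, and exp (2 d^2) to absorb the pair count by (2 d k)^d <= exp (2 d^2 k). The
  geometric sum from k = 1 is at most 2 r, which turns 5 into 10.\<close>

lemma animal_sum:
  assumes r: "r = real (2 * d + 4 * d ^ 2) ^ 2 * exp (4 * real d ^ 2 - \<mu>)" "r \<le> 1/2"
  shows "(\<Sum>K\<in>animals near2 V. real (5 * card V * (2 * d * card K) ^ d) * exp (2 * real d ^ 2 - \<mu>) ^ card K)
    \<le> 10 * r * real (card V) ^ 2"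
proof -
  define m where "m = 2 * d + 4 * d ^ 2"
  define q where "q = exp (2 * real d ^ 2 - \<mu>)"
  have "m \<ge> 1" using d2 by (simp add: m_def)
  then have m1: "real m \<ge> 1" by simp
  have finN: "finite (animals near2 V)" by (rule finite_subset[of _ "Pow V"]) (auto simp: animals_def)
  have r0: "r \<ge> 0" using r by simp
  have rq: "r = real m ^ 2 * (exp (2 * real d ^ 2) * q)"
    by (simp add: r(1) m_def q_def flip: exp_add)
  let ?g = "\<lambda>k. real (5 * card V * (2 * d * k) ^ d) * q ^ k"
  have "(\<Sum>K\<in>animals near2 V. ?g (card K))
      = (\<Sum>k\<in>card ` animals near2 V. \<Sum>K\<in>{K \<in> animals near2 V. card K = k}. ?g (card K))"
    by (rule sum.image_gen[OF finN])
  also have "\<dots> \<le> (\<Sum>k\<in>card ` animals near2 V. 5 * real (card V) ^ 2 * r ^ k)"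
  proof (rule sum_mono)
    fix k
    have "(\<Sum>K\<in>{K \<in> animals near2 V. card K = k}. ?g (card K))
        = real (card {K \<in> animals near2 V. card K = k}) * ?g k" by simp
    also have "\<dots> \<le> real (card V * m ^ (2 * (k - 1))) * ?g k"
      using card_animals_le[OF sym_near finite_verts near_degree, of d L k]
      by (intro mult_right_mono of_nat_mono) (auto simp: m_def q_def)
    also have "\<dots> \<le> real (card V * m ^ (2 * k)) * ?g k"
      using m1 by (intro mult_right_mono of_nat_mono mult_left_mono power_increasing) (auto simp: q_def)
    also have "\<dots> = 5 * real (card V) ^ 2 * (real m ^ 2) ^ k * q ^ k * (real (2 * d * k)) ^ d"
      by (simp add: power_mult power2_eq_square power_mult_distrib mult_ac)
    also have "\<dots> \<le> 5 * real (card V) ^ 2 * (real m ^ 2) ^ k * q ^ k * exp (2 * real d ^ 2) ^ k"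
    proof (rule mult_left_mono)
      have "real (2 * d * k) ^ d \<le> exp (real (2 * d * k)) ^ d"
        using exp_ge_add_one_self[of "real (2 * d * k)"] by (intro power_mono) linarith+
      also have "\<dots> = exp (2 * real d ^ 2) ^ k"
        by (simp add: exp_of_nat_mult[symmetric] power2_eq_square mult_ac)
      finally show "real (2 * d * k) ^ d \<le> exp (2 * real d ^ 2) ^ k" .
    qed (auto simp: q_def)
    also have "\<dots> = 5 * real (card V) ^ 2 * r ^ k" by (simp add: rq power_mult_distrib mult_ac)
    finally show "(\<Sum>K\<in>{K \<in> animals near2 V. card K = k}. ?g (card K)) \<le> 5 * real (card V) ^ 2 * r ^ k" .
  qed
  also have "\<dots> = 5 * real (card V) ^ 2 * (\<Sum>k\<in>card ` animals near2 V. r ^ k)" by (simp add: sum_distrib_left)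
  also have "\<dots> \<le> 5 * real (card V) ^ 2 * (2 * r ^ 1)"
  proof (intro mult_left_mono geometric_tail)
    fix k assume "k \<in> card ` animals near2 V"
    then obtain K where "k = card K" "K \<subseteq> V" "K \<noteq> {}" by (auto simp: animals_def)
    then show "1 \<le> k" using finite_subset[of K V] by (simp add: Suc_le_eq card_gt_0_iff)
  qed (use r0 r(2) finN in auto)
  also have "\<dots> = 10 * r * real (card V) ^ 2" by (simp add: mult_ac)
  finally show ?thesis by (simp only: q_def)
qed

text \<open>All pairs split into connected ones, counted by the sum of |C|^2, and disconnected ones.
  For the linear terms, each empty vertex makes |V| pairs disconnected, so |V| - |A| is at most the
  number of disconnected pairs divided by |V|.\<close>

lemma spin_deficit:
  assumes A: "A \<subseteq> V"
  shows "real (card V) * (card V + 2) \<le>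
    (\<Sum>C\<in>ccomps adj A. real (card C) * (card C + 2)) + real (card (disconnected d L A)) * (card V + 2) / card V"
proof -
  have finA: "finite A" using A by (rule finite_subset) simp
  define T where "T = {(v, w). v \<in> A \<and> w \<in> A \<and> w \<in> ccomp adj A v}"
  define D where "D = disconnected d L A"
  have D: "D = V \<times> V - T" and TV: "T \<subseteq> V \<times> V" using A by (auto simp: D_def T_def disconnected_def)
  have finD: "finite D" unfolding D by simp
  have "card D + card T = card (V \<times> V)"
    unfolding D using TV card_Diff_subset[of T "V \<times> V"] card_mono[OF _ TV] finite_subset[OF TV] by simp
  then have n: "real (card D) + (\<Sum>C\<in>ccomps adj A. real (card C) ^ 2) = real (card V) ^ 2"
    using card_connected_pairs[OF sym_adjT finA]
    by (simp add: T_def card_cartesian_product power2_eq_square flip: of_nat_sum of_nat_add of_nat_mult)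
  have "(V - A) \<times> V \<subseteq> D" by (auto simp: D_def disconnected_def)
  then have "card ((V - A) \<times> V) \<le> card D" using finD by (intro card_mono)
  then have "(real (card V) - card A) * card V \<le> card D"
    using card_Diff_subset[OF finA A] card_mono[OF finite_verts A]
    by (simp add: card_cartesian_product of_nat_diff flip: of_nat_mult of_nat_diff)
  moreover have V0: "real (card V) > 0" using L2 by (simp add: card_verts)
  ultimately have a: "real (card V) - card A \<le> card D / card V" by (simp add: pos_le_divide_eq)
  have "(\<Sum>C\<in>ccomps adj A. real (card C) * (card C + 2)) = (\<Sum>C\<in>ccomps adj A. real (card C) ^ 2) + 2 * real (card A)"
    using sum_card_ccomps[OF sym_adjT finA, of d L, symmetric]
    by (simp add: sum.distrib algebra_simps power2_eq_square sum_distrib_left)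
  moreover have "real (card D) * (card V + 2) / card V = card D + 2 * (card D / card V)"
  proof -
    have "x * (y + 2) / y = x + 2 * (x / y)" if "y > 0" for x y :: real
      using that by (simp add: field_simps)
    from this[OF V0] show ?thesis by (simp add: add.commute)
  qed
  ultimately show ?thesis using n a by (simp add: D_def power2_eq_square algebra_simps)
qed

lemma high_density_spin:
  assumes r: "r = real (2 * d + 4 * d ^ 2) ^ 2 * exp (4 * real d ^ 2 - \<mu>)" "r \<le> 1/2"
  shows "(\<Sum>A\<in>Pow V. gibbs adj \<mu> A) * (real (card V) * (card V + 2) * (1 - 10 * r))
    \<le> (\<Sum>A\<in>Pow V. gibbs adj \<mu> A * (\<Sum>C\<in>ccomps adj A. real (card C) * (card C + 2)))"
proof -
  define Z where "Z = (\<Sum>A\<in>Pow V. gibbs adj \<mu> A)"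
  define c where "c = real (card V)"
  have Z: "Z \<ge> 0" unfolding Z_def by (intro sum_nonneg less_imp_le gibbs_pos)
  have c: "c > 0" using L2 by (simp add: c_def card_verts)
  have "(\<Sum>A\<in>Pow V. gibbs adj \<mu> A * real (card (disconnected d L A)))
      \<le> (\<Sum>A\<in>Pow V. gibbs adj \<mu> A * (\<Sum>K\<in>ccomps near2 (V - A). real (5 * card V * (2 * d * card K) ^ d)))"
  proof (intro sum_mono mult_left_mono)
    fix A assume "A \<in> Pow V"
    then show "real (card (disconnected d L A)) \<le> (\<Sum>K\<in>ccomps near2 (V - A). real (5 * card V * (2 * d * card K) ^ d))"
      unfolding of_nat_sum[symmetric] by (intro of_nat_mono disconnected_card) auto
  qed (auto intro: less_imp_le gibbs_pos)
  also have "\<dots> \<le> Z * (\<Sum>K\<in>animals near2 V. real (5 * card V * (2 * d * card K) ^ d) * exp (2 * real d ^ 2 - \<mu>) ^ card K)"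
    unfolding Z_def by (rule peierls) simp
  also have "\<dots> \<le> Z * (10 * r * c ^ 2)"
    unfolding c_def using Z animal_sum[OF r] by (rule mult_left_mono[rotated])
  finally have "(\<Sum>A\<in>Pow V. gibbs adj \<mu> A * real (card (disconnected d L A))) * ((c + 2) / c)
      \<le> Z * (10 * r * c ^ 2) * ((c + 2) / c)" using c by (intro mult_right_mono) auto
  also have "\<dots> = Z * (10 * r * c * (c + 2))" using c by (simp add: power2_eq_square)
  finally have bad: "(\<Sum>A\<in>Pow V. gibbs adj \<mu> A * real (card (disconnected d L A))) * ((c + 2) / c)
      \<le> Z * (10 * r * c * (c + 2))" .
  have "Z * (c * (c + 2)) \<le> (\<Sum>A\<in>Pow V. gibbs adj \<mu> A *
      ((\<Sum>C\<in>ccomps adj A. real (card C) * (card C + 2)) + real (card (disconnected d L A)) * (card V + 2) / card V))"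
    unfolding Z_def c_def sum_distrib_right
    using spin_deficit by (intro sum_mono mult_left_mono) (auto intro: less_imp_le gibbs_pos simp: add.commute)
  also have "\<dots> = (\<Sum>A\<in>Pow V. gibbs adj \<mu> A * (\<Sum>C\<in>ccomps adj A. real (card C) * (card C + 2)))
      + (\<Sum>A\<in>Pow V. gibbs adj \<mu> A * real (card (disconnected d L A))) * ((c + 2) / c)"
    by (simp add: c_def algebra_simps sum.distrib sum_distrib_left sum_distrib_right add_divide_distrib sum_divide_distrib)
  finally show ?thesis using bad by (simp add: Z_def c_def algebra_simps)
qed

end

section \<open>Fermion operators\<close>

lemma sum_fun_app: "(\<Sum>i\<in>I. f i) x = (\<Sum>i\<in>I. f i x)" for f :: "'i \<Rightarrow> 'a \<Rightarrow> 'b::comm_monoid_add"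
  by (induction I rule: infinite_finite_induct) auto

text \<open>On an infinite set \<open>card\<close> is 0 and the Jordan-Wigner sign loses its
  meaning; the anticommutation relations are stated for states that vanish there.\<close>

definition fin_state :: "'m fstate \<Rightarrow> bool" where
  "fin_state \<psi> \<longleftrightarrow> (\<forall>S. infinite S \<longrightarrow> \<psi> S = 0)"

definition sc :: "complex \<Rightarrow> 'm fstate \<Rightarrow> 'm fstate" where
  "sc c \<psi> = (\<lambda>S. c * \<psi> S)"

definition lin :: "'m fop \<Rightarrow> bool" where
  "lin A \<longleftrightarrow> (\<forall>\<phi> \<psi>. A (\<phi> + \<psi>) = A \<phi> + A \<psi>) \<and> (\<forall>c \<psi>. A (sc c \<psi>) = sc c (A \<psi>))"

lemma sc_apply [simp]: "sc c \<psi> S = c * \<psi> S"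
  by (simp add: sc_def)

lemma sc_simps [simp]: "sc 0 \<psi> = 0" "sc 1 \<psi> = \<psi>" "sc c 0 = 0" "sc (- 1) \<psi> = - \<psi>"
  by (auto simp: fun_eq_iff)

lemma sc_add: "sc c (\<phi> + \<psi>) = sc c \<phi> + sc c \<psi>"
  by (auto simp: fun_eq_iff algebra_simps)

lemma sc_sc: "sc a (sc b \<psi>) = sc (a * b) \<psi>"
  by (auto simp: fun_eq_iff)

lemma smul_eq: "smul a A \<psi> = sc a (A \<psi>)"
  by (simp add: smul_def sc_def)

lemma lin_add: "lin A \<Longrightarrow> A (\<phi> + \<psi>) = A \<phi> + A \<psi>"
  and lin_sc: "lin A \<Longrightarrow> A (sc c \<psi>) = sc c (A \<psi>)"
  by (auto simp: lin_def)

lemma lin_zero: "lin A \<Longrightarrow> A 0 = 0"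
  using lin_sc[of A 0 0] by simp

lemma lin_uminus: "lin A \<Longrightarrow> A (- \<psi>) = - A \<psi>"
  using lin_sc[of A "-1" \<psi>] by simp

lemma lin_diff: "lin A \<Longrightarrow> A (\<phi> - \<psi>) = A \<phi> - A \<psi>"
  by (simp only: diff_conv_add_uminus lin_add lin_uminus)

lemma lin_sum: "lin A \<Longrightarrow> A (\<Sum>i\<in>I. f i) = (\<Sum>i\<in>I. A (f i))"
  by (induction I rule: infinite_finite_induct) (auto simp: lin_zero lin_add)

lemma lin_ann: "lin (ann x)" and lin_cre: "lin (cre x)"
  by (auto simp: lin_def ann_def cre_def fun_eq_iff algebra_simps)

lemma lin_comp: "lin A \<Longrightarrow> lin B \<Longrightarrow> lin (A \<circ> B)"
  by (simp add: lin_def)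

lemma lin_plus: "lin A \<Longrightarrow> lin B \<Longrightarrow> lin (A + B)"
  by (auto simp: lin_def sc_add algebra_simps)

lemma lin_opzero: "lin 0"
  by (simp add: lin_def)

lemma lin_opsum: "(\<And>i. i \<in> I \<Longrightarrow> lin (A i)) \<Longrightarrow> lin (\<Sum>i\<in>I. A i)"
  by (induction I rule: infinite_finite_induct) (auto intro: lin_plus lin_opzero)

lemma lin_smul: "lin A \<Longrightarrow> lin (smul a A)"
  by (auto simp: lin_def smul_eq sc_add sc_sc mult.commute)

lemma lin_numop: "lin (numop x)"
  unfolding numop_def by (intro lin_comp lin_ann lin_cre)

lemma lin_expN: "lin (expN \<mu>)"
  by (auto simp: lin_def expN_def fun_eq_iff algebra_simps)

lemma fsign_sq [simp]: "fsign x S * fsign x S = 1"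
  by (simp add: fsign_def flip: power_mult_distrib)

lemma fsign_nz [simp]: "fsign x S \<noteq> 0"
  by (simp add: fsign_def)

lemma norm_fsign [simp]: "norm (fsign x S) = 1"
  by (simp add: fsign_def norm_power)

lemma cnj_fsign [simp]: "cnj (fsign x S) = fsign x S"
  by (simp add: fsign_def)

lemma fsign_insert_same [simp]: "fsign x (insert x S) = fsign x S"
  unfolding fsign_def by (rule arg_cong[where f = "\<lambda>A. (-1) ^ card A"]) auto

lemma fsign_remove_same [simp]: "fsign x (S - {x}) = fsign x S"
  unfolding fsign_def by (rule arg_cong[where f = "\<lambda>A. (-1) ^ card A"]) auto

text \<open>The sign rule behind all anticommutation relations: of two distinct modes, only filling
  the smaller one flips the sign attached to the larger one.\<close>

lemma fsign_insert:
  assumes "finite S" "y \<notin> S"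
  shows "fsign x (insert y S) = (if y < x then - fsign x S else fsign x S)"
proof (cases "y < x")
  case True
  then have "{z \<in> insert y S. z < x} = insert y {z \<in> S. z < x}" by auto
  then show ?thesis using assms True by (simp add: fsign_def)
next
  case False
  then have "{z \<in> insert y S. z < x} = {z \<in> S. z < x}" by auto
  then show ?thesis using False by (simp add: fsign_def)
qed

lemma fin_ann: "fin_state \<psi> \<Longrightarrow> fin_state (ann x \<psi>)"
  by (auto simp: fin_state_def ann_def)

lemma fock_fin: "finite Ms \<Longrightarrow> \<psi> \<in> fock Ms \<Longrightarrow> fin_state \<psi>"
  by (auto simp: fock_def fin_state_def) (metis finite_subset)

lemma ann_ann:
  assumes "fin_state \<psi>" shows "ann x (ann y \<psi>) = - ann y (ann x \<psi>)"
proof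
  fix S
  show "ann x (ann y \<psi>) S = (- ann y (ann x \<psi>)) S"
  proof (cases "finite S \<and> x \<noteq> y \<and> x \<notin> S \<and> y \<notin> S")
    case True
    then show ?thesis
      by (cases x y rule: linorder_cases) (auto simp: ann_def fsign_insert insert_commute)
  next
    case False
    then show ?thesis using assms by (auto simp: ann_def fin_state_def)
  qed
qed

lemma cre_cre:
  assumes "fin_state \<psi>" shows "cre x (cre y \<psi>) = - cre y (cre x \<psi>)"
proof
  fix S
  show "cre x (cre y \<psi>) S = (- cre y (cre x \<psi>)) S"
  proof (cases "finite S \<and> x \<noteq> y \<and> x \<in> S \<and> y \<in> S")
    case True
    define T where "T = S - {x, y}"
    have S: "S = insert x (insert y T)" "x \<notin> T" "y \<notin> T" "finite T" using True by (auto simp: T_def)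
    have e: "insert x (insert y T) - {x} = insert y T" "insert x (insert y T) - {y} = insert x T"
      "insert y T - {y} = T" "insert x T - {x} = T" using S True by auto
    have f: "fsign x (insert x (insert y T)) = fsign x (insert y T)"
      "fsign y (insert x (insert y T)) = fsign y (insert x T)"
      using fsign_insert_same[of y "insert x T"] by (simp_all add: insert_commute)
    show ?thesis unfolding S(1) using S True
      by (cases x y rule: linorder_cases) (auto simp: cre_def e f fsign_insert)
  next
    case False
    then show ?thesis using assms by (auto simp: cre_def fin_state_def)
  qed
qed

lemma ann_cre:
  assumes "fin_state \<psi>" shows "ann x (cre y \<psi>) = (if x = y then \<psi> else 0) - cre y (ann x \<psi>)"
proof
  fix S
  show "ann x (cre y \<psi>) S = ((if x = y then \<psi> else 0) - cre y (ann x \<psi>)) S"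
  proof (cases "finite S")
    case False
    then show ?thesis using assms by (auto simp: ann_def cre_def fin_state_def)
  next
    case fin: True
    show ?thesis
    proof (cases "x = y")
      case True
      then show ?thesis
        by (cases "y \<in> S") (auto simp: ann_def cre_def insert_absorb mult.assoc[symmetric])
    next
      case False
      show ?thesis
      proof (cases "x \<notin> S \<and> y \<in> S")
        case True
        define T where "T = S - {y}"
        have S: "S = insert y T" "x \<notin> T" "y \<notin> T" "finite T" using True fin by (auto simp: T_def)
        have e: "insert x (insert y T) - {y} = insert x T" "insert y T - {y} = T" using S False by auto
        have f: "fsign y (insert x (insert y T)) = fsign y (insert x T)"
          using fsign_insert_same[of y "insert x T"] by (simp add: insert_commute)
        show ?thesis unfolding S(1) using S False
          by (cases x y rule: linorder_cases) (auto simp: ann_def cre_def e f fsign_insert)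
      next
        case f: False
        then show ?thesis using False by (auto simp: ann_def cre_def)
      qed
    qed
  qed
qed

lemma numop_eq: "numop x \<psi> = (\<lambda>S. if x \<in> S then \<psi> S else 0)"
  by (auto simp: numop_def cre_def ann_def fun_eq_iff insert_absorb mult.assoc[symmetric])

lemma ann_ann_eq_0_iff:
  assumes "x \<noteq> y"
  shows "ann x (ann y \<psi>) = 0 \<longleftrightarrow> (\<forall>S. x \<in> S \<longrightarrow> y \<in> S \<longrightarrow> \<psi> S = 0)"
proof
  assume z: "ann x (ann y \<psi>) = 0"
  show "\<forall>S. x \<in> S \<longrightarrow> y \<in> S \<longrightarrow> \<psi> S = 0"
  proof (intro allI impI)
    fix S assume "x \<in> S" "y \<in> S"
    then have "insert y (insert x (S - {x, y})) = S" by auto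
    moreover have "ann x (ann y \<psi>) (S - {x, y}) = 0" using z by simp
    ultimately show "\<psi> S = 0" using assms by (simp add: ann_def)
  qed
next
  assume "\<forall>S. x \<in> S \<longrightarrow> y \<in> S \<longrightarrow> \<psi> S = 0"
  then show "ann x (ann y \<psi>) = 0" by (auto simp: ann_def fun_eq_iff)
qed

section \<open>Fock space, projections and traces\<close>

lemma fock_add: "\<phi> \<in> fock Ms \<Longrightarrow> \<psi> \<in> fock Ms \<Longrightarrow> \<phi> + \<psi> \<in> fock Ms"
  and fock_sc: "\<psi> \<in> fock Ms \<Longrightarrow> sc c \<psi> \<in> fock Ms"
  and fock_zero: "0 \<in> fock Ms"
  by (auto simp: fock_def)

lemma fock_diff: "\<phi> \<in> fock Ms \<Longrightarrow> \<psi> \<in> fock Ms \<Longrightarrow> \<phi> - \<psi> \<in> fock Ms"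
  by (auto simp: fock_def)

lemma fock_sum: "(\<And>i. i \<in> I \<Longrightarrow> f i \<in> fock Ms) \<Longrightarrow> (\<Sum>i\<in>I. f i) \<in> fock Ms"
  by (induction I rule: infinite_finite_induct) (auto intro: fock_add fock_zero)

lemma fock_ann: "\<psi> \<in> fock Ms \<Longrightarrow> ann x \<psi> \<in> fock Ms"
  by (auto simp: fock_def ann_def)

lemma fock_cre: "x \<in> Ms \<Longrightarrow> \<psi> \<in> fock Ms \<Longrightarrow> cre x \<psi> \<in> fock Ms"
proof -
  assume x: "x \<in> Ms" and \<psi>: "\<psi> \<in> fock Ms"
  have "cre x \<psi> S = 0" if "\<not> S \<subseteq> Ms" for S
  proof -
    have "\<not> S - {x} \<subseteq> Ms" using that x by auto
    then show ?thesis using \<psi> by (simp add: fock_def cre_def)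
  qed
  then show ?thesis by (simp add: fock_def)
qed

lemma fock_basisv: "S \<subseteq> Ms \<Longrightarrow> basisv S \<in> fock Ms"
  by (auto simp: fock_def basisv_def)

lemma finner_add_right: "finner Ms \<chi> (\<phi> + \<psi>) = finner Ms \<chi> \<phi> + finner Ms \<chi> \<psi>"
  and finner_diff_right: "finner Ms \<chi> (\<phi> - \<psi>) = finner Ms \<chi> \<phi> - finner Ms \<chi> \<psi>"
  and finner_add_left: "finner Ms (\<phi> + \<psi>) \<chi> = finner Ms \<phi> \<chi> + finner Ms \<psi> \<chi>"
  by (simp_all add: finner_def algebra_simps sum.distrib sum_subtractf)

lemma finner_sc_right: "finner Ms \<chi> (sc c \<phi>) = c * finner Ms \<chi> \<phi>"
  and finner_sc_left: "finner Ms (sc c \<phi>) \<chi> = cnj c * finner Ms \<phi> \<chi>"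
  by (simp_all add: finner_def sum_distrib_left mult_ac)

lemma finner_zero [simp]: "finner Ms \<chi> 0 = 0" "finner Ms 0 \<chi> = 0"
  by (simp_all add: finner_def)

lemma finner_sum_left: "finner Ms (\<Sum>i\<in>I. f i) \<chi> = (\<Sum>i\<in>I. finner Ms (f i) \<chi>)"
  unfolding finner_def sum_fun_app cnj_sum sum_distrib_right by (rule sum.swap)

lemma finner_sum_right: "finner Ms \<chi> (\<Sum>i\<in>I. f i) = (\<Sum>i\<in>I. finner Ms \<chi> (f i))"
  unfolding finner_def sum_fun_app sum_distrib_left by (rule sum.swap)

lemma finner_self: "finner Ms \<psi> \<psi> = of_real (\<Sum>S\<in>Pow Ms. (norm (\<psi> S))\<^sup>2)"
  unfolding finner_def of_real_sum
  by (intro sum.cong refl) (simp add: complex_norm_square mult.commute del: of_real_power)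

lemma finner_self_zero:
  assumes "finite Ms" "\<psi> \<in> fock Ms" "finner Ms \<psi> \<psi> = 0" shows "\<psi> = 0"
proof
  fix S
  have "(\<Sum>S\<in>Pow Ms. (norm (\<psi> S))\<^sup>2) = 0" using assms(3) by (simp only: finner_self of_real_eq_0_iff)
  then have "\<forall>S\<in>Pow Ms. (norm (\<psi> S))\<^sup>2 = 0"
    using assms(1) by (subst (asm) sum_nonneg_eq_0_iff) auto
  then show "\<psi> S = 0 S" using assms(2) by (cases "S \<subseteq> Ms") (auto simp: fock_def)
qed

lemma finner_cre:
  assumes "finite Ms" "x \<in> Ms"
  shows "finner Ms \<phi> (cre x \<psi>) = finner Ms (ann x \<phi>) \<psi>"
proof -
  have "finner Ms \<phi> (cre x \<psi>) = (\<Sum>S\<in>{S \<in> Pow Ms. x \<in> S}. cnj (\<phi> S) * (fsign x S * \<psi> (S - {x})))"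
    unfolding finner_def cre_def using assms
    by (intro sum.mono_neutral_cong_right) auto
  also have "\<dots> = (\<Sum>S\<in>{S \<in> Pow Ms. x \<notin> S}. cnj (\<phi> (insert x S)) * (fsign x S * \<psi> S))"
    using assms by (intro sum.reindex_bij_witness[of _ "insert x" "\<lambda>S. S - {x}"]) (auto simp: insert_absorb)
  also have "\<dots> = finner Ms (ann x \<phi>) \<psi>"
    unfolding finner_def ann_def using assms
    by (intro sum.mono_neutral_cong_left) auto
  finally show ?thesis .
qed

text \<open>Existence of the orthogonal projection onto the span of a finite, possibly dependent
  family. The part \<open>r\<close> of the new vector orthogonal to the old span is split off, and
  only the component of the old residual along \<open>r\<close> still has to be removed.\<close>

lemma gram_schmidt:
  assumes "finite Ms" "finite I" "\<And>i. i \<in> I \<Longrightarrow> b i \<in> fock Ms"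
  shows "\<exists>c. \<forall>i\<in>I. finner Ms (b i) (\<psi> - (\<Sum>k\<in>I. sc (c k) (b k))) = 0"
  using assms(2,3)
proof (induction arbitrary: \<psi> rule: finite_induct)
  case (insert j I)
  obtain e where e: "\<And>i. i \<in> I \<Longrightarrow> finner Ms (b i) (b j - (\<Sum>k\<in>I. sc (e k) (b k))) = 0"
    using insert.IH[of "b j"] insert.prems by blast
  obtain c where c: "\<And>i. i \<in> I \<Longrightarrow> finner Ms (b i) (\<psi> - (\<Sum>k\<in>I. sc (c k) (b k))) = 0"
    using insert.IH[of \<psi>] insert.prems by blast
  define E where "E = (\<Sum>k\<in>I. sc (e k) (b k))"
  define \<psi>' where "\<psi>' = \<psi> - (\<Sum>k\<in>I. sc (c k) (b k))"
  define r where "r = b j - E"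
  \<comment> \<open>For r = 0 the new vector depends on the earlier ones and nothing is
    subtracted.\<close>
  define \<alpha> where "\<alpha> = (if r = 0 then 0 else finner Ms r \<psi>' / finner Ms r r)"
  have rf: "r \<in> fock Ms"
    using insert.prems unfolding r_def E_def by (intro fock_diff fock_sum fock_sc) auto
  define c' where "c' k = (if k = j then \<alpha> else c k - \<alpha> * e k)" for k
  have "(\<Sum>k\<in>I. sc (c' k) (b k)) = (\<Sum>k\<in>I. sc (c k) (b k)) - sc \<alpha> E"
  proof -
    have "(\<Sum>k\<in>I. sc (c' k) (b k)) = (\<Sum>k\<in>I. sc (c k) (b k) - sc \<alpha> (sc (e k) (b k)))"
      using insert(2) by (intro sum.cong) (auto simp: c'_def fun_eq_iff algebra_simps)
    also have "\<dots> = (\<Sum>k\<in>I. sc (c k) (b k)) - (\<Sum>k\<in>I. sc \<alpha> (sc (e k) (b k)))" by (rule sum_subtractf)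
    also have "(\<Sum>k\<in>I. sc \<alpha> (sc (e k) (b k))) = sc \<alpha> E"
      unfolding E_def by (auto simp: fun_eq_iff sum_fun_app sum_distrib_left)
    finally show ?thesis .
  qed
  then have new: "\<psi> - (\<Sum>k\<in>insert j I. sc (c' k) (b k)) = \<psi>' - sc \<alpha> r"
    using insert(1,2) by (auto simp: c'_def \<psi>'_def r_def fun_eq_iff algebra_simps)
  have perp: "finner Ms (b i) (\<psi>' - sc \<alpha> r) = 0" if "i \<in> I" for i
    using c[OF that] e[OF that] by (simp add: finner_diff_right finner_sc_right \<psi>'_def r_def E_def)
  have perp_r: "finner Ms r (\<psi>' - sc \<alpha> r) = 0"
  proof (cases "r = 0")
    case False
    then have "finner Ms r r \<noteq> 0" using finner_self_zero[OF assms(1) rf] by auto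
    then show ?thesis using False by (simp add: finner_diff_right finner_sc_right \<alpha>_def)
  qed simp
  have "finner Ms E (\<psi>' - sc \<alpha> r) = 0"
    unfolding E_def finner_sum_left finner_sc_left using perp by simp
  moreover have "b j = r + E" by (simp add: r_def)
  ultimately have "finner Ms (b j) (\<psi>' - sc \<alpha> r) = 0" using perp_r by (simp add: finner_add_left)
  then have "\<forall>i\<in>insert j I. finner Ms (b i) (\<psi> - (\<Sum>k\<in>insert j I. sc (c' k) (b k))) = 0"
    using perp new by auto
  then show ?case by blast
qed simp

text \<open>The spanning vectors \<open>b\<close> need not be orthogonal. The linear functionals
  \<open>\<xi>\<close> replace inner products with a dual basis, which is all that traces over the
  kernel require.\<close>

locale kernel_basis =
  fixes Ms :: "'m::linorder set" and H :: "'m fop" and I :: "'i set"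
    and b :: "'i \<Rightarrow> 'm fstate" and \<xi> :: "'i \<Rightarrow> 'm fstate \<Rightarrow> complex"
  assumes finMs: "finite Ms" and finI: "finite I" and linH: "lin H"
    and b_fock: "\<And>i. i \<in> I \<Longrightarrow> b i \<in> fock Ms" and b_ker: "\<And>i. i \<in> I \<Longrightarrow> H (b i) = 0"
    and xi_add: "\<And>i \<phi> \<psi>. \<xi> i (\<phi> + \<psi>) = \<xi> i \<phi> + \<xi> i \<psi>"
    and xi_sc: "\<And>i c \<psi>. \<xi> i (sc c \<psi>) = c * \<xi> i \<psi>"
    and expand: "\<And>\<psi>. \<psi> \<in> fock Ms \<Longrightarrow> H \<psi> = 0 \<Longrightarrow> \<psi> = (\<Sum>i\<in>I. sc (\<xi> i \<psi>) (b i))"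
begin

definition ker :: "'m fstate set" where
  "ker = {\<psi> \<in> fock Ms. H \<psi> = 0}"

lemma ker_add: "\<phi> \<in> ker \<Longrightarrow> \<psi> \<in> ker \<Longrightarrow> \<phi> + \<psi> \<in> ker"
  and ker_sc: "\<psi> \<in> ker \<Longrightarrow> sc c \<psi> \<in> ker"
  and ker_zero: "0 \<in> ker"
  using linH by (auto simp: ker_def lin_add lin_sc lin_zero intro: fock_add fock_sc fock_zero)

lemma ker_sum: "(\<And>i. i \<in> J \<Longrightarrow> f i \<in> ker) \<Longrightarrow> (\<Sum>i\<in>J. f i) \<in> ker"
  by (induction J rule: infinite_finite_induct) (auto intro: ker_add ker_zero)

lemma ker_diff: "\<phi> \<in> ker \<Longrightarrow> \<psi> \<in> ker \<Longrightarrow> \<phi> - \<psi> \<in> ker"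
  using ker_add[of \<phi> "- \<psi>"] ker_sc[of \<psi> "-1"] by simp

lemma b_in_ker: "i \<in> I \<Longrightarrow> b i \<in> ker"
  using b_fock b_ker by (simp add: ker_def)

lemma xi_sum: "\<xi> i (\<Sum>k\<in>J. f k) = (\<Sum>k\<in>J. \<xi> i (f k))"
proof -
  have "\<xi> i 0 = 0" using xi_sc[of i 0 0] by simp
  then show ?thesis by (induction J rule: infinite_finite_induct) (auto simp: xi_add)
qed

definition is_proj :: "'m fstate \<Rightarrow> 'm fstate \<Rightarrow> bool" where
  "is_proj \<psi> \<phi> \<longleftrightarrow> \<phi> \<in> ker \<and> (\<forall>\<chi>\<in>ker. finner Ms \<chi> (\<psi> - \<phi>) = 0)"

lemma is_proj_ex: "\<exists>\<phi>. is_proj \<psi> \<phi>"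
proof -
  obtain c where c: "\<forall>i\<in>I. finner Ms (b i) (\<psi> - (\<Sum>k\<in>I. sc (c k) (b k))) = 0"
    using gram_schmidt[of Ms I b \<psi>] finMs finI b_fock by blast
  define \<phi> where "\<phi> = (\<Sum>k\<in>I. sc (c k) (b k))"
  have "finner Ms \<chi> (\<psi> - \<phi>) = 0" if "\<chi> \<in> ker" for \<chi>
  proof -
    have "\<chi> = (\<Sum>i\<in>I. sc (\<xi> i \<chi>) (b i))" using that expand by (auto simp: ker_def)
    then have "finner Ms \<chi> (\<psi> - \<phi>) = finner Ms (\<Sum>i\<in>I. sc (\<xi> i \<chi>) (b i)) (\<psi> - \<phi>)"
      by (rule arg_cong)
    also have "\<dots> = (\<Sum>i\<in>I. cnj (\<xi> i \<chi>) * finner Ms (b i) (\<psi> - \<phi>))"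
      by (simp only: finner_sum_left finner_sc_left)
    finally show ?thesis using c by (simp add: \<phi>_def)
  qed
  moreover have "\<phi> \<in> ker" unfolding \<phi>_def by (intro ker_sum ker_sc b_in_ker)
  ultimately show ?thesis by (auto simp: is_proj_def)
qed

lemma is_proj_unique:
  assumes "is_proj \<psi> \<phi>" "is_proj \<psi> \<phi>'" shows "\<phi> = \<phi>'"
proof -
  have d: "\<phi> - \<phi>' \<in> ker" using assms by (auto simp: is_proj_def intro: ker_diff)
  have "finner Ms (\<phi> - \<phi>') (\<phi> - \<phi>') = finner Ms (\<phi> - \<phi>') ((\<psi> - \<phi>') - (\<psi> - \<phi>))" by simp
  also have "\<dots> = 0" unfolding finner_diff_right[of _ _ "\<psi> - \<phi>'"] using assms d by (auto simp: is_proj_def)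
  finally have "\<phi> - \<phi>' = 0" using d finMs by (intro finner_self_zero) (auto simp: ker_def)
  then show ?thesis by simp
qed

abbreviation "P0 \<equiv> zero_proj Ms H"

text \<open>Makes the definite description usable: Gram-Schmidt gives existence, and the difference
  of two projections lies in the kernel and is orthogonal to itself.\<close>

lemma P0_iff: "P0 \<psi> = \<phi> \<longleftrightarrow> is_proj \<psi> \<phi>"
proof -
  have eq: "P0 \<psi> = (THE \<phi>. is_proj \<psi> \<phi>)"
    unfolding zero_proj_def is_proj_def ker_def
    by (rule arg_cong[where f = The]) (auto simp: fun_eq_iff zero_fun_def fun_diff_def)
  obtain \<phi>0 where p: "is_proj \<psi> \<phi>0" using is_proj_ex by blast
  then have "P0 \<psi> = \<phi>0" unfolding eq using is_proj_unique by blast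
  then show ?thesis using p is_proj_unique by blast
qed

lemma P0_proj: "is_proj \<psi> (P0 \<psi>)"
  using P0_iff by blast

lemma P0_ker: "P0 \<psi> \<in> ker"
  using P0_proj by (simp add: is_proj_def)

lemma P0_id: "\<psi> \<in> ker \<Longrightarrow> P0 \<psi> = \<psi>"
  unfolding P0_iff by (simp add: is_proj_def)

lemma lin_P0: "lin P0"
  unfolding lin_def
proof (intro conjI allI)
  fix \<phi> \<psi>
  have "\<phi> + \<psi> - (P0 \<phi> + P0 \<psi>) = (\<phi> - P0 \<phi>) + (\<psi> - P0 \<psi>)" by simp
  then have "finner Ms \<chi> (\<phi> + \<psi> - (P0 \<phi> + P0 \<psi>))
      = finner Ms \<chi> (\<phi> - P0 \<phi>) + finner Ms \<chi> (\<psi> - P0 \<psi>)" for \<chi>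
    by (simp only: finner_add_right)
  then show "P0 (\<phi> + \<psi>) = P0 \<phi> + P0 \<psi>"
    unfolding P0_iff using P0_proj[of \<phi>] P0_proj[of \<psi>]
    by (auto simp: is_proj_def intro!: ker_add)
next
  fix c \<psi>
  have "sc c \<psi> - sc c (P0 \<psi>) = sc c (\<psi> - P0 \<psi>)" by (auto simp: fun_eq_iff algebra_simps)
  then show "P0 (sc c \<psi>) = sc c (P0 \<psi>)"
    unfolding P0_iff using P0_proj[of \<psi>] by (auto simp: is_proj_def finner_sc_right intro: ker_sc)
qed

text \<open>Cyclicity in coordinates: expanding \<open>P0 (basisv S)\<close> in the vectors
  \<open>b\<close> and summing over \<open>S\<close> first reassembles \<open>P0 (T (b i))\<close>,
  which is \<open>T (b i)\<close> because that vector is in the kernel.\<close>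

lemma trace_on_kernel:
  assumes T: "lin T" and Tb: "\<And>i. i \<in> I \<Longrightarrow> T (b i) \<in> ker"
  shows "ftrace Ms (T \<circ> P0) = (\<Sum>i\<in>I. \<xi> i (T (b i)))"
proof -
  have exp: "P0 \<psi> = (\<Sum>i\<in>I. sc (\<xi> i (P0 \<psi>)) (b i))" for \<psi>
    using expand P0_ker[of \<psi>] by (auto simp: ker_def)
  have decomp: "\<psi> = (\<Sum>S\<in>Pow Ms. sc (\<psi> S) (basisv S))" if "\<psi> \<in> fock Ms" for \<psi>
  proof
    fix S
    show "\<psi> S = (\<Sum>S\<in>Pow Ms. sc (\<psi> S) (basisv S)) S"
      using that finMs by (auto simp: sum_fun_app basisv_def fock_def if_distrib cong: if_cong)
  qed
  have "(T \<circ> P0) (basisv S) S = (\<Sum>i\<in>I. \<xi> i (P0 (basisv S)) * T (b i) S)" for S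
  proof -
    have "T (P0 (basisv S)) = T (\<Sum>i\<in>I. sc (\<xi> i (P0 (basisv S))) (b i))" by (rule arg_cong[OF exp])
    also have "\<dots> = (\<Sum>i\<in>I. sc (\<xi> i (P0 (basisv S))) (T (b i)))" by (simp add: lin_sum[OF T] lin_sc[OF T])
    finally show ?thesis by (simp add: sum_fun_app)
  qed
  then have "ftrace Ms (T \<circ> P0) = (\<Sum>S\<in>Pow Ms. \<Sum>i\<in>I. \<xi> i (P0 (basisv S)) * T (b i) S)"
    by (simp only: ftrace_def)
  also have "\<dots> = (\<Sum>i\<in>I. \<Sum>S\<in>Pow Ms. \<xi> i (P0 (basisv S)) * T (b i) S)" by (rule sum.swap)
  also have "\<dots> = (\<Sum>i\<in>I. \<xi> i (T (b i)))"
  proof (rule sum.cong[OF refl])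
    fix i assume i: "i \<in> I"
    have "T (b i) = P0 (T (b i))" using P0_id[OF Tb[OF i]] by simp
    also have "\<dots> = P0 (\<Sum>S\<in>Pow Ms. sc (T (b i) S) (basisv S))"
      using Tb[OF i] by (intro arg_cong[where f = P0] decomp) (simp add: ker_def)
    also have "\<dots> = (\<Sum>S\<in>Pow Ms. sc (T (b i) S) (P0 (basisv S)))"
      by (simp add: lin_sum[OF lin_P0] lin_sc[OF lin_P0])
    finally have "\<xi> i (T (b i)) = \<xi> i (\<Sum>S\<in>Pow Ms. sc (T (b i) S) (P0 (basisv S)))"
      by (rule arg_cong)
    also have "\<dots> = (\<Sum>S\<in>Pow Ms. \<xi> i (sc (T (b i) S) (P0 (basisv S))))" by (rule xi_sum)
    finally show "(\<Sum>S\<in>Pow Ms. \<xi> i (P0 (basisv S)) * T (b i) S) = \<xi> i (T (b i))"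
      by (simp add: xi_sc mult.commute)
  qed
  finally show ?thesis .
qed

end

section \<open>Spin operators\<close>

locale spin_sites =
  fixes X :: "(bool \<Rightarrow> nat list) set"
  assumes finX: "finite X"
    and injX: "\<And>x y s r. x \<in> X \<Longrightarrow> y \<in> X \<Longrightarrow> x s = y r \<longleftrightarrow> x = y \<and> s = r"
begin

text \<open>The generators of gl(2) acting on spin: \<open>hop True False\<close> raises,
  \<open>hop False True\<close> lowers, and the diagonal ones count the electrons of each
  spin.\<close>

definition hop :: "bool \<Rightarrow> bool \<Rightarrow> nat list fop" where
  "hop s r = (\<Sum>x\<in>X. cre (x s) \<circ> ann (x r))"

definition spin_tot :: "nat \<Rightarrow> nat list fop" where
  "spin_tot a = (\<Sum>x\<in>X. spin_op a x)"

lemma hop_apply: "hop s r \<psi> = (\<Sum>x\<in>X. cre (x s) (ann (x r) \<psi>))"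
  by (simp add: hop_def sum_fun_app)

lemma lin_hop: "lin (hop s r)"
  unfolding hop_def by (intro lin_opsum lin_comp lin_ann lin_cre)

lemma hop_same: "hop s s \<psi> = (\<lambda>S. of_nat (card {x \<in> X. x s \<in> S}) * \<psi> S)"
proof
  fix S
  have "hop s s \<psi> S = (\<Sum>x\<in>X. if x s \<in> S then \<psi> S else 0)"
    unfolding hop_apply sum_fun_app
    by (intro sum.cong refl) (simp only: numop_eq[unfolded numop_def comp_apply])
  also have "\<dots> = of_nat (card {x \<in> X. x s \<in> S}) * \<psi> S"
    using finX by (simp add: sum.inter_filter[symmetric])
  finally show "hop s s \<psi> S = of_nat (card {x \<in> X. x s \<in> S}) * \<psi> S" .
qed

lemma hop_hop:
  assumes "fin_state \<psi>"
  shows "hop s r (hop s' r' \<psi>) = (if r = s' then hop s r' \<psi> else 0)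
    - (\<Sum>x\<in>X. \<Sum>y\<in>X. cre (x s) (cre (y s') (ann (x r) (ann (y r') \<psi>))))"
proof -
  have "cre (x s) (ann (x r) (cre (y s') (ann (y r') \<psi>)))
      = (if x = y \<and> r = s' then cre (x s) (ann (x r') \<psi>) else 0)
        - cre (x s) (cre (y s') (ann (x r) (ann (y r') \<psi>)))" if "x \<in> X" "y \<in> X" for x y
  proof -
    have "ann (x r) (cre (y s') (ann (y r') \<psi>))
        = (if x = y \<and> r = s' then ann (y r') \<psi> else 0) - cre (y s') (ann (x r) (ann (y r') \<psi>))"
      using ann_cre[OF fin_ann[OF assms], of "x r" "y s'" "y r'"] injX[OF that] by simp
    then show ?thesis
      by (cases "x = y \<and> r = s'") (simp_all only: simp_thms if_True if_False lin_diff[OF lin_cre] lin_zero[OF lin_cre])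
  qed
  then have "hop s r (hop s' r' \<psi>) = (\<Sum>x\<in>X. \<Sum>y\<in>X. (if x = y \<and> r = s' then cre (x s) (ann (x r') \<psi>) else 0)
        - cre (x s) (cre (y s') (ann (x r) (ann (y r') \<psi>))))"
    unfolding hop_apply lin_sum[OF lin_ann] lin_sum[OF lin_cre] by (intro sum.cong refl)
  also have "\<dots> = (\<Sum>x\<in>X. \<Sum>y\<in>X. (if x = y \<and> r = s' then cre (x s) (ann (x r') \<psi>) else 0))
        - (\<Sum>x\<in>X. \<Sum>y\<in>X. cre (x s) (cre (y s') (ann (x r) (ann (y r') \<psi>))))"
    by (simp only: sum_subtractf)
  also have "(\<Sum>x\<in>X. \<Sum>y\<in>X. (if x = y \<and> r = s' then cre (x s) (ann (x r') \<psi>) else 0))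
      = (if r = s' then hop s r' \<psi> else 0)"
    using finX by (cases "r = s'") (simp_all add: hop_apply sum.delta)
  finally show ?thesis .
qed

text \<open>In both orders the normally ordered quartic term is the same, since exchanging the two
  creators and the two annihilators produces two signs. Only the contractions of
  \<open>hop_hop\<close> remain.\<close>

lemma hop_commutator:
  assumes "fin_state \<psi>"
  shows "hop s r (hop s' r' \<psi>) - hop s' r' (hop s r \<psi>)
    = (if r = s' then hop s r' \<psi> else 0) - (if s = r' then hop s' r \<psi> else 0)"
proof -
  have sym: "(\<Sum>x\<in>X. \<Sum>y\<in>X. cre (x s) (cre (y s') (ann (x r) (ann (y r') \<psi>))))
      = (\<Sum>y\<in>X. \<Sum>x\<in>X. cre (y s') (cre (x s) (ann (y r') (ann (x r) \<psi>))))"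
  proof (subst sum.swap, intro sum.cong refl)
    fix x y
    have c: "cre (x s) (cre (y s') (ann (x r) (ann (y r') \<psi>))) = - cre (y s') (cre (x s) (ann (x r) (ann (y r') \<psi>)))"
      by (intro cre_cre fin_ann assms)
    have a: "ann (x r) (ann (y r') \<psi>) = - ann (y r') (ann (x r) \<psi>)" by (intro ann_ann assms)
    have "cre (y s') (cre (x s) (ann (x r) (ann (y r') \<psi>))) = - cre (y s') (cre (x s) (ann (y r') (ann (x r) \<psi>)))"
      by (simp only: a lin_uminus[OF lin_cre])
    then show "cre (x s) (cre (y s') (ann (x r) (ann (y r') \<psi>)))
        = cre (y s') (cre (x s) (ann (y r') (ann (x r) \<psi>)))"
      unfolding c by (simp only: minus_minus)
  qed
  have "s = r' \<longleftrightarrow> r' = s" by auto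
  then show ?thesis unfolding hop_hop[OF assms] sym by (simp only: diff_diff_eq2 diff_add_eq add_diff_eq) (simp add: algebra_simps)
qed

lemma spin_tot_apply:
  "spin_tot a \<psi> = sc (1/2) (\<Sum>s\<in>UNIV. \<Sum>r\<in>UNIV. sc (pauli a s r) (hop s r \<psi>))"
proof
  fix S
  have "spin_tot a \<psi> S = (\<Sum>x\<in>X. 1/2 * (\<Sum>s\<in>UNIV. \<Sum>r\<in>UNIV. pauli a s r * cre (x s) (ann (x r) \<psi>) S))"
    by (simp only: spin_tot_def spin_op_def sum_fun_app smul_def comp_apply)
  also have "\<dots> = 1/2 * (\<Sum>s\<in>UNIV. \<Sum>r\<in>UNIV. \<Sum>x\<in>X. pauli a s r * cre (x s) (ann (x r) \<psi>) S)"
    by (simp only: sum_distrib_left[symmetric] sum.swap[of _ X] sum.swap[of _ _ X])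
  finally show "spin_tot a \<psi> S = sc (1/2) (\<Sum>s\<in>UNIV. \<Sum>r\<in>UNIV. sc (pauli a s r) (hop s r \<psi>)) S"
    by (simp only: sc_apply sum_fun_app hop_apply sum_distrib_left)
qed

lemma UNIV_bool_sum: "(\<Sum>s\<in>UNIV. f s) = f True + f False" for f :: "bool \<Rightarrow> 'c::comm_monoid_add"
  by (simp add: UNIV_bool add.commute)

lemma spin_tot_3: "spin_tot 3 \<psi> = sc (1/2) (hop True True \<psi> - hop False False \<psi>)"
  unfolding spin_tot_apply UNIV_bool_sum by (auto simp: pauli_def fun_eq_iff)

lemma spin_tot_1: "spin_tot 1 \<psi> = sc (1/2) (hop True False \<psi> + hop False True \<psi>)"
  unfolding spin_tot_apply UNIV_bool_sum by (auto simp: pauli_def fun_eq_iff)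

lemma spin_tot_2: "spin_tot 2 \<psi> = sc (\<i>/2) (hop False True \<psi> - hop True False \<psi>)"
  unfolding spin_tot_apply UNIV_bool_sum by (auto simp: pauli_def fun_eq_iff algebra_simps)

lemma lin_spin_tot: "lin (spin_tot a)"
  unfolding spin_tot_def spin_op_def
  by (intro lin_opsum lin_smul lin_comp lin_ann lin_cre)

text \<open>The terms that raise twice or lower twice cancel between the squares of components 1 and
  2, which leaves the ladder form.\<close>

lemma spin_square:
  "(\<Sum>a\<in>{1,2,3}. spin_tot a \<circ> spin_tot a) \<psi> = spin_tot 3 (spin_tot 3 \<psi>)
    + sc (1/2) (hop True False (hop False True \<psi>) + hop False True (hop True False \<psi>))"
proof -
  let ?P = "hop True False" and ?M = "hop False True"
  have s1: "spin_tot 1 (spin_tot 1 \<psi>) = sc (1/4) (?P (?P \<psi>) + ?P (?M \<psi>) + ?M (?P \<psi>) + ?M (?M \<psi>))"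
    unfolding spin_tot_1 lin_sc[OF lin_hop] lin_add[OF lin_hop]
    by (auto simp: fun_eq_iff algebra_simps)
  have s2: "spin_tot 2 (spin_tot 2 \<psi>) = sc (1/4) (- ?P (?P \<psi>) + ?P (?M \<psi>) + ?M (?P \<psi>) - ?M (?M \<psi>))"
    unfolding spin_tot_2 lin_sc[OF lin_hop] lin_diff[OF lin_hop]
    by (auto simp: fun_eq_iff algebra_simps)
  have "(\<Sum>a\<in>{1,2,3}. spin_tot a \<circ> spin_tot a) \<psi>
      = spin_tot 1 (spin_tot 1 \<psi>) + spin_tot 2 (spin_tot 2 \<psi>) + spin_tot 3 (spin_tot 3 \<psi>)"
    by (simp add: sum_fun_app add.assoc)
  also have "\<dots> = spin_tot 3 (spin_tot 3 \<psi>) + sc (1/2) (?P (?M \<psi>) + ?M (?P \<psi>))"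
    unfolding s1 s2 by (auto simp: fun_eq_iff algebra_simps)
  finally show ?thesis .
qed

end

text \<open>Cyclicity of the trace turns \<open>[S\<^sup>+, S\<^sup>-] = 2 S\<^sup>3\<close> into the equality of the traces of
  \<open>S\<^sup>+ S\<^sup>-\<close>, \<open>S\<^sup>- S\<^sup>+\<close> and \<open>2 (S\<^sup>3)\<^sup>2\<close>.\<close>

lemma (in kernel_basis) ladder_trace:
  fixes m w :: "'i \<Rightarrow> complex" and P M :: "'m fop"
  assumes xi_b: "\<And>i k. i \<in> I \<Longrightarrow> k \<in> I \<Longrightarrow> \<xi> i (b k) = (if i = k then 1 else 0)"
    and lin: "lin P" "lin M"
    and ker: "\<And>i. i \<in> I \<Longrightarrow> P (b i) \<in> ker" "\<And>i. i \<in> I \<Longrightarrow> M (b i) \<in> ker"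
    and comm: "\<And>i. i \<in> I \<Longrightarrow> P (M (b i)) - M (P (b i)) = sc (2 * m i) (b i)"
    and grade: "\<And>i k. i \<in> I \<Longrightarrow> k \<in> I \<Longrightarrow> \<xi> k (P (b i)) \<noteq> 0 \<Longrightarrow> m k = m i + 1 \<and> w k = w i"
  shows "(\<Sum>i\<in>I. w i * \<xi> i (P (M (b i)))) = (\<Sum>i\<in>I. 2 * w i * m i ^ 2)"
    and "(\<Sum>i\<in>I. w i * \<xi> i (M (P (b i)))) = (\<Sum>i\<in>I. 2 * w i * m i ^ 2)"
proof -
  define p where "p k i = \<xi> k (P (b i))" for k i
  define q where "q k i = \<xi> k (M (b i))" for k i
  have comp: "\<xi> i (A (B (b k))) = (\<Sum>l\<in>I. \<xi> l (B (b k)) * \<xi> i (A (b l)))"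
    if "lin A" "B (b k) \<in> ker" for A B i k
  proof -
    have "A (B (b k)) = A (\<Sum>l\<in>I. sc (\<xi> l (B (b k))) (b l))"
      using that(2) by (intro arg_cong[where f = A] expand) (auto simp: ker_def)
    also have "\<dots> = (\<Sum>l\<in>I. sc (\<xi> l (B (b k))) (A (b l)))"
      by (simp only: lin_sum[OF that(1)] lin_sc[OF that(1)])
    finally show ?thesis by (simp only: xi_sum xi_sc)
  qed
  have PM: "\<xi> i (P (M (b i))) = (\<Sum>l\<in>I. p i l * q l i)" if "i \<in> I" for i
    using comp[of P M i i] lin(1) ker(2)[OF that] by (simp add: p_def q_def mult.commute)
  have MP: "\<xi> i (M (P (b i))) = (\<Sum>l\<in>I. p l i * q i l)" if "i \<in> I" for i
    using comp[of M P i i] lin(2) ker(1)[OF that] by (simp add: p_def q_def)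
  \<comment> \<open>\<open>P\<close> raises \<open>m\<close> by 1 and preserves \<open>w\<close>, so
    m i = m l + 1 and w i = w l wherever p i l is nonzero.\<close>
  have gr: "w i * (p i l * q l i) = w l * (p i l * q l i)"
    "m i * (p i l * q l i) = (m l + 1) * (p i l * q l i)" if "i \<in> I" "l \<in> I" for i l
    using grade[OF that(2,1)] by (auto simp: p_def)
  define a where "a = (\<Sum>i\<in>I. \<Sum>l\<in>I. w i * (p i l * q l i))"
  have A1: "(\<Sum>i\<in>I. w i * \<xi> i (P (M (b i)))) = a"
    unfolding a_def by (intro sum.cong refl) (simp add: PM sum_distrib_left)
  have A2: "(\<Sum>i\<in>I. w i * \<xi> i (M (P (b i)))) = a"
  proof -
    have "(\<Sum>i\<in>I. w i * \<xi> i (M (P (b i)))) = (\<Sum>i\<in>I. \<Sum>l\<in>I. w i * (p l i * q i l))"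
      by (intro sum.cong refl) (simp add: MP sum_distrib_left)
    also have "\<dots> = (\<Sum>l\<in>I. \<Sum>i\<in>I. w i * (p l i * q i l))" by (rule sum.swap)
    also have "\<dots> = a" unfolding a_def by (intro sum.cong refl) (rule gr(1)[symmetric])
    finally show ?thesis .
  qed
  have "\<xi> i (P (M (b i))) - \<xi> i (M (P (b i))) = 2 * m i" if "i \<in> I" for i
  proof -
    have "\<xi> i (P (M (b i))) = \<xi> i ((P (M (b i)) - M (P (b i))) + M (P (b i)))" by simp
    also have "\<dots> = \<xi> i (P (M (b i)) - M (P (b i))) + \<xi> i (M (P (b i)))" by (rule xi_add)
    also have "\<xi> i (P (M (b i)) - M (P (b i))) = 2 * m i"
      unfolding comm[OF that] xi_sc using xi_b[OF that that] by simp
    finally show ?thesis by simp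
  qed
  \<comment> \<open>The trace of w m [P, M] is computed twice: \<open>comm\<close> gives 2 w m^2,
    while after swapping indices the two double sums differ by the factor m i - m l = 1, leaving
    \<open>a\<close>.\<close>
  then have "(\<Sum>i\<in>I. 2 * w i * m i ^ 2) = (\<Sum>i\<in>I. w i * m i * (\<xi> i (P (M (b i))) - \<xi> i (M (P (b i)))))"
    by (intro sum.cong refl) (simp add: power2_eq_square)
  also have "\<dots> = (\<Sum>i\<in>I. \<Sum>l\<in>I. w i * m i * (p i l * q l i)) - (\<Sum>i\<in>I. \<Sum>l\<in>I. w i * m i * (p l i * q i l))"
    by (simp add: PM MP algebra_simps sum_subtractf sum_distrib_left cong: sum.cong)
  also have "(\<Sum>i\<in>I. \<Sum>l\<in>I. w i * m i * (p l i * q i l)) = (\<Sum>l\<in>I. \<Sum>i\<in>I. w i * m i * (p l i * q i l))"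
    by (rule sum.swap)
  also have "(\<Sum>i\<in>I. \<Sum>l\<in>I. w i * m i * (p i l * q l i)) - (\<Sum>l\<in>I. \<Sum>i\<in>I. w i * m i * (p l i * q i l)) = a"
    unfolding a_def sum_subtractf[symmetric]
  proof (intro sum.cong refl)
    fix i l assume il: "i \<in> I" "l \<in> I"
    have "w i * m i * (p i l * q l i) - w l * m l * (p i l * q l i)
        = w i * (m i * (p i l * q l i)) - m l * (w l * (p i l * q l i))" by (simp add: algebra_simps)
    also have "\<dots> = w i * ((m l + 1) * (p i l * q l i)) - m l * (w i * (p i l * q l i))"
      by (simp only: gr[OF il])
    also have "\<dots> = w i * (p i l * q l i)" by (simp add: algebra_simps)
    finally show "w i * m i * (p i l * q l i) - w l * m l * (p i l * q l i) = w i * (p i l * q l i)" .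
  qed
  finally show "(\<Sum>i\<in>I. w i * \<xi> i (P (M (b i)))) = (\<Sum>i\<in>I. 2 * w i * m i ^ 2)"
    and "(\<Sum>i\<in>I. w i * \<xi> i (M (P (b i)))) = (\<Sum>i\<in>I. 2 * w i * m i ^ 2)"
    using A1 A2 by simp_all
qed

section \<open>Zero-energy states of a decorated graph\<close>

text \<open>Every bond \<open>e\<close> carries a midpoint; \<open>vm\<close> and \<open>mm\<close> are the modes of vertices and midpoints.\<close>

locale decorated_graph =
  fixes V :: "'v set" and E :: "'e set" and src tgt :: "'e \<Rightarrow> 'v"
    and vm :: "'v \<Rightarrow> bool \<Rightarrow> 'm::linorder" and mm :: "'e \<Rightarrow> bool \<Rightarrow> 'm"
    and t lam U U' :: real
  assumes finV: "finite V" and finE: "finite E"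
    and ends: "\<And>e. e \<in> E \<Longrightarrow> src e \<in> V" "\<And>e. e \<in> E \<Longrightarrow> tgt e \<in> V" "\<And>e. e \<in> E \<Longrightarrow> src e \<noteq> tgt e"
    and vm_inj: "\<And>v w s r. vm v s = vm w r \<longleftrightarrow> v = w \<and> s = r"
    and mm_inj: "\<And>e f s r. mm e s = mm f r \<longleftrightarrow> e = f \<and> s = r"
    and vm_mm: "\<And>v e s r. vm v s \<noteq> mm e r"
    and pos: "t > 0" "lam > 0" "U > 0" "U' > 0"
begin

lemma mm_vm: "mm e r \<noteq> vm v s"
  using vm_mm[of v s e r] by metis

definition Ms :: "'m set" where
  "Ms = {vm v s | v s. v \<in> V} \<union> {mm e s | e s. e \<in> E}"

definition vmodes :: "'m set" where
  "vmodes = {vm v s | v s. v \<in> V}"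

definition aop :: "'e \<Rightarrow> bool \<Rightarrow> 'm fop" where
  "aop e s = ann (vm (src e) s) + ann (vm (tgt e) s) + smul (complex_of_real lam) (ann (mm e s))"

definition cop :: "'e \<Rightarrow> bool \<Rightarrow> 'm fop" where
  "cop e s = cre (vm (src e) s) + cre (vm (tgt e) s) + smul (complex_of_real lam) (cre (mm e s))"

definition hamiltonian :: "'m fop" where
  "hamiltonian = (\<Sum>s\<in>UNIV. \<Sum>e\<in>E. smul (complex_of_real t) (cop e s \<circ> aop e s))
   + (smul (complex_of_real U) (\<Sum>v\<in>V. numop (vm v True) \<circ> numop (vm v False))
    + smul (complex_of_real U') (\<Sum>e\<in>E. numop (mm e True) \<circ> numop (mm e False)))"

definition adj :: "('v \<times> 'v) set" where
  "adj = {(v, w). \<exists>e\<in>E. (v = src e \<and> w = tgt e) \<or> (w = src e \<and> v = tgt e)}"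

lemma sym_adj: "sym adj"
  by (auto simp: adj_def sym_def)

lemma finMs: "finite Ms"
proof -
  have "Ms \<subseteq> (\<lambda>(v, s). vm v s) ` (V \<times> UNIV) \<union> (\<lambda>(e, s). mm e s) ` (E \<times> UNIV)"
    by (auto simp: Ms_def)
  then show ?thesis using finV finE by (auto intro: finite_subset)
qed

lemma modes_in: "v \<in> V \<Longrightarrow> vm v s \<in> Ms" "e \<in> E \<Longrightarrow> mm e s \<in> Ms"
  by (auto simp: Ms_def)

lemma lin_aop: "lin (aop e s)" and lin_cop: "lin (cop e s)"
  unfolding aop_def cop_def by (intro lin_plus lin_smul lin_ann lin_cre)+

lemma lin_hamiltonian: "lin hamiltonian"
  unfolding hamiltonian_def
  by (intro lin_plus lin_smul lin_opsum lin_comp lin_aop lin_cop lin_numop)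

lemma aop_apply: "aop e s \<psi> = ann (vm (src e) s) \<psi> + ann (vm (tgt e) s) \<psi> + sc (complex_of_real lam) (ann (mm e s) \<psi>)"
  by (simp add: aop_def smul_eq)

lemma fock_aop: "\<psi> \<in> fock Ms \<Longrightarrow> aop e s \<psi> \<in> fock Ms"
  unfolding aop_apply by (intro fock_add fock_sc fock_ann)

lemma finner_cop:
  assumes "e \<in> E" shows "finner Ms \<phi> (cop e s \<psi>) = finner Ms (aop e s \<phi>) \<psi>"
proof -
  have "finner Ms \<phi> (cop e s \<psi>) = finner Ms \<phi> (cre (vm (src e) s) \<psi>) + finner Ms \<phi> (cre (vm (tgt e) s) \<psi>)
      + complex_of_real lam * finner Ms \<phi> (cre (mm e s) \<psi>)"
    by (simp only: cop_def plus_fun_apply smul_eq finner_add_right finner_sc_right)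
  then show ?thesis
    using finner_cre[OF finMs modes_in(1)[OF ends(1)[OF assms]]] finner_cre[OF finMs modes_in(1)[OF ends(2)[OF assms]]]
      finner_cre[OF finMs modes_in(2)[OF assms]]
    by (simp only: aop_apply finner_add_left finner_sc_left complex_cnj_complex_of_real)
qed

section \<open>The conditions for zero energy\<close>

definition zero_energy :: "'m fstate \<Rightarrow> bool" where
  "zero_energy \<psi> \<longleftrightarrow> \<psi> \<in> fock Ms \<and> (\<forall>e\<in>E. \<forall>s. aop e s \<psi> = 0)
    \<and> (\<forall>v\<in>V. \<forall>S. vm v True \<in> S \<longrightarrow> vm v False \<in> S \<longrightarrow> \<psi> S = 0)
    \<and> (\<forall>e\<in>E. \<forall>S. mm e True \<in> S \<longrightarrow> mm e False \<in> S \<longrightarrow> \<psi> S = 0)"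

definition interaction :: "'m set \<Rightarrow> real" where
  "interaction S = U * card {v \<in> V. vm v True \<in> S \<and> vm v False \<in> S}
    + U' * card {e \<in> E. mm e True \<in> S \<and> mm e False \<in> S}"

lemma hamiltonian_apply:
  "hamiltonian \<psi> = (\<Sum>s\<in>UNIV. \<Sum>e\<in>E. sc (complex_of_real t) (cop e s (aop e s \<psi>)))
    + (\<lambda>S. complex_of_real (interaction S) * \<psi> S)"
proof
  fix S
  have v: "(\<Sum>v\<in>V. (numop (vm v True) \<circ> numop (vm v False)) \<psi> S)
      = of_nat (card {v \<in> V. vm v True \<in> S \<and> vm v False \<in> S}) * \<psi> S"
  proof -
    have "(\<Sum>v\<in>V. (numop (vm v True) \<circ> numop (vm v False)) \<psi> S)
        = (\<Sum>v\<in>V. if vm v True \<in> S \<and> vm v False \<in> S then \<psi> S else 0)"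
      by (intro sum.cong refl) (auto simp: numop_eq)
    then show ?thesis using finV by (simp add: sum.inter_filter[symmetric])
  qed
  have e: "(\<Sum>e\<in>E. (numop (mm e True) \<circ> numop (mm e False)) \<psi> S)
      = of_nat (card {e \<in> E. mm e True \<in> S \<and> mm e False \<in> S}) * \<psi> S"
  proof -
    have "(\<Sum>e\<in>E. (numop (mm e True) \<circ> numop (mm e False)) \<psi> S)
        = (\<Sum>e\<in>E. if mm e True \<in> S \<and> mm e False \<in> S then \<psi> S else 0)"
      by (intro sum.cong refl) (auto simp: numop_eq)
    then show ?thesis using finE by (simp add: sum.inter_filter[symmetric])
  qed
  have "hamiltonian \<psi> S = (\<Sum>s\<in>UNIV. \<Sum>e\<in>E. complex_of_real t * cop e s (aop e s \<psi>) S)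
      + (complex_of_real U * (\<Sum>v\<in>V. (numop (vm v True) \<circ> numop (vm v False)) \<psi> S)
        + complex_of_real U' * (\<Sum>e\<in>E. (numop (mm e True) \<circ> numop (mm e False)) \<psi> S))"
    by (simp only: hamiltonian_def plus_fun_apply sum_fun_app smul_def comp_apply)
  then show "hamiltonian \<psi> S = ((\<Sum>s\<in>UNIV. \<Sum>e\<in>E. sc (complex_of_real t) (cop e s (aop e s \<psi>)))
    + (\<lambda>S. complex_of_real (interaction S) * \<psi> S)) S"
    unfolding v e by (simp add: sum_fun_app interaction_def algebra_simps)
qed

text \<open>The expectation of the Hamiltonian is a sum of squared norms with positive coefficients:
  t times the norms of \<open>aop e s \<psi>\<close>, plus |\<psi> S|^2 weighted by the interaction
  of S. It vanishes only if every summand does.\<close>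

lemma hamiltonian_zero_iff:
  assumes "\<psi> \<in> fock Ms"
  shows "hamiltonian \<psi> = 0 \<longleftrightarrow> zero_energy \<psi>"
proof
  assume H: "hamiltonian \<psi> = 0"
  define h where "h s e = (\<Sum>S\<in>Pow Ms. (norm (aop e s \<psi> S))\<^sup>2)" for s e
  have hop: "finner Ms \<psi> (sc (complex_of_real t) (cop e s (aop e s \<psi>))) = complex_of_real (t * h s e)"
    if "e \<in> E" for e s
    using that by (simp only: finner_sc_right finner_cop finner_self h_def of_real_mult)
  have int: "finner Ms \<psi> (\<lambda>S. complex_of_real (interaction S) * \<psi> S)
      = complex_of_real (\<Sum>S\<in>Pow Ms. interaction S * (norm (\<psi> S))\<^sup>2)"
    unfolding finner_def of_real_sum
  proof (intro sum.cong refl)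
    fix S
    have "complex_of_real ((norm (\<psi> S))\<^sup>2) = \<psi> S * cnj (\<psi> S)" by (rule complex_norm_square)
    then show "cnj (\<psi> S) * (complex_of_real (interaction S) * \<psi> S) = complex_of_real (interaction S * (norm (\<psi> S))\<^sup>2)"
      by (simp only: of_real_mult mult_ac)
  qed
  have "0 = finner Ms \<psi> (hamiltonian \<psi>)" using H by simp
  also have "\<dots> = (\<Sum>s\<in>UNIV. \<Sum>e\<in>E. complex_of_real (t * h s e))
      + complex_of_real (\<Sum>S\<in>Pow Ms. interaction S * (norm (\<psi> S))\<^sup>2)"
    unfolding hamiltonian_apply finner_add_right finner_sum_right int using hop by (simp cong: sum.cong)
  also have "\<dots> = complex_of_real ((\<Sum>s\<in>UNIV. \<Sum>e\<in>E. t * h s e) + (\<Sum>S\<in>Pow Ms. interaction S * (norm (\<psi> S))\<^sup>2))"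
    by (simp only: of_real_add of_real_sum)
  finally have "complex_of_real ((\<Sum>s\<in>UNIV. \<Sum>e\<in>E. t * h s e) + (\<Sum>S\<in>Pow Ms. interaction S * (norm (\<psi> S))\<^sup>2)) = 0" by (rule sym)
  then have sum0: "(\<Sum>s\<in>UNIV. \<Sum>e\<in>E. t * h s e) + (\<Sum>S\<in>Pow Ms. interaction S * (norm (\<psi> S))\<^sup>2) = 0"
    by (simp only: of_real_eq_0_iff)
  have h0: "h s e \<ge> 0" for s e unfolding h_def by (intro sum_nonneg) simp
  have i0: "interaction S \<ge> 0" for S unfolding interaction_def using pos by simp
  have n1: "(\<Sum>s\<in>UNIV. \<Sum>e\<in>E. t * h s e) \<ge> 0" using h0 pos by (intro sum_nonneg) simp
  have n2: "(\<Sum>S\<in>Pow Ms. interaction S * (norm (\<psi> S))\<^sup>2) \<ge> 0" using i0 by (intro sum_nonneg) simp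
  have "(\<Sum>s\<in>UNIV. \<Sum>e\<in>E. t * h s e) = 0" "(\<Sum>S\<in>Pow Ms. interaction S * (norm (\<psi> S))\<^sup>2) = 0"
    using sum0 n1 n2 by linarith+
  then have hz: "\<forall>s. \<forall>e\<in>E. t * h s e = 0" and iz: "\<forall>S\<in>Pow Ms. interaction S * (norm (\<psi> S))\<^sup>2 = 0"
    using h0 pos i0 finE finMs by (simp_all add: sum_nonneg_eq_0_iff sum_nonneg)
  have a0: "aop e s \<psi> = 0" if "e \<in> E" for e s
  proof (rule finner_self_zero[OF finMs fock_aop[OF assms]])
    show "finner Ms (aop e s \<psi>) (aop e s \<psi>) = 0"
      using hz that pos unfolding finner_self by (simp add: h_def)
  qed
  have out: "\<psi> S = 0" if "interaction S \<noteq> 0" for S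
    using iz assms that by (cases "S \<subseteq> Ms") (auto simp: fock_def)
  have vz: "\<psi> S = 0" if "v \<in> V" "vm v True \<in> S" "vm v False \<in> S" for v S
  proof (rule out)
    have "card {v \<in> V. vm v True \<in> S \<and> vm v False \<in> S} > 0"
      using that finV by (auto simp: card_gt_0_iff)
    then have "U * card {v \<in> V. vm v True \<in> S \<and> vm v False \<in> S} > 0" using pos by simp
    moreover have "U' * card {e \<in> E. mm e True \<in> S \<and> mm e False \<in> S} \<ge> 0" using pos by simp
    ultimately show "interaction S \<noteq> 0" unfolding interaction_def by linarith
  qed
  have ez: "\<psi> S = 0" if "e \<in> E" "mm e True \<in> S" "mm e False \<in> S" for e S
  proof (rule out)
    have "card {e \<in> E. mm e True \<in> S \<and> mm e False \<in> S} > 0"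
      using that finE by (auto simp: card_gt_0_iff)
    then have "U' * card {e \<in> E. mm e True \<in> S \<and> mm e False \<in> S} > 0" using pos by simp
    moreover have "U * card {v \<in> V. vm v True \<in> S \<and> vm v False \<in> S} \<ge> 0" using pos by simp
    ultimately show "interaction S \<noteq> 0" unfolding interaction_def by linarith
  qed
  show "zero_energy \<psi>" unfolding zero_energy_def using assms a0 vz ez by blast
next
  assume z: "zero_energy \<psi>"
  have int: "complex_of_real (interaction S) * \<psi> S = 0" for S
  proof (cases "\<psi> S = 0")
    case False
    then have "{v \<in> V. vm v True \<in> S \<and> vm v False \<in> S} = {}" "{e \<in> E. mm e True \<in> S \<and> mm e False \<in> S} = {}"
      using z unfolding zero_energy_def by blast+
    then have "interaction S = 0" unfolding interaction_def by (simp only:) simp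
    then show ?thesis by simp
  qed simp
  have "(\<lambda>S. complex_of_real (interaction S) * \<psi> S) = 0" by (rule ext) (simp only: int zero_fun_apply)
  moreover have "(\<Sum>s\<in>UNIV. \<Sum>e\<in>E. sc (complex_of_real t) (cop e s (aop e s \<psi>))) = 0"
    using z unfolding zero_energy_def
    by (intro sum.neutral ballI) (simp add: lin_zero[OF lin_cop])
  ultimately show "hamiltonian \<psi> = 0" unfolding hamiltonian_apply by (simp only: add_0)
qed

text \<open>The hopping condition \<open>aop e s \<psi> = 0\<close> expresses midpoint amplitudes through vertex amplitudes.\<close>

lemma determined_by_vertices:
  assumes \<psi>: "\<psi> \<in> fock Ms" "\<And>e s. e \<in> E \<Longrightarrow> aop e s \<psi> = 0"
    and z: "\<And>S. S \<subseteq> vmodes \<Longrightarrow> \<psi> S = 0"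
  shows "\<psi> = 0"
proof
  fix S
  have "\<psi> S = 0" if "S \<subseteq> Ms" for S
    using that
  \<comment> \<open>Induction on the number of occupied midpoint modes: moving an electron from a
    midpoint to an end of its bond lowers this number.\<close>
  proof (induction "card (S - vmodes)" arbitrary: S rule: less_induct)
    case less
    show ?case
    proof (cases "S \<subseteq> vmodes")
      case True then show ?thesis by (rule z)
    next
      case False
      then obtain e s where e: "e \<in> E" "mm e s \<in> S"
        using less.prems unfolding Ms_def vmodes_def by blast
      define T where "T = S - {mm e s}"
      have TS: "mm e s \<notin> T" "insert (mm e s) T = S" using e by (auto simp: T_def)
      have "finite S" using less.prems finMs finite_subset by blast
      have mv: "mm e s \<notin> vmodes" using mm_vm by (auto simp: vmodes_def)
      have v: "ann (vm v s) \<psi> T = 0" if "v \<in> V" for v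
      proof -
        have vv: "vm v s \<in> vmodes" using that by (auto simp: vmodes_def)
        have "insert (vm v s) T - vmodes = (S - vmodes) - {mm e s}" using vv by (auto simp: T_def)
        moreover have "card ((S - vmodes) - {mm e s}) < card (S - vmodes)"
          using e mv \<open>finite S\<close> by (intro card_Diff1_less) auto
        moreover have "insert (vm v s) T \<subseteq> Ms" using less.prems that by (auto simp: T_def modes_in)
        ultimately have "\<psi> (insert (vm v s) T) = 0" using less.hyps by simp
        then show ?thesis by (simp add: ann_def)
      qed
      have "aop e s \<psi> T = 0" using \<psi>(2)[OF e(1)] by simp
      then have "complex_of_real lam * ann (mm e s) \<psi> T = 0"
        using v[OF ends(1)[OF e(1)]] v[OF ends(2)[OF e(1)]] by (simp add: aop_apply)
      then show ?thesis using pos TS by (simp add: ann_def)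
    qed
  qed
  then show "\<psi> S = 0 S" using \<psi>(1) by (cases "S \<subseteq> Ms") (auto simp: fock_def)
qed

lemma aop_ann:
  assumes "fin_state \<psi>" shows "aop e s (ann x \<psi>) = - ann x (aop e s \<psi>)"
proof -
  have "ann y (ann x \<psi>) = - ann x (ann y \<psi>)" for y by (rule ann_ann[OF assms])
  then show ?thesis
    unfolding aop_apply lin_add[OF lin_ann] lin_sc[OF lin_ann] by (auto simp: fun_eq_iff algebra_simps)
qed

text \<open>Creates an electron in the flat-band state localized around \<open>v\<close>; the
  coefficient - 1 / lam is dictated by the cancellation in \<open>aop_bdag\<close>.\<close>

definition bdag :: "'v \<Rightarrow> bool \<Rightarrow> 'm fop" where
  "bdag v s = cre (vm v s) + smul (complex_of_real (- 1 / lam)) (\<Sum>e\<in>{e \<in> E. src e = v \<or> tgt e = v}. cre (mm e s))"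

text \<open>The electron at a vertex of the list has spin up exactly if the vertex is in
  \<open>P\<close>. The list fixes the order of the creation operators, hence the sign of the
  state.\<close>

fun phi :: "'v list \<Rightarrow> 'v set \<Rightarrow> 'm fstate" where
  "phi [] P = basisv {}"
| "phi (v # l) P = bdag v (v \<in> P) (phi l P)"

lemma bdag_apply: "bdag v s \<psi> = cre (vm v s) \<psi>
    + sc (complex_of_real (- 1 / lam)) (\<Sum>e\<in>{e \<in> E. src e = v \<or> tgt e = v}. cre (mm e s) \<psi>)"
  by (simp only: bdag_def plus_fun_apply smul_eq sum_fun_app)

lemma lin_bdag: "lin (bdag v s)"
  unfolding bdag_def by (intro lin_plus lin_smul lin_opsum lin_cre)

lemma fock_bdag: "v \<in> V \<Longrightarrow> \<psi> \<in> fock Ms \<Longrightarrow> bdag v s \<psi> \<in> fock Ms"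
  unfolding bdag_apply by (intro fock_add fock_sc fock_sum fock_cre modes_in) auto

lemma ann_bdag:
  assumes "fin_state \<psi>"
  shows "ann x (bdag v s \<psi>) = (if x = vm v s then \<psi> else 0)
      + sc (complex_of_real (- 1 / lam)) (\<Sum>e\<in>{e \<in> E. src e = v \<or> tgt e = v}. if x = mm e s then \<psi> else 0)
      - bdag v s (ann x \<psi>)"
  unfolding bdag_apply lin_add[OF lin_ann] lin_sc[OF lin_ann] lin_sum[OF lin_ann] ann_cre[OF assms]
  by (auto simp: fun_eq_iff sum_subtractf sum_fun_app algebra_simps)

lemma ann_vm_bdag:
  assumes "fin_state \<psi>"
  shows "ann (vm w r) (bdag v s \<psi>) = (if w = v \<and> r = s then \<psi> else 0) - bdag v s (ann (vm w r) \<psi>)"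
  unfolding ann_bdag[OF assms] using vm_inj vm_mm by simp

lemma ann_mm_bdag:
  assumes "fin_state \<psi>" "f \<in> E"
  shows "ann (mm f r) (bdag v s \<psi>)
    = sc (if (src f = v \<or> tgt f = v) \<and> r = s then complex_of_real (- 1 / lam) else 0) \<psi> - bdag v s (ann (mm f r) \<psi>)"
proof -
  have "(\<Sum>e\<in>{e \<in> E. src e = v \<or> tgt e = v}. if mm f r = mm e s then \<psi> else 0)
      = (if (src f = v \<or> tgt f = v) \<and> r = s then \<psi> else 0)"
    using finE assms(2) by (cases "r = s") (auto simp: mm_inj sum.delta')
  then show ?thesis unfolding ann_bdag[OF assms(1)] using mm_vm by simp
qed

text \<open>For equal spins and a bond at \<open>v\<close>, the contraction at the end is 1 and that
  at the midpoint is lam * (- 1 / lam); they cancel, so bond operators pass through localized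
  electrons and reach the vacuum.\<close>

lemma aop_bdag:
  assumes "fin_state \<psi>" "e \<in> E"
  shows "aop e r (bdag v s \<psi>) = - bdag v s (aop e r \<psi>)"
proof -
  have ne: "src e \<noteq> tgt e" using ends(3)[OF assms(2)] .
  have lam: "complex_of_real lam * complex_of_real (- 1 / lam) = - 1" using pos
    by (simp flip: of_real_mult)
  show ?thesis
    unfolding aop_apply ann_vm_bdag[OF assms(1)] ann_mm_bdag[OF assms] lin_add[OF lin_bdag] lin_sc[OF lin_bdag]
    using ne lam by (cases "r = s"; cases "src e = v"; cases "tgt e = v") (auto simp: fun_eq_iff algebra_simps)
qed

lemma basisv_fock: "basisv {} \<in> fock Ms"
  by (rule fock_basisv) simp

lemma phi_fock: "set l \<subseteq> V \<Longrightarrow> phi l P \<in> fock Ms"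
  by (induction l) (auto intro: fock_bdag basisv_fock)

lemma phi_fin: "set l \<subseteq> V \<Longrightarrow> fin_state (phi l P)"
  by (rule fock_fin[OF finMs phi_fock])

lemma ann_vac: "ann x (basisv {}) = 0"
  by (auto simp: ann_def basisv_def fun_eq_iff)

lemma aop_phi: "set l \<subseteq> V \<Longrightarrow> e \<in> E \<Longrightarrow> aop e s (phi l P) = 0"
proof (induction l)
  case Nil
  then show ?case by (simp add: aop_apply ann_vac)
next
  case (Cons v l)
  then have "aop e s (phi l P) = 0" "fin_state (phi l P)" by (auto intro: phi_fin)
  then show ?case using Cons.prems by (simp only: phi.simps aop_bdag lin_zero[OF lin_bdag] minus_zero)
qed

definition conf :: "'v set \<Rightarrow> 'v set \<Rightarrow> 'm set" where
  "conf A P = (\<lambda>v. vm v (v \<in> P)) ` A"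

lemma conf_vmodes: "A \<subseteq> V \<Longrightarrow> conf A P \<subseteq> vmodes"
  by (auto simp: conf_def vmodes_def)

lemma conf_mem: "vm v s \<in> conf A P \<longleftrightarrow> v \<in> A \<and> s = (v \<in> P)"
  by (auto simp: conf_def vm_inj)

lemma conf_inj: "conf A P = conf B Q \<Longrightarrow> P \<subseteq> A \<Longrightarrow> Q \<subseteq> B \<Longrightarrow> A = B \<and> P = Q"
proof -
  assume eq: "conf A P = conf B Q" and sub: "P \<subseteq> A" "Q \<subseteq> B"
  have "v \<in> A \<and> s = (v \<in> P) \<longleftrightarrow> v \<in> B \<and> s = (v \<in> Q)" for v s
    using eq conf_mem by metis
  then show ?thesis using sub by blast
qed

text \<open>The midpoint terms of \<open>bdag\<close> cannot contribute to a configuration of vertex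
  modes, so each product state has exactly one such configuration in its support. Coordinates and
  linear independence rest on this.\<close>

lemma phi_at_vertices:
  assumes "distinct l" "set l \<subseteq> V" "S \<subseteq> vmodes"
  shows "phi l P S \<noteq> 0 \<longleftrightarrow> S = conf (set l) P"
  using assms
proof (induction l arbitrary: S)
  case Nil
  then show ?case by (auto simp: basisv_def conf_def)
next
  case (Cons v l)
  let ?s = "v \<in> P"
  have "mm e ?s \<notin> S" for e using Cons.prems(3) mm_vm by (auto simp: vmodes_def)
  then have "phi (v # l) P S = cre (vm v ?s) (phi l P) S"
    by (simp add: bdag_apply sum_fun_app cre_def)
  also have "\<dots> \<noteq> 0 \<longleftrightarrow> vm v ?s \<in> S \<and> phi l P (S - {vm v ?s}) \<noteq> 0" by (simp add: cre_def)
  also have "\<dots> \<longleftrightarrow> vm v ?s \<in> S \<and> S - {vm v ?s} = conf (set l) P"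
    using Cons.IH[of "S - {vm v ?s}"] Cons.prems by auto
  also have "\<dots> \<longleftrightarrow> S = insert (vm v ?s) (conf (set l) P)"
    using Cons.prems(1) conf_mem[of v ?s "set l" P] by auto
  finally show ?case by (simp add: conf_def)
qed

lemma ann_phi_zero:
  assumes "set l \<subseteq> V" "\<not> (v \<in> set l \<and> s = (v \<in> P))"
  shows "ann (vm v s) (phi l P) = 0"
  using assms
proof (induction l)
  case Nil then show ?case by (simp add: ann_vac)
next
  case (Cons u l)
  then have "ann (vm v s) (phi l P) = 0" "\<not> (v = u \<and> s = (u \<in> P))" by auto
  moreover have "fin_state (phi l P)" using Cons.prems by (intro phi_fin) auto
  ultimately show ?case
    using Cons.prems by (auto simp only: phi.simps ann_vm_bdag lin_zero[OF lin_bdag] if_False diff_zero)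
qed

lemma phi_cong: "(\<And>u. u \<in> set l \<Longrightarrow> (u \<in> P) = (u \<in> Q)) \<Longrightarrow> phi l P = phi l Q"
  by (induction l) auto

text \<open>Removing the electron at \<open>w\<close> erases its spin, and the sign depends only on
  its position in the list.\<close>

lemma ann_phi_flip:
  assumes "distinct l" "set l \<subseteq> V" "\<And>u. u \<in> set l \<Longrightarrow> u \<noteq> w \<Longrightarrow> (u \<in> P) = (u \<in> Q)"
  shows "ann (vm w (w \<in> P)) (phi l P) = ann (vm w (w \<in> Q)) (phi l Q)"
  using assms
proof (induction l)
  case Nil then show ?case by (simp add: ann_vac)
next
  case (Cons u l)
  have fin: "fin_state (phi l P)" "fin_state (phi l Q)" using Cons.prems by (auto intro: phi_fin)
  show ?case
  proof (cases "u = w")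
    case True
    then have "w \<notin> set l" using Cons.prems by auto
    then have "phi l P = phi l Q" "ann (vm w (w \<in> P)) (phi l P) = 0" "ann (vm w (w \<in> Q)) (phi l Q) = 0"
      using Cons.prems by (auto intro!: phi_cong ann_phi_zero)
    then show ?thesis using True fin by (simp add: ann_vm_bdag lin_zero[OF lin_bdag])
  next
    case False
    then have "(u \<in> P) = (u \<in> Q)" using Cons.prems by auto
    then show ?thesis using False fin Cons by (simp add: ann_vm_bdag)
  qed
qed

text \<open>Both sides remove the electrons at \<open>v\<close> and \<open>w\<close> and leave the
  same state; they do so in opposite orders, whence the minus sign.\<close>

lemma ann_phi_swap:
  assumes "distinct l" "set l \<subseteq> V" "v \<in> P" "w \<notin> P" and Q: "Q = insert w (P - {v})"
  shows "ann (vm v True) (ann (vm w False) (phi l P)) = - ann (vm w True) (ann (vm v False) (phi l Q))"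
  using assms(1,2)
proof (induction l)
  case Nil then show ?case by (simp only: phi.simps ann_vac lin_zero[OF lin_ann] minus_zero)
next
  case (Cons u l)
  have vw: "v \<noteq> w" "v \<notin> Q" "w \<in> Q" using assms by auto
  let ?X = "phi l P" and ?Y = "phi l Q"
  have l: "distinct l" "set l \<subseteq> V" "u \<notin> set l" using Cons.prems by auto
  have fin: "fin_state ?X" "fin_state ?Y" using l by (auto intro: phi_fin)
  note fin2 = fin[THEN fin_ann]
  consider "u = v" | "u = w" | "u \<noteq> v" "u \<noteq> w" by blast
  then show ?case
  proof cases
    case 1
    have z: "ann (vm v True) ?X = 0" "ann (vm v False) ?Y = 0"
      using l 1 by (auto intro: ann_phi_zero)
    have z2: "ann (vm v True) (ann (vm w False) ?X) = 0"
      using ann_ann[OF fin(1), of "vm v True" "vm w False"] z(1) by (simp add: lin_zero[OF lin_ann])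
    have f: "ann (vm w False) ?X = ann (vm w True) ?Y"
      using ann_phi_flip[OF l(1,2), of w P Q] l(3) 1 vw assms(3,4) Q by auto
    have "ann (vm w False) (phi (u # l) P) = - bdag v True (ann (vm w False) ?X)"
      using 1 assms(3) vw fin by (simp add: ann_vm_bdag)
    then have "ann (vm v True) (ann (vm w False) (phi (u # l) P)) = - ann (vm w False) ?X"
      using fin2 z2 by (simp only: lin_uminus[OF lin_ann] ann_vm_bdag lin_zero[OF lin_bdag] simp_thms if_True diff_zero)
    moreover have "ann (vm v False) (phi (u # l) Q) = ?Y"
      using 1 vw fin z by (simp add: ann_vm_bdag lin_zero[OF lin_bdag])
    ultimately show ?thesis using f by simp
  next
    case 2
    have z: "ann (vm w False) ?X = 0" "ann (vm w True) ?Y = 0"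
      using l 2 by (auto intro: ann_phi_zero)
    have z2: "ann (vm w True) (ann (vm v False) ?Y) = 0"
      using ann_ann[OF fin(2), of "vm w True" "vm v False"] z(2) by (simp add: lin_zero[OF lin_ann])
    have f: "ann (vm v True) ?X = ann (vm v False) ?Y"
      using ann_phi_flip[OF l(1,2), of v P Q] l(3) 2 vw assms(3,4) Q by auto
    have "ann (vm v False) (phi (u # l) Q) = - bdag w True (ann (vm v False) ?Y)"
      using 2 vw fin by (simp add: ann_vm_bdag)
    then have "ann (vm w True) (ann (vm v False) (phi (u # l) Q)) = - ann (vm v False) ?Y"
      using fin2 z2 by (simp only: lin_uminus[OF lin_ann] ann_vm_bdag lin_zero[OF lin_bdag] simp_thms if_True diff_zero)
    moreover have "ann (vm w False) (phi (u # l) P) = ?X"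
      using 2 assms(4) fin z by (simp add: ann_vm_bdag lin_zero[OF lin_bdag])
    ultimately show ?thesis using f by simp
  next
    case 3
    have uPQ: "(u \<in> Q) = (u \<in> P)" using 3 Q by auto
    have IH: "ann (vm v True) (ann (vm w False) ?X) = - ann (vm w True) (ann (vm v False) ?Y)"
      by (rule Cons.IH[OF l(1,2)])
    have one: "ann (vm x r) (bdag u q \<psi>) = - bdag u q (ann (vm x r) \<psi>)"
      if "x \<noteq> u" "fin_state \<psi>" for x r q \<psi>
      using ann_vm_bdag[OF that(2), of x r u q] that(1) by simp
    have ne: "v \<noteq> u" "w \<noteq> u" using 3 by auto
    have "ann (vm v True) (ann (vm w False) (phi (u # l) P)) = bdag u (u \<in> P) (ann (vm v True) (ann (vm w False) ?X))"
      by (simp only: phi.simps one[OF ne(1)] one[OF ne(2)] fin fin2 lin_uminus[OF lin_ann] minus_minus)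
    moreover have "ann (vm w True) (ann (vm v False) (phi (u # l) Q)) = bdag u (u \<in> P) (ann (vm w True) (ann (vm v False) ?Y))"
      by (simp only: phi.simps uPQ one[OF ne(1)] one[OF ne(2)] fin fin2 lin_uminus[OF lin_ann] minus_minus)
    ultimately show ?thesis by (simp only: IH lin_uminus[OF lin_bdag])
  qed
qed

end

text \<open>\<open>P\<close> is a set of tokens. Along a path to \<open>z\<close> whose last
  intermediate vertex is \<open>y\<close>: if \<open>y\<close> is free, the token goes to
  \<open>y\<close> and then to \<open>z\<close>; if \<open>y\<close> is occupied, its token moves to
  \<open>z\<close> and the token from \<open>v\<close> takes its place.\<close>

lemma token_exchange:
  assumes R: "sym R"
    and step: "\<And>P v w. P \<subseteq> A \<Longrightarrow> v \<in> P \<Longrightarrow> w \<in> A - P \<Longrightarrow> (v, w) \<in> R \<Longrightarrow> g P = g (insert w (P - {v}))"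
    and P: "P \<subseteq> A" "v \<in> P" "w \<in> A - P" "w \<in> ccomp R A v"
  shows "g P = g (insert w (P - {v}))"
proof -
  have "\<forall>P. P \<subseteq> A \<longrightarrow> v \<in> P \<longrightarrow> w \<in> A - P \<longrightarrow> g P = g (insert w (P - {v}))"
    using P(4)
  proof (induction rule: ccomp_induct)
    case base then show ?case by blast
  next
    case (step y z)
    show ?case
    proof (intro allI impI)
      fix P assume P: "P \<subseteq> A" "v \<in> P" "z \<in> A - P"
      have zv: "z \<noteq> v" using P by auto
      show "g P = g (insert z (P - {v}))"
      proof (cases "y \<in> P")
        case yP: True
        have 1: "g P = g (insert z (P - {y}))" by (rule assms(2)[OF P(1) yP P(3) step.hyps(2)])
        show ?thesis
        proof (cases "y = v")
          case True then show ?thesis using 1 by simp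
        next
          case False
          let ?Q = "insert z (P - {y})"
          have "?Q \<subseteq> A" "v \<in> ?Q" "y \<in> A - ?Q" using False P yP step.hyps(3,4) by auto
          then have "g ?Q = g (insert y (?Q - {v}))" using step.IH by blast
          moreover have "insert y (?Q - {v}) = insert z (P - {v})" using False yP zv by auto
          ultimately show ?thesis using 1 by simp
        qed
      next
        case False
        let ?Q = "insert y (P - {v})"
        have "y \<in> A - P" using False step.hyps(3) by auto
        then have 1: "g P = g ?Q" using step.IH P by blast
        show ?thesis
        proof (cases "z = y")
          case True then show ?thesis using 1 by simp
        next
          case zy: False
          then have "?Q \<subseteq> A" "y \<in> ?Q" "z \<in> A - ?Q" using P step.hyps(3,4) zv by auto
          then have "g ?Q = g (insert z (?Q - {y}))" using step.hyps(2) by (rule assms(2))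
          moreover have "insert z (?Q - {y}) = insert z (P - {v})" using False by auto
          ultimately show ?thesis using 1 by simp
        qed
      qed
    qed
  qed
  then show ?thesis using P by blast
qed

text \<open>A token in \<open>P - Q\<close> has, in its component, a free target in
  \<open>Q - P\<close> because the counts agree there. Moving it keeps all counts and shrinks
  \<open>P - Q\<close>.\<close>

lemma token_invariant:
  assumes R: "sym R" and A: "finite A"
    and step: "\<And>P v w. P \<subseteq> A \<Longrightarrow> v \<in> P \<Longrightarrow> w \<in> A - P \<Longrightarrow> (v, w) \<in> R \<Longrightarrow> g P = g (insert w (P - {v}))"
    and "P \<subseteq> A" "Q \<subseteq> A" "\<And>C. C \<in> ccomps R A \<Longrightarrow> card (P \<inter> C) = card (Q \<inter> C)"
  shows "g P = g Q"
  using assms(4-6)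
proof (induction "card (P - Q)" arbitrary: P rule: less_induct)
  case less
  have fin: "finite P" "finite Q" using less.prems A finite_subset by blast+
  show ?case
  proof (cases "P \<subseteq> Q")
    case True
    have "Q \<subseteq> P"
    proof
      fix x assume x: "x \<in> Q"
      then obtain C where C: "C \<in> ccomps R A" "x \<in> C" using less.prems(2) ccomps_Union[of R A] by blast
      have "P \<inter> C = Q \<inter> C"
        using True less.prems(3)[OF C(1)] fin by (intro card_subset_eq) auto
      then show "x \<in> P" using x C(2) by auto
    qed
    then show ?thesis using True by simp
  next
    case False
    then obtain v where v: "v \<in> P" "v \<notin> Q" by auto
    then obtain C where C: "C \<in> ccomps R A" "v \<in> C" using less.prems(1) ccomps_Union[of R A] by blast
    have "\<exists>w\<in>Q \<inter> C. w \<notin> P"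
    proof (rule ccontr)
      assume "\<not> ?thesis"
      then have "Q \<inter> C \<subset> P \<inter> C" using v C(2) by auto
      then have "card (Q \<inter> C) < card (P \<inter> C)" using fin by (intro psubset_card_mono) auto
      then show False using less.prems(3)[OF C(1)] by simp
    qed
    then obtain w where w: "w \<in> Q" "w \<in> C" "w \<notin> P" by auto
    define P' where "P' = insert w (P - {v})"
    have wc: "w \<in> ccomp R A v" using ccompsD(1)[OF R C] w(2) by simp
    have wA: "w \<in> A - P" using w less.prems(2) by auto
    have "g P = g P'" unfolding P'_def
      by (rule token_exchange[OF R step less.prems(1) v(1) wA wc])
    also have "g P' = g Q"
    proof (rule less.hyps)
      have "P' - Q = (P - Q) - {v}" using w by (auto simp: P'_def)
      moreover have "card ((P - Q) - {v}) < card (P - Q)" using v fin by (intro card_Diff1_less) auto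
      ultimately show "card (P' - Q) < card (P - Q)" by simp
      show "P' \<subseteq> A" using less.prems(1) wA by (auto simp: P'_def)
      fix D assume D: "D \<in> ccomps R A"
      have "card (P' \<inter> D) = card (P \<inter> D)"
      proof (cases "D = C")
        case True
        have "P' \<inter> C = insert w ((P \<inter> C) - {v})" using w by (auto simp: P'_def)
        moreover have "card (insert w ((P \<inter> C) - {v})) = Suc (card ((P \<inter> C) - {v}))" using w fin by simp
        moreover have "Suc (card ((P \<inter> C) - {v})) = card (P \<inter> C)" using v C(2) fin by (intro card_Suc_Diff1) auto
        ultimately show ?thesis using True by simp
      next
        case False
        then have "D \<inter> C = {}" using ccomps_disj[OF R D C(1)] by simp
        then have "P' \<inter> D = P \<inter> D" using w C(2) by (auto simp: P'_def)
        then show ?thesis by simp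
      qed
      then show "card (P' \<inter> D) = card (Q \<inter> D)" using less.prems(3)[OF D] by simp
    qed (use less.prems in simp)
    finally show ?thesis .
  qed
qed

context decorated_graph
begin

lemma no_double_ann:
  assumes "\<And>S. vm v True \<in> S \<Longrightarrow> vm v False \<in> S \<Longrightarrow> \<psi> S = 0"
  shows "ann (vm v True) (ann (vm v False) \<psi>) = 0"
  using assms by (subst ann_ann_eq_0_iff) (auto simp: vm_inj)

text \<open>On \<open>\<psi>\<close> the midpoint annihilator equals - 1 / lam times the sum of
  those at the ends. In the product the terms with both spins at one end drop out, and what remains
  annihilates a singlet on the bond.\<close>

lemma midpoint_exchange:
  assumes \<psi>: "fin_state \<psi>" and a0: "\<And>s. aop e s \<psi> = 0"
    and v: "ann (vm (src e) True) (ann (vm (src e) False) \<psi>) = 0"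
    and w: "ann (vm (tgt e) True) (ann (vm (tgt e) False) \<psi>) = 0"
  shows "ann (mm e True) (ann (mm e False) \<psi>) = sc (complex_of_real (1 / lam ^ 2))
    (ann (vm (src e) True) (ann (vm (tgt e) False) \<psi>) + ann (vm (tgt e) True) (ann (vm (src e) False) \<psi>))"
proof -
  let ?v = "vm (src e)" and ?w = "vm (tgt e)" and ?c = "complex_of_real (- 1 / lam)"
  have m: "ann (mm e s) \<psi> = sc ?c (ann (?v s) \<psi> + ann (?w s) \<psi>)" for s
  proof
    fix S
    have "aop e s \<psi> S = 0" by (simp add: a0)
    then have "ann (?v s) \<psi> S + ann (?w s) \<psi> S + complex_of_real lam * ann (mm e s) \<psi> S = 0"
      by (simp add: aop_apply)
    then have "complex_of_real lam * ann (mm e s) \<psi> S = - (ann (?v s) \<psi> S + ann (?w s) \<psi> S)"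
      using add_eq_0_iff by blast
    moreover have "complex_of_real lam \<noteq> 0" using pos by simp
    ultimately have "ann (mm e s) \<psi> S = - (ann (?v s) \<psi> S + ann (?w s) \<psi> S) / complex_of_real lam"
      by (simp add: field_simps)
    then show "ann (mm e s) \<psi> S = sc ?c (ann (?v s) \<psi> + ann (?w s) \<psi>) S"
      by (simp add: diff_divide_distrib add_divide_distrib)
  qed
  have anti: "ann x (ann y \<psi>) = - ann y (ann x \<psi>)" for x y by (rule ann_ann[OF \<psi>])
  \<comment> \<open>The substitution is valid only for an operator acting directly on
    \<open>\<psi>\<close>, so the second midpoint annihilator is first moved inside by
    anticommutation.\<close>
  have step: "ann (mm e True) (ann (x::'m) \<psi>) = sc (- ?c) (ann x (ann (?v True) \<psi>) + ann x (ann (?w True) \<psi>))" for x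
  proof -
    have "ann (mm e True) (ann x \<psi>) = - ann x (ann (mm e True) \<psi>)" by (rule anti)
    then show ?thesis unfolding m[of True] lin_sc[OF lin_ann] lin_add[OF lin_ann]
      by (auto simp: fun_eq_iff)
  qed
  have v': "ann (?v False) (ann (?v True) \<psi>) = 0"
    by (simp only: anti[of "?v False" "?v True"] v minus_zero)
  have w': "ann (?w False) (ann (?w True) \<psi>) = 0"
    by (simp only: anti[of "?w False" "?w True"] w minus_zero)
  have "ann (mm e True) (ann (mm e False) \<psi>) = sc ?c (sc (- ?c) (ann (?v False) (ann (?w True) \<psi>))
      + sc (- ?c) (ann (?w False) (ann (?v True) \<psi>)))"
    by (simp only: m[of False] lin_sc[OF lin_ann] lin_add[OF lin_ann] step v' w' add_0 add_0_right)
  also have "\<dots> = sc (?c * ?c) (ann (?w True) (ann (?v False) \<psi>) + ann (?v True) (ann (?w False) \<psi>))"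
    unfolding anti[of "?v False" "?w True"] anti[of "?w False" "?v True"] by (auto simp: fun_eq_iff algebra_simps)
  also have "?c * ?c = complex_of_real (1 / lam ^ 2)" by (simp add: power2_eq_square)
  finally show ?thesis by (simp only: add.commute)
qed

section \<open>A basis of the zero-energy space\<close>

definition enum :: "'v set \<Rightarrow> 'v list" where
  "enum A = (SOME l. distinct l \<and> set l = A)"

lemma enum: "A \<subseteq> V \<Longrightarrow> distinct (enum A) \<and> set (enum A) = A"
  unfolding enum_def using finite_distinct_list[OF finite_subset[OF _ finV]] by (metis (mono_tags, lifting) someI_ex)

definition Phi :: "'v set \<Rightarrow> 'v set \<Rightarrow> 'm fstate" where
  "Phi A P = phi (enum A) P"

text \<open>An index is a set of occupied vertices with the number of up spins in each component.\<close>

definition idx :: "('v set \<times> ('v set \<Rightarrow> nat)) set" where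
  "idx = (SIGMA A:Pow V. PiE (ccomps adj A) (\<lambda>C. {0..card C}))"

definition cls :: "'v set \<times> ('v set \<Rightarrow> nat) \<Rightarrow> 'v set set" where
  "cls i = {P. P \<subseteq> fst i \<and> (\<forall>C\<in>ccomps adj (fst i). card (P \<inter> C) = snd i C)}"

text \<open>Equal coefficients make the state symmetric in the spins of each component: it is a
  product of Dicke states, each in the multiplet of maximal spin.\<close>

definition Psi :: "'v set \<times> ('v set \<Rightarrow> nat) \<Rightarrow> 'm fstate" where
  "Psi i = (\<Sum>P\<in>cls i. Phi (fst i) P)"

definition rep :: "'v set \<times> ('v set \<Rightarrow> nat) \<Rightarrow> 'v set" where
  "rep i = (SOME P. P \<in> cls i)"

text \<open>By \<open>Phi_at_conf\<close> only one product state has nonzero amplitude at this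
  configuration, so dividing by its amplitude recovers the coefficient.\<close>

definition coord :: "'v set \<times> ('v set \<Rightarrow> nat) \<Rightarrow> 'm fstate \<Rightarrow> complex" where
  "coord i \<psi> = \<psi> (conf (fst i) (rep i)) / Phi (fst i) (rep i) (conf (fst i) (rep i))"

lemma finite_idx: "finite idx"
  unfolding idx_def using finV finite_subset[OF _ finV] by (intro finite_SigmaI finite_PiE) auto

lemma idx_sub: "i \<in> idx \<Longrightarrow> fst i \<subseteq> V"
  by (auto simp: idx_def)

lemma finite_cls: "i \<in> idx \<Longrightarrow> finite (cls i)"
  using finite_subset[OF idx_sub finV] by (auto simp: cls_def intro: finite_subset[of _ "Pow (fst i)"])

lemma cls_nonempty:
  assumes "i \<in> idx" shows "cls i \<noteq> {}"
proof -
  let ?A = "fst i"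
  have finA: "finite ?A" using idx_sub[OF assms] finV by (rule finite_subset)
  have "\<exists>T. T \<subseteq> C \<and> card T = snd i C" if "C \<in> ccomps adj ?A" for C
  proof -
    have "snd i C \<le> card C" using assms that by (auto simp: idx_def dest: PiE_mem)
    then obtain T where "T \<subseteq> C" "card T = snd i C" by (rule obtain_subset_with_card_n)
    then show ?thesis by blast
  qed
  then obtain T where T: "\<And>C. C \<in> ccomps adj ?A \<Longrightarrow> T C \<subseteq> C \<and> card (T C) = snd i C" by metis
  define P where "P = (\<Union>C\<in>ccomps adj ?A. T C)"
  have "P \<inter> C = T C" if C: "C \<in> ccomps adj ?A" for C
  proof
    show "T C \<subseteq> P \<inter> C" using T[OF C] C by (auto simp: P_def)
    show "P \<inter> C \<subseteq> T C"
    proof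
      fix x assume x: "x \<in> P \<inter> C"
      then obtain D where D: "D \<in> ccomps adj ?A" "x \<in> T D" by (auto simp: P_def)
      then have "D = C" using ccomps_disj[OF sym_adj D(1) C] T[OF D(1)] x by blast
      then show "x \<in> T C" using D by simp
    qed
  qed
  moreover have "P \<subseteq> ?A" using T ccomps_sub by (fastforce simp: P_def)
  ultimately have "P \<in> cls i" using T by (simp add: cls_def)
  then show ?thesis by auto
qed

lemma rep_cls: "i \<in> idx \<Longrightarrow> rep i \<in> cls i"
  unfolding rep_def using cls_nonempty by (metis ex_in_conv someI_ex)

lemma cls_determines:
  assumes "i \<in> idx" "k \<in> idx" "fst i = fst k" "P \<in> cls i" "P \<in> cls k" shows "i = k"
proof -
  have "snd i = snd k"
  proof (rule PiE_ext)
    show "snd i \<in> PiE (ccomps adj (fst i)) (\<lambda>C. {0..card C})"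
      and "snd k \<in> PiE (ccomps adj (fst i)) (\<lambda>C. {0..card C})"
      using assms(1-3) by (auto simp: idx_def)
    show "snd i C = snd k C" if "C \<in> ccomps adj (fst i)" for C
      using that assms(3-5) by (auto simp: cls_def)
  qed
  then show ?thesis using assms(3) by (simp add: prod_eq_iff)
qed

lemma Phi_at_conf:
  assumes "A \<subseteq> V" "P \<subseteq> A" "B \<subseteq> V" "Q \<subseteq> B"
  shows "Phi B Q (conf A P) \<noteq> 0 \<longleftrightarrow> A = B \<and> P = Q"
proof -
  have "Phi B Q (conf A P) \<noteq> 0 \<longleftrightarrow> conf A P = conf B Q"
    unfolding Phi_def using phi_at_vertices[of "enum B" "conf A P" Q] enum[OF assms(3)] assms conf_vmodes by auto
  then show ?thesis using conf_inj[OF _ assms(2,4)] by blast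
qed

lemma Psi_at_conf:
  assumes i: "i \<in> idx" and A: "A \<subseteq> V" "P \<subseteq> A"
  shows "Psi i (conf A P) = (if A = fst i \<and> P \<in> cls i then Phi A P (conf A P) else 0)"
proof -
  have "Phi (fst i) Q (conf A P) = (if Q = P then (if A = fst i then Phi A P (conf A P) else 0) else 0)"
    if "Q \<in> cls i" for Q
    using Phi_at_conf[OF A idx_sub[OF i], of Q] that by (auto simp: cls_def)
  then have "Psi i (conf A P) = (\<Sum>Q\<in>cls i. if Q = P then (if A = fst i then Phi A P (conf A P) else 0) else 0)"
    unfolding Psi_def sum_fun_app by (intro sum.cong refl)
  then show ?thesis using finite_cls[OF i] by (simp add: sum.delta)
qed

lemma Psi_fock: "i \<in> idx \<Longrightarrow> Psi i \<in> fock Ms"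
  unfolding Psi_def Phi_def using enum[OF idx_sub] idx_sub by (intro fock_sum phi_fock) auto

lemma aop_Psi:
  assumes "i \<in> idx" "e \<in> E" shows "aop e s (Psi i) = 0"
  unfolding Psi_def Phi_def lin_sum[OF lin_aop] using enum[OF idx_sub[OF assms(1)]] idx_sub[OF assms(1)] assms(2)
  by (intro sum.neutral ballI aop_phi) auto

lemma cls_swap:
  assumes i: "i \<in> idx" and vw: "(v, w) \<in> adj" "v \<in> fst i" "w \<in> fst i" and P: "P \<in> cls i" "v \<in> P" "w \<notin> P"
  shows "insert w (P - {v}) \<in> cls i"
proof -
  have finP: "finite P" using P(1) finite_subset[OF idx_sub[OF i] finV] by (auto simp: cls_def intro: finite_subset)
  have "card (insert w (P - {v}) \<inter> C) = card (P \<inter> C)" if C: "C \<in> ccomps adj (fst i)" for C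
  proof (cases "v \<in> C")
    case True
    then have wC: "w \<in> C" using ccomps_adj[OF sym_adj C _ vw(1,3)] by simp
    have "insert w (P - {v}) \<inter> C = insert w (P \<inter> C - {v})" using wC by auto
    then have "card (insert w (P - {v}) \<inter> C) = Suc (card (P \<inter> C - {v}))" using P finP by simp
    also have "\<dots> = card (P \<inter> C)" using True P finP by (intro card_Suc_Diff1) auto
    finally show ?thesis .
  next
    case False
    have "(w, v) \<in> adj" using vw(1) sym_adj by (auto simp: sym_def)
    then have "w \<notin> C" using ccomps_adj[OF sym_adj C _ _ vw(2)] False by blast
    then have "insert w (P - {v}) \<inter> C = P \<inter> C" using False by auto
    then show ?thesis by simp
  qed
  then show ?thesis using P vw by (auto simp: cls_def)
qed

text \<open>Exchanging the spins at \<open>v\<close> and \<open>w\<close> permutes the summands of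
  \<open>Psi i\<close>, all of which have coefficient 1, so \<open>ann_phi_swap\<close> applies term
  by term.\<close>

lemma ann_Psi_swap:
  assumes i: "i \<in> idx" and vw: "(v, w) \<in> adj" "v \<noteq> w"
  shows "ann (vm v True) (ann (vm w False) (Psi i)) = - ann (vm w True) (ann (vm v False) (Psi i))"
proof -
  let ?A = "fst i" and ?l = "enum (fst i)"
  have l: "distinct ?l" "set ?l \<subseteq> V" "set ?l = ?A" using enum[OF idx_sub[OF i]] idx_sub[OF i] by auto
  have wv: "(w, v) \<in> adj" using vw(1) sym_adj by (auto simp: sym_def)
  have zero: "ann (vm x True) (ann (vm y False) (phi ?l P)) = 0"
    if "\<not> (x \<in> ?A \<and> y \<in> ?A \<and> x \<in> P \<and> y \<notin> P)" for x y P
  proof (cases "y \<in> ?A \<and> y \<notin> P")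
    case True
    then have "ann (vm x True) (phi ?l P) = 0" using that l by (intro ann_phi_zero) auto
    then show ?thesis
      using ann_ann[OF phi_fin[OF l(2)], of "vm x True" "vm y False"] by (simp only: lin_zero[OF lin_ann] minus_zero)
  next
    case False
    then have "ann (vm y False) (phi ?l P) = 0" using l by (intro ann_phi_zero) auto
    then show ?thesis by (simp only: lin_zero[OF lin_ann])
  qed
  let ?F = "{P \<in> cls i. v \<in> ?A \<and> w \<in> ?A \<and> v \<in> P \<and> w \<notin> P}"
  let ?G = "{P \<in> cls i. v \<in> ?A \<and> w \<in> ?A \<and> w \<in> P \<and> v \<notin> P}"
  have "ann (vm v True) (ann (vm w False) (Psi i)) = (\<Sum>P\<in>cls i. ann (vm v True) (ann (vm w False) (phi ?l P)))"
    unfolding Psi_def Phi_def lin_sum[OF lin_ann] by simp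
  also have "\<dots> = (\<Sum>P\<in>?F. ann (vm v True) (ann (vm w False) (phi ?l P)))"
    using finite_cls[OF i] zero[of v w] by (intro sum.mono_neutral_right) auto
  also have "\<dots> = (\<Sum>P\<in>?G. - ann (vm w True) (ann (vm v False) (phi ?l P)))"
  proof (rule sum.reindex_bij_witness[of _ "\<lambda>Q. insert v (Q - {w})" "\<lambda>P. insert w (P - {v})"])
    fix P assume P: "P \<in> ?F"
    show "insert v (insert w (P - {v}) - {w}) = P" using P vw(2) by auto
    show "insert w (P - {v}) \<in> ?G" using P vw cls_swap[OF i vw(1)] by auto
    show "- ann (vm w True) (ann (vm v False) (phi ?l (insert w (P - {v})))) = ann (vm v True) (ann (vm w False) (phi ?l P))"
      using ann_phi_swap[OF l(1,2) _ _ refl, of v P w] P by simp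
  next
    fix Q assume Q: "Q \<in> ?G"
    show "insert w (insert v (Q - {w}) - {v}) = Q" using Q vw(2) by auto
    show "insert v (Q - {w}) \<in> ?F" using Q vw cls_swap[OF i wv] by auto
  qed
  also have "\<dots> = - (\<Sum>P\<in>?G. ann (vm w True) (ann (vm v False) (phi ?l P)))" by (rule sum_negf)
  also have "(\<Sum>P\<in>?G. ann (vm w True) (ann (vm v False) (phi ?l P))) = (\<Sum>P\<in>cls i. ann (vm w True) (ann (vm v False) (phi ?l P)))"
    using finite_cls[OF i] zero[of w v] by (intro sum.mono_neutral_left) auto
  also have "\<dots> = ann (vm w True) (ann (vm v False) (Psi i))"
    unfolding Psi_def Phi_def lin_sum[OF lin_ann] by simp
  finally show ?thesis .
qed

lemma conf_of_vmodes:
  assumes "S \<subseteq> vmodes" "\<not> (\<exists>v\<in>V. vm v True \<in> S \<and> vm v False \<in> S)"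
  shows "\<exists>A P. A \<subseteq> V \<and> P \<subseteq> A \<and> S = conf A P"
proof (intro exI conjI)
  let ?A = "{v \<in> V. vm v True \<in> S \<or> vm v False \<in> S}" and ?P = "{v \<in> V. vm v True \<in> S}"
  show "?A \<subseteq> V" "?P \<subseteq> ?A" by auto
  have "vm v s \<in> S \<longleftrightarrow> vm v s \<in> conf ?A ?P" for v s
  proof (cases "v \<in> V")
    case True
    then show ?thesis using assms(2) by (cases s) (auto simp: conf_mem)
  next
    case False
    then have "vm v s \<notin> S" using assms(1) by (auto simp: vmodes_def vm_inj)
    then show ?thesis using False by (simp add: conf_mem)
  qed
  then show "S = conf ?A ?P" using assms(1) conf_vmodes[OF \<open>?A \<subseteq> V\<close>, of ?P] unfolding vmodes_def by blast
qed

text \<open>The doubly annihilated state still satisfies the bond conditions, as annihilators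
  anticommute with bond operators. By \<open>determined_by_vertices\<close> it is enough to look at
  vertex configurations, where each summand occupies a vertex at most once.\<close>

lemma Psi_no_vertex_double:
  assumes i: "i \<in> idx" and v: "v \<in> V"
  shows "ann (vm v True) (ann (vm v False) (Psi i)) = 0"
proof (rule determined_by_vertices)
  have fin: "fin_state (Psi i)" using fock_fin[OF finMs Psi_fock[OF i]] .
  show "ann (vm v True) (ann (vm v False) (Psi i)) \<in> fock Ms" by (intro fock_ann Psi_fock i)
  show "aop e s (ann (vm v True) (ann (vm v False) (Psi i))) = 0" if "e \<in> E" for e s
    by (simp only: aop_ann[OF fin_ann[OF fin]] aop_ann[OF fin] aop_Psi[OF i that] lin_zero[OF lin_ann] minus_zero)
  fix S assume S: "S \<subseteq> vmodes"
  have "Psi i T = 0" if "T \<subseteq> vmodes" "vm v True \<in> T" "vm v False \<in> T" for T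
  proof -
    have "Phi (fst i) P T = 0" for P
    proof -
      have "T \<noteq> conf (fst i) P" using that conf_mem by auto
      then show ?thesis unfolding Phi_def
        using phi_at_vertices[of "enum (fst i)" T P] enum[OF idx_sub[OF i]] idx_sub[OF i] that(1) by auto
    qed
    then show ?thesis by (simp add: Psi_def sum_fun_app)
  qed
  moreover have "insert (vm v False) (insert (vm v True) S) \<subseteq> vmodes" using S v by (auto simp: vmodes_def)
  ultimately show "ann (vm v True) (ann (vm v False) (Psi i)) S = 0" by (simp add: ann_def)
qed

lemma Psi_zero_energy:
  assumes i: "i \<in> idx" shows "zero_energy (Psi i)"
  unfolding zero_energy_def
proof (intro conjI ballI allI impI)
  have fin: "fin_state (Psi i)" using fock_fin[OF finMs Psi_fock[OF i]] .
  show "Psi i \<in> fock Ms" by (rule Psi_fock[OF i])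
  show "aop e s (Psi i) = 0" if "e \<in> E" for e s by (rule aop_Psi[OF i that])
  show "Psi i S = 0" if "v \<in> V" "vm v True \<in> S" "vm v False \<in> S" for v S
    using Psi_no_vertex_double[OF i that(1)] that(2,3) by (subst (asm) ann_ann_eq_0_iff) (auto simp: vm_inj)
  show "Psi i S = 0" if e: "e \<in> E" and S: "mm e True \<in> S" "mm e False \<in> S" for e S
  proof -
    have adj: "(src e, tgt e) \<in> adj" using e by (auto simp: adj_def)
    have "ann (mm e True) (ann (mm e False) (Psi i)) = sc (complex_of_real (1 / lam ^ 2))
      (- ann (vm (tgt e) True) (ann (vm (src e) False) (Psi i)) + ann (vm (tgt e) True) (ann (vm (src e) False) (Psi i)))"
      unfolding midpoint_exchange[OF fin aop_Psi[OF i e] Psi_no_vertex_double[OF i ends(1)[OF e]] Psi_no_vertex_double[OF i ends(2)[OF e]]]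
      by (simp only: ann_Psi_swap[OF i adj ends(3)[OF e]])
    also have "\<dots> = 0" by simp
    finally have "ann (mm e True) (ann (mm e False) (Psi i)) = 0" .
    then show ?thesis using S by (subst (asm) ann_ann_eq_0_iff) (auto simp: mm_inj)
  qed
qed

lemma conf_insert: "conf (insert v A) P = insert (vm v (v \<in> P)) (conf A P)"
  by (simp add: conf_def)

text \<open>An empty singlet channel on the bond means that exchanging opposite neighbouring spins
  alters the amplitude by a sign at most. Taking norms also discards the Jordan-Wigner signs, and it
  suffices for proving that amplitudes vanish.\<close>

lemma norm_swap:
  assumes z: "zero_energy \<psi>" and A: "A \<subseteq> V"
    and P: "P \<subseteq> A" "v \<in> P" "w \<in> A - P" "(v, w) \<in> adj"
  shows "norm (\<psi> (conf A P)) = norm (\<psi> (conf A (insert w (P - {v}))))"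
proof -
  let ?Q = "insert w (P - {v})"
  have fin: "fin_state \<psi>" using z fock_fin[OF finMs] by (auto simp: zero_energy_def)
  have vw: "v \<noteq> w" using P by auto
  obtain e where e: "e \<in> E" "v = src e \<and> w = tgt e \<or> w = src e \<and> v = tgt e"
    using P(4) by (auto simp: adj_def)
  have d: "ann (vm u True) (ann (vm u False) \<psi>) = 0" if "u \<in> V" for u
    using z that by (intro no_double_ann) (auto simp: zero_energy_def)
  have m: "ann (mm e True) (ann (mm e False) \<psi>) = 0"
    using z e(1) by (subst ann_ann_eq_0_iff) (auto simp: mm_inj zero_energy_def)
  have a0: "aop e s \<psi> = 0" for s using z e(1) by (auto simp: zero_energy_def)
  have "sc (complex_of_real (1 / lam ^ 2))
    (ann (vm (src e) True) (ann (vm (tgt e) False) \<psi>) + ann (vm (tgt e) True) (ann (vm (src e) False) \<psi>)) = 0"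
    using midpoint_exchange[OF fin a0 d[OF ends(1)[OF e(1)]] d[OF ends(2)[OF e(1)]]] m by simp
  then have "ann (vm (src e) True) (ann (vm (tgt e) False) \<psi>) S + ann (vm (tgt e) True) (ann (vm (src e) False) \<psi>) S = 0" for S
    using pos by (simp add: fun_eq_iff)
  then have sum0: "ann (vm v True) (ann (vm w False) \<psi>) S + ann (vm w True) (ann (vm v False) \<psi>) S = 0" for S
    using e(2) by (auto simp: add.commute)
  define B where "B = A - {v, w}"
  define T where "T = conf B P"
  have AB: "A = insert v (insert w B)" using P by (auto simp: B_def)
  have TQ: "T = conf B ?Q" unfolding T_def conf_def B_def by (intro image_cong) auto
  have nT: "vm v s \<notin> T" "vm w s \<notin> T" for s by (auto simp: T_def conf_mem B_def)
  have cP: "conf A P = insert (vm w False) (insert (vm v True) T)"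
    unfolding AB conf_insert T_def using P by (simp add: insert_commute)
  have cQ: "conf A ?Q = insert (vm v False) (insert (vm w True) T)"
    unfolding AB conf_insert TQ using vw by simp
  have "norm (\<psi> (conf A P)) = norm (ann (vm v True) (ann (vm w False) \<psi>) T)"
    unfolding cP ann_def using nT vw by (simp add: vm_inj norm_mult)
  also have "\<dots> = norm (ann (vm w True) (ann (vm v False) \<psi>) T)"
    using sum0[of T] by (metis add_eq_0_iff norm_minus_cancel)
  also have "\<dots> = norm (\<psi> (conf A ?Q))"
    unfolding cQ ann_def using nT vw by (simp add: vm_inj norm_mult)
  finally show ?thesis .
qed

text \<open>Vanishing coordinates kill one vertex configuration per class;
  \<open>token_invariant\<close>, applied to the norm of the amplitude, spreads this over the class,
  and \<open>determined_by_vertices\<close> extends it to the midpoints.\<close>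

lemma zero_energy_zero:
  assumes z: "zero_energy \<psi>" and c: "\<And>i. i \<in> idx \<Longrightarrow> coord i \<psi> = 0"
  shows "\<psi> = 0"
proof (rule determined_by_vertices)
  show "\<psi> \<in> fock Ms" using z by (simp add: zero_energy_def)
  show "aop e s \<psi> = 0" if "e \<in> E" for e s using z that by (simp add: zero_energy_def)
  fix S assume S: "S \<subseteq> vmodes"
  show "\<psi> S = 0"
  proof (cases "\<exists>v\<in>V. vm v True \<in> S \<and> vm v False \<in> S")
    case True
    then show ?thesis using z by (auto simp: zero_energy_def)
  next
    case False
    then obtain A P where A: "A \<subseteq> V" "P \<subseteq> A" "S = conf A P" using conf_of_vmodes[OF S] by auto
    define i where "i = (A, restrict (\<lambda>C. card (P \<inter> C)) (ccomps adj A))"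
    have finA: "finite A" using A(1) finV by (rule finite_subset)
    have i: "i \<in> idx"
      using A(1) ccomps_finite_mem[OF finA] by (auto simp: idx_def i_def intro!: card_mono)
    have r: "rep i \<subseteq> A" "\<And>C. C \<in> ccomps adj A \<Longrightarrow> card (rep i \<inter> C) = card (P \<inter> C)"
      using rep_cls[OF i] by (auto simp: cls_def i_def)
    have "norm (\<psi> (conf A P)) = norm (\<psi> (conf A (rep i)))"
    proof (rule token_invariant[OF sym_adj finA])
      fix Q v w assume "Q \<subseteq> A" "v \<in> Q" "w \<in> A - Q" "(v, w) \<in> adj"
      then show "norm (\<psi> (conf A Q)) = norm (\<psi> (conf A (insert w (Q - {v}))))"
        by (rule norm_swap[OF z A(1)])
    qed (use A r in auto)
    moreover have "\<psi> (conf A (rep i)) = 0"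
      using c[OF i] Phi_at_conf[OF A(1) r(1) A(1) r(1)] by (simp add: coord_def i_def)
    ultimately show ?thesis using A(3) by simp
  qed
qed

lemma coord_add: "coord i (\<phi> + \<psi>) = coord i \<phi> + coord i \<psi>"
  and coord_sc: "coord i (sc c \<psi>) = c * coord i \<psi>"
  by (simp_all add: coord_def add_divide_distrib)

lemma coord_Psi:
  assumes i: "i \<in> idx" and k: "k \<in> idx"
  shows "coord i (Psi k) = (if i = k then 1 else 0)"
proof -
  have r: "rep i \<subseteq> fst i" "rep i \<in> cls i" using rep_cls[OF i] by (auto simp: cls_def)
  have "Phi (fst i) (rep i) (conf (fst i) (rep i)) \<noteq> 0"
    using Phi_at_conf[OF idx_sub[OF i] r(1) idx_sub[OF i] r(1)] by simp
  moreover have "fst i = fst k \<and> rep i \<in> cls k \<longleftrightarrow> i = k" using cls_determines[OF i k _ r(2)] r(2) by auto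
  ultimately show ?thesis unfolding coord_def Psi_at_conf[OF k idx_sub[OF i] r(1)] by auto
qed

lemma zero_energy_add: "zero_energy \<phi> \<Longrightarrow> zero_energy \<psi> \<Longrightarrow> zero_energy (\<phi> + \<psi>)"
  and zero_energy_sc: "zero_energy \<psi> \<Longrightarrow> zero_energy (sc c \<psi>)"
  unfolding zero_energy_def by (auto simp: lin_add[OF lin_aop] lin_sc[OF lin_aop] intro: fock_add fock_sc)

lemma coord_sum: "coord i (\<Sum>k\<in>J. f k) = (\<Sum>k\<in>J. coord i (f k))"
  by (simp add: coord_def sum_fun_app sum_divide_distrib)

lemma zero_energy_sum: "(\<And>k. k \<in> J \<Longrightarrow> zero_energy (f k)) \<Longrightarrow> zero_energy (\<Sum>k\<in>J. f k)"
proof (induction J rule: infinite_finite_induct)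
  case (insert x F)
  have "zero_energy (f x + sum f F)" by (intro zero_energy_add insert.IH insert.prems) auto
  then show ?case by (simp only: sum.insert[OF insert.hyps])
qed (simp_all add: zero_energy_def fock_zero lin_zero[OF lin_aop])

lemma zero_energy_expand:
  assumes z: "zero_energy \<psi>" shows "\<psi> = (\<Sum>i\<in>idx. sc (coord i \<psi>) (Psi i))"
proof -
  let ?\<phi> = "\<Sum>k\<in>idx. sc (coord k \<psi>) (Psi k)"
  have "\<psi> + sc (- 1) ?\<phi> = 0"
  proof (rule zero_energy_zero)
    show "zero_energy (\<psi> + sc (- 1) ?\<phi>)"
      by (intro zero_energy_add z zero_energy_sc zero_energy_sum Psi_zero_energy)
    fix i assume i: "i \<in> idx"
    have "coord i ?\<phi> = (\<Sum>k\<in>idx. coord k \<psi> * (if i = k then 1 else 0))"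
      unfolding coord_sum coord_sc using coord_Psi[OF i] by (intro sum.cong) auto
    also have "\<dots> = coord i \<psi>" using i finite_idx by (simp add: if_distrib cong: if_cong)
    finally show "coord i (\<psi> + sc (- 1) ?\<phi>) = 0" by (simp only: coord_add coord_sc) simp
  qed
  then show ?thesis by (simp only: sc_simps add_uminus_conv_diff right_minus_eq)
qed

sublocale kernel_basis Ms hamiltonian idx Psi coord
proof
  show "finite Ms" by (rule finMs)
  show "finite idx" by (rule finite_idx)
  show "lin hamiltonian" by (rule lin_hamiltonian)
  show "Psi i \<in> fock Ms" if "i \<in> idx" for i by (rule Psi_fock[OF that])
  show "hamiltonian (Psi i) = 0" if "i \<in> idx" for i
    using hamiltonian_zero_iff[OF Psi_fock[OF that]] Psi_zero_energy[OF that] by simp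
  show "coord i (\<phi> + \<psi>) = coord i \<phi> + coord i \<psi>" for i \<phi> \<psi> by (rule coord_add)
  show "coord i (sc c \<psi>) = c * coord i \<psi>" for i c \<psi> by (rule coord_sc)
  show "\<psi> = (\<Sum>i\<in>idx. sc (coord i \<psi>) (Psi i))" if "\<psi> \<in> fock Ms" "hamiltonian \<psi> = 0" for \<psi>
    using hamiltonian_zero_iff[OF that(1)] that(2) zero_energy_expand by blast
qed

lemma ker_iff: "\<psi> \<in> ker \<longleftrightarrow> zero_energy \<psi>"
  using hamiltonian_zero_iff by (auto simp: ker_def zero_energy_def)

end

section \<open>Traces over the zero-energy space\<close>

locale decorated_lists = decorated_graph V E src tgt vm mm t lam U U'
  for V :: "'v set" and E :: "'e set" and src tgt :: "'e \<Rightarrow> 'v"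
    and vm :: "'v \<Rightarrow> bool \<Rightarrow> nat list" and mm :: "'e \<Rightarrow> bool \<Rightarrow> nat list"
    and t lam U U' :: real
begin

definition sites_set :: "(bool \<Rightarrow> nat list) set" where
  "sites_set = vm ` V \<union> mm ` E"

sublocale spin_sites sites_set
proof
  show "finite sites_set" using finV finE by (simp add: sites_set_def)
  have v: "vm v = vm w \<longleftrightarrow> v = w" for v w using vm_inj[of v True w True] by auto
  have m: "mm v = mm w \<longleftrightarrow> v = w" for v w using mm_inj[of v True w True] by auto
  have n: "vm v \<noteq> mm e" "mm e \<noteq> vm v" for v e using vm_mm[of v True e True] by auto
  show "x s = y r \<longleftrightarrow> x = y \<and> s = r" if "x \<in> sites_set" "y \<in> sites_set" for x y s r
    using that unfolding sites_set_def by (auto simp: vm_inj mm_inj vm_mm mm_vm v m n)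
qed

lemma Ms_sites: "Ms = {x s | x s. x \<in> sites_set}"
  by (auto simp: Ms_def sites_set_def)

lemma site_in_Ms: "x \<in> sites_set \<Longrightarrow> x s \<in> Ms"
  by (auto simp: Ms_sites)

lemma zero_energy_alt:
  "zero_energy \<psi> \<longleftrightarrow> \<psi> \<in> fock Ms \<and> (\<forall>e\<in>E. \<forall>s. aop e s \<psi> = 0)
    \<and> (\<forall>x\<in>sites_set. ann (x True) (ann (x False) \<psi>) = 0)"
proof -
  have "ann (x True) (ann (x False) \<psi>) = 0 \<longleftrightarrow> (\<forall>S. x True \<in> S \<longrightarrow> x False \<in> S \<longrightarrow> \<psi> S = 0)"
    if "x \<in> sites_set" for x
    using injX[OF that that] by (intro ann_ann_eq_0_iff) auto
  then show ?thesis unfolding zero_energy_def by (auto simp: sites_set_def)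
qed

lemma ann_hop:
  assumes "fin_state \<psi>" "x \<in> sites_set"
  shows "ann (x q) (hop s r \<psi>) = hop s r (ann (x q) \<psi>) + (if q = s then ann (x r) \<psi> else 0)"
proof -
  have "ann (x q) (cre (y s) (ann (y r) \<psi>)) = cre (y s) (ann (y r) (ann (x q) \<psi>))
      + (if x = y then (if q = s then ann (x r) \<psi> else 0) else 0)" if "y \<in> sites_set" for y
  proof -
    have "ann (x q) (cre (y s) (ann (y r) \<psi>))
        = (if x q = y s then ann (y r) \<psi> else 0) - cre (y s) (ann (x q) (ann (y r) \<psi>))"
      by (rule ann_cre[OF fin_ann[OF assms(1)]])
    also have "ann (x q) (ann (y r) \<psi>) = - ann (y r) (ann (x q) \<psi>)" by (rule ann_ann[OF assms(1)])
    also have "cre (y s) (- ann (y r) (ann (x q) \<psi>)) = - cre (y s) (ann (y r) (ann (x q) \<psi>))"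
      by (rule lin_uminus[OF lin_cre])
    also have "(if x q = y s then ann (y r) \<psi> else 0) = (if x = y then (if q = s then ann (x r) \<psi> else 0) else 0)"
      using injX[OF assms(2) that] by simp
    finally show ?thesis by (simp only: diff_minus_eq_add add.commute)
  qed
  then have "ann (x q) (hop s r \<psi>) = (\<Sum>y\<in>sites_set. cre (y s) (ann (y r) (ann (x q) \<psi>))
      + (if x = y then (if q = s then ann (x r) \<psi> else 0) else 0))"
    unfolding hop_apply lin_sum[OF lin_ann] by (intro sum.cong refl)
  also have "\<dots> = hop s r (ann (x q) \<psi>) + (if q = s then ann (x r) \<psi> else 0)"
    unfolding sum.distrib hop_apply using finX assms(2) by (simp add: sum.delta)
  finally show ?thesis .
qed

text \<open>The zero-energy conditions are invariant under spin rotation: commuting with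
  \<open>hop\<close> turns a bond operator into the one of the other spin, and a double annihilator
  into itself or into the square of an annihilator, which is 0.\<close>

lemma hop_zero_energy:
  assumes z: "zero_energy \<psi>" shows "zero_energy (hop s r \<psi>)"
  unfolding zero_energy_alt
proof (intro conjI ballI allI)
  have fk: "\<psi> \<in> fock Ms" using z by (simp add: zero_energy_def)
  then have fin: "fin_state \<psi>" by (rule fock_fin[OF finMs])
  show "hop s r \<psi> \<in> fock Ms"
    unfolding hop_apply by (intro fock_sum fock_cre fock_ann fk site_in_Ms)
  show "aop e q (hop s r \<psi>) = 0" if e: "e \<in> E" for e q
  proof -
    have X: "vm (src e) \<in> sites_set" "vm (tgt e) \<in> sites_set" "mm e \<in> sites_set"
      using e ends by (auto simp: sites_set_def)
    have "aop e q (hop s r \<psi>) = hop s r (aop e q \<psi>) + (if q = s then aop e r \<psi> else 0)"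
      unfolding aop_apply ann_hop[OF fin X(1)] ann_hop[OF fin X(2)] ann_hop[OF fin X(3)]
        lin_add[OF lin_hop] lin_sc[OF lin_hop]
      by (cases "q = s") (simp_all add: sc_add algebra_simps)
    also have "\<dots> = 0" using z e by (simp add: zero_energy_def lin_zero[OF lin_hop])
    finally show ?thesis .
  qed
  show "ann (x True) (ann (x False) (hop s r \<psi>)) = 0" if x: "x \<in> sites_set" for x
  proof -
    have d: "ann (x True) (ann (x False) \<psi>) = 0" using z x by (simp add: zero_energy_alt)
    have sq: "ann y (ann y \<psi>) = 0" for y by (auto simp: ann_def fun_eq_iff)
    have "ann (x True) (ann (x False) (hop s r \<psi>)) = hop s r (ann (x True) (ann (x False) \<psi>))
        + (if True = s then ann (x r) (ann (x False) \<psi>) else 0)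
        + (if False = s then ann (x True) (ann (x r) \<psi>) else 0)"
      unfolding ann_hop[OF fin x] lin_add[OF lin_ann] ann_hop[OF fin_ann[OF fin] x]
      by (cases s) (simp_all add: lin_zero[OF lin_ann])
    then show ?thesis using d sq by (cases s; cases r) (simp_all add: lin_zero[OF lin_hop])
  qed
qed

section \<open>Particle number and magnetization of the basis states\<close>

definition cnt :: "bool \<Rightarrow> nat list set \<Rightarrow> nat" where
  "cnt s S = card {x \<in> sites_set. x s \<in> S}"

lemma cnt_remove:
  assumes "x \<in> sites_set" "x s \<in> S"
  shows "cnt s S = Suc (cnt s (S - {x s}))" and "r \<noteq> s \<Longrightarrow> cnt r S = cnt r (S - {x s})"
proof -
  have "{y \<in> sites_set. y s \<in> S} = insert x {y \<in> sites_set. y s \<in> S - {x s}}"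
    using assms injX by auto
  then show "cnt s S = Suc (cnt s (S - {x s}))" using finX by (simp add: cnt_def)
  show "cnt r S = cnt r (S - {x s})" if "r \<noteq> s"
    unfolding cnt_def using assms(1) injX that by (intro arg_cong[where f = card]) auto
qed

lemma bdag_support:
  assumes "v \<in> V" "bdag v s \<psi> S \<noteq> 0"
  shows "\<exists>x\<in>sites_set. x s \<in> S \<and> \<psi> (S - {x s}) \<noteq> 0"
proof (rule ccontr)
  assume neg: "\<not> ?thesis"
  have "cre (x s) \<psi> S = 0" if "x \<in> sites_set" for x using neg that by (auto simp: cre_def)
  then have "bdag v s \<psi> S = 0"
    using assms(1) by (simp add: bdag_apply sum_fun_app sites_set_def)
  then show False using assms(2) by simp
qed

lemma phi_support:
  assumes "distinct l" "set l \<subseteq> V" "phi l P S \<noteq> 0"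
  shows "finite S \<and> card S = length l \<and> cnt True S = card (set l \<inter> P) \<and> cnt False S = card (set l - P)"
  using assms
proof (induction l arbitrary: S)
  case Nil
  then have "S = {}" by (auto simp: basisv_def split: if_splits)
  then show ?case by (simp add: cnt_def)
next
  case (Cons v l)
  let ?s = "v \<in> P"
  obtain x where x: "x \<in> sites_set" "x ?s \<in> S" "phi l P (S - {x ?s}) \<noteq> 0"
    using bdag_support[of v ?s "phi l P" S] Cons.prems by auto
  let ?T = "S - {x ?s}"
  have IH: "finite ?T" "card ?T = length l" "cnt True ?T = card (set l \<inter> P)" "cnt False ?T = card (set l - P)"
    using Cons.IH[OF _ _ x(3)] Cons.prems by auto
  have other: "cnt (\<not> ?s) S = cnt (\<not> ?s) ?T" using cnt_remove(2)[OF x(1,2), of "\<not> ?s"] by simp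
  have "finite S" using IH(1) by simp
  moreover have "card S = Suc (length l)" using IH(2) x(2) \<open>finite S\<close> by (metis card.remove)
  moreover have "cnt True S = card (set (v # l) \<inter> P) \<and> cnt False S = card (set (v # l) - P)"
  proof (cases "v \<in> P")
    case True
    then have "set (v # l) \<inter> P = insert v (set l \<inter> P)" "set (v # l) - P = set l - P" by auto
    then show ?thesis using cnt_remove(1)[OF x(1,2)] other IH(3,4) True Cons.prems(1) by simp
  next
    case False
    then have "set (v # l) \<inter> P = set l \<inter> P" "set (v # l) - P = insert v (set l - P)" by auto
    then show ?thesis using cnt_remove(1)[OF x(1,2)] other IH(3,4) False Cons.prems(1) by simp
  qed
  ultimately show ?case by simp
qed

definition nup :: "'v set \<times> ('v set \<Rightarrow> nat) \<Rightarrow> nat" where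
  "nup i = (\<Sum>C\<in>ccomps adj (fst i). snd i C)"

text \<open>The eigenvalue of the third spin component on \<open>Psi i\<close>, half the excess of
  up over down spins.\<close>

definition magn :: "'v set \<times> ('v set \<Rightarrow> nat) \<Rightarrow> real" where
  "magn i = real (nup i) - real (card (fst i)) / 2"

lemma cls_card:
  assumes i: "i \<in> idx" and P: "P \<in> cls i" shows "card P = nup i"
proof -
  have finA: "finite (fst i)" using idx_sub[OF i] finV by (rule finite_subset)
  have PA: "P \<subseteq> fst i" using P by (simp add: cls_def)
  have "P = (\<Union>C\<in>ccomps adj (fst i). P \<inter> C)" using PA ccomps_Union[of adj "fst i"] by auto
  then have "card P = card (\<Union>C\<in>ccomps adj (fst i). P \<inter> C)" by simp
  also have "\<dots> = (\<Sum>C\<in>ccomps adj (fst i). card (P \<inter> C))"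
  proof (rule card_UN_disjoint)
    show "\<forall>C\<in>ccomps adj (fst i). finite (P \<inter> C)" using finite_subset[OF PA finA] by simp
    show "\<forall>C\<in>ccomps adj (fst i). \<forall>D\<in>ccomps adj (fst i). C \<noteq> D \<longrightarrow> (P \<inter> C) \<inter> (P \<inter> D) = {}"
      using ccomps_disj[OF sym_adj] by (intro ballI impI) blast
  qed (use finA in simp)
  also have "\<dots> = nup i" unfolding nup_def using P by (intro sum.cong) (auto simp: cls_def)
  finally show ?thesis .
qed

lemma Psi_support:
  assumes i: "i \<in> idx" and S: "Psi i S \<noteq> 0"
  shows "finite S" "card S = card (fst i)" "cnt True S = nup i" "cnt False S + nup i = card (fst i)"
proof -
  obtain P where P: "P \<in> cls i" "phi (enum (fst i)) P S \<noteq> 0"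
    using S unfolding Psi_def Phi_def sum_fun_app by (meson sum.neutral)
  have l: "distinct (enum (fst i))" "set (enum (fst i)) = fst i" using enum[OF idx_sub[OF i]] by auto
  have PA: "P \<subseteq> fst i" using P by (simp add: cls_def)
  have finA: "finite (fst i)" using idx_sub[OF i] finV by (rule finite_subset)
  have h: "finite S \<and> card S = length (enum (fst i)) \<and> cnt True S = card (fst i \<inter> P) \<and> cnt False S = card (fst i - P)"
    using phi_support[OF l(1) _ P(2)] l(2) idx_sub[OF i] by simp
  show "finite S" "card S = card (fst i)" using h l distinct_card[OF l(1)] by auto
  have "fst i \<inter> P = P" using PA by auto
  then show "cnt True S = nup i" using h cls_card[OF i P(1)] by simp
  have "card (fst i - P) = card (fst i) - card P" "card P \<le> card (fst i)"
    using PA finA card_Diff_subset[OF finite_subset[OF PA finA] PA] card_mono[OF finA PA] by auto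
  then show "cnt False S + nup i = card (fst i)" using h cls_card[OF i P(1)] by simp
qed

lemma number_sum: "(\<Sum>x\<in>Ms. numop x) \<psi> = (\<lambda>S. of_nat (card (S \<inter> Ms)) * \<psi> S)"
proof
  fix S
  have "(\<Sum>x\<in>Ms. numop x) \<psi> S = (\<Sum>x\<in>Ms. if x \<in> S then \<psi> S else 0)"
    by (simp add: sum_fun_app numop_eq)
  also have "\<dots> = of_nat (card {x \<in> Ms. x \<in> S}) * \<psi> S"
    using finMs by (simp add: sum.inter_filter[symmetric])
  also have "{x \<in> Ms. x \<in> S} = S \<inter> Ms" by auto
  finally show "(\<Sum>x\<in>Ms. numop x) \<psi> S = of_nat (card (S \<inter> Ms)) * \<psi> S" .
qed

lemma number_Psi:
  assumes i: "i \<in> idx"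
  shows "(\<Sum>x\<in>Ms. numop x) (Psi i) = sc (complex_of_real (card (fst i))) (Psi i)"
proof
  fix S
  show "(\<Sum>x\<in>Ms. numop x) (Psi i) S = sc (complex_of_real (card (fst i))) (Psi i) S"
  proof (cases "Psi i S = 0")
    case False
    then have "S \<subseteq> Ms" using Psi_fock[OF i] by (auto simp: fock_def)
    then have "S \<inter> Ms = S" by auto
    then show ?thesis unfolding number_sum using Psi_support(2)[OF i False] by simp
  qed (simp add: number_sum)
qed

lemma expN_Psi:
  assumes i: "i \<in> idx"
  shows "expN \<mu> (Psi i) = sc (complex_of_real (exp (\<mu> * card (fst i)))) (Psi i)"
proof
  fix S
  show "expN \<mu> (Psi i) S = sc (complex_of_real (exp (\<mu> * card (fst i)))) (Psi i) S"
    using Psi_support(2)[OF i, of S] by (cases "Psi i S = 0") (simp_all add: expN_def)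
qed

lemma spin3_Psi:
  assumes i: "i \<in> idx"
  shows "spin_tot 3 (Psi i) = sc (complex_of_real (magn i)) (Psi i)"
proof
  fix S
  show "spin_tot 3 (Psi i) S = sc (complex_of_real (magn i)) (Psi i) S"
  proof (cases "Psi i S = 0")
    case True
    then show ?thesis by (simp add: spin_tot_3 hop_same)
  next
    case False
    have "real (cnt False S) = real (card (fst i)) - real (nup i)" "real (cnt True S) = real (nup i)"
      using Psi_support(3,4)[OF i False] by linarith+
    then have "1/2 * (real (cnt True S) - real (cnt False S)) = magn i" by (simp add: magn_def)
    then have "complex_of_real (1/2 * (real (cnt True S) - real (cnt False S))) = complex_of_real (magn i)" by simp
    then show ?thesis by (simp add: spin_tot_3 hop_same cnt_def algebra_simps)
  qed
qed

lemma Psi_ker: "i \<in> idx \<Longrightarrow> Psi i \<in> ker"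
  by (rule b_in_ker)

lemma hop_Psi_ker: "i \<in> idx \<Longrightarrow> hop s r (Psi i) \<in> ker"
  using hop_zero_energy Psi_zero_energy by (simp add: ker_iff)

text \<open>A nonzero coordinate means a nonzero amplitude at the representative configuration of
  \<open>k\<close>. Turning one up electron of it back to spin down yields a configuration in the
  support of \<open>Psi i\<close>, and the spin counts are compared.\<close>

lemma raise_grade:
  assumes i: "i \<in> idx" and k: "k \<in> idx" and nz: "coord k (hop True False (Psi i)) \<noteq> 0"
  shows "magn k = magn i + 1" "card (fst k) = card (fst i)"
proof -
  let ?S = "conf (fst k) (rep k)"
  have "rep k \<subseteq> fst k" "rep k \<in> cls k" using rep_cls[OF k] by (auto simp: cls_def)
  then have "Psi k ?S = Phi (fst k) (rep k) ?S" "Phi (fst k) (rep k) ?S \<noteq> 0"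
    using Psi_at_conf[OF k idx_sub[OF k], of "rep k"] Phi_at_conf[OF idx_sub[OF k], of "rep k" "fst k" "rep k"] idx_sub[OF k] by auto
  then have kS: "Psi k ?S \<noteq> 0" by simp
  note ks = Psi_support[OF k kS]
  have "hop True False (Psi i) ?S \<noteq> 0" using nz by (auto simp: coord_def)
  then obtain x where x: "x \<in> sites_set" "cre (x True) (ann (x False) (Psi i)) ?S \<noteq> 0"
    unfolding hop_apply sum_fun_app by (meson sum.neutral)
  define T where "T = ?S - {x True}"
  have t: "x True \<in> ?S" "x False \<notin> T" "Psi i (insert (x False) T) \<noteq> 0"
    using x(2) by (auto simp: cre_def ann_def T_def split: if_splits)
  note iS = Psi_support[OF i t(3)]
  have c1: "cnt True ?S = Suc (cnt True T)" "cnt False ?S = cnt False T"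
    using cnt_remove[OF x(1) t(1)] by (auto simp: T_def)
  have c2: "cnt False (insert (x False) T) = Suc (cnt False T)" "cnt True (insert (x False) T) = cnt True T"
    using cnt_remove[OF x(1), of False "insert (x False) T"] t(2) by auto
  have n: "nup k = nup i + 1" using c1 c2 ks(3) iS(3) by simp
  moreover have "card (fst k) = card (fst i)" using c1 c2 ks(4) iS(4) n by simp
  ultimately show "magn k = magn i + 1" "card (fst k) = card (fst i)" by (simp_all add: magn_def)
qed

section \<open>The partition function and the traces of particle number and squared spin\<close>

lemma trace_exp:
  "ftrace Ms (expN \<mu> \<circ> zero_proj Ms hamiltonian) = complex_of_real (\<Sum>i\<in>idx. exp (\<mu> * card (fst i)))"
proof -
  have "ftrace Ms (expN \<mu> \<circ> zero_proj Ms hamiltonian) = (\<Sum>i\<in>idx. coord i (expN \<mu> (Psi i)))"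
    by (rule trace_on_kernel[OF lin_expN]) (simp add: expN_Psi ker_sc Psi_ker)
  also have "\<dots> = (\<Sum>i\<in>idx. complex_of_real (exp (\<mu> * card (fst i))))"
    by (intro sum.cong refl) (simp add: expN_Psi coord_sc coord_Psi)
  finally show ?thesis by (simp only: of_real_sum)
qed

lemma trace_number:
  "ftrace Ms ((\<Sum>x\<in>Ms. numop x) \<circ> expN \<mu> \<circ> zero_proj Ms hamiltonian)
    = complex_of_real (\<Sum>i\<in>idx. exp (\<mu> * card (fst i)) * card (fst i))"
proof -
  have linN: "lin (\<Sum>x\<in>Ms. numop x)" by (intro lin_opsum lin_numop)
  have Tb: "((\<Sum>x\<in>Ms. numop x) \<circ> expN \<mu>) (Psi i)
      = sc (complex_of_real (exp (\<mu> * card (fst i)) * card (fst i))) (Psi i)" if "i \<in> idx" for i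
    by (simp only: comp_apply expN_Psi[OF that] lin_sc[OF linN] number_Psi[OF that] sc_sc of_real_mult)
  have "ftrace Ms (((\<Sum>x\<in>Ms. numop x) \<circ> expN \<mu>) \<circ> zero_proj Ms hamiltonian)
      = (\<Sum>i\<in>idx. coord i (((\<Sum>x\<in>Ms. numop x) \<circ> expN \<mu>) (Psi i)))"
    by (rule trace_on_kernel[OF lin_comp[OF linN lin_expN]]) (simp only: Tb ker_sc Psi_ker)
  also have "\<dots> = (\<Sum>i\<in>idx. complex_of_real (exp (\<mu> * card (fst i)) * card (fst i)))"
    by (intro sum.cong refl) (simp add: Tb coord_sc coord_Psi del: comp_apply)
  finally show ?thesis by (simp only: of_real_sum)
qed

text \<open>The third component contributes magn^2; by \<open>ladder_trace\<close> each of the two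
  ladder products contributes 2 magn^2 in the weighted sum, and they enter with factor 1/2.\<close>

lemma trace_spin:
  "ftrace Ms ((\<Sum>a\<in>{1,2,3}. spin_tot a \<circ> spin_tot a) \<circ> expN \<mu> \<circ> zero_proj Ms hamiltonian)
    = complex_of_real (\<Sum>i\<in>idx. exp (\<mu> * card (fst i)) * (3 * (magn i)\<^sup>2))"
proof -
  let ?S = "\<Sum>a\<in>{1,2,3}. spin_tot a \<circ> spin_tot a"
  let ?P = "hop True False" and ?M = "hop False True"
  define w where "w i = complex_of_real (exp (\<mu> * card (fst i)))" for i :: "'v set \<times> ('v set \<Rightarrow> nat)"
  define m where "m i = complex_of_real (magn i)" for i
  have linS: "lin ?S" by (intro lin_opsum lin_comp lin_spin_tot)
  have fin: "fin_state (Psi i)" if "i \<in> idx" for i using fock_fin[OF finMs Psi_fock[OF that]] .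
  have S: "?S (Psi i) = sc (m i * m i) (Psi i) + sc (1/2) (?P (?M (Psi i)) + ?M (?P (Psi i)))" if "i \<in> idx" for i
    by (simp only: spin_square spin3_Psi[OF that] lin_sc[OF lin_spin_tot] sc_sc m_def)
  have hh: "hop s r (hop s' r' (Psi i)) \<in> ker" if "i \<in> idx" for i s r s' r'
    using hop_zero_energy hop_Psi_ker[OF that] by (simp add: ker_iff)
  have Tb: "(?S \<circ> expN \<mu>) (Psi i) = sc (w i) (?S (Psi i))" if "i \<in> idx" for i
    by (simp only: comp_apply expN_Psi[OF that] lin_sc[OF linS] w_def)
  have Tk: "(?S \<circ> expN \<mu>) (Psi i) \<in> ker" if "i \<in> idx" for i
    unfolding Tb[OF that] S[OF that] by (intro ker_sc ker_add hh Psi_ker that)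
  have comm: "?P (?M (Psi i)) - ?M (?P (Psi i)) = sc (2 * m i) (Psi i)" if "i \<in> idx" for i
  proof -
    have "?P (?M (Psi i)) - ?M (?P (Psi i)) = hop True True (Psi i) - hop False False (Psi i)"
      using hop_commutator[OF fin[OF that], of True False False True] by (simp only: simp_thms if_True)
    also have "\<dots> = sc 2 (spin_tot 3 (Psi i))" by (simp add: spin_tot_3 sc_sc)
    finally show ?thesis by (simp only: spin3_Psi[OF that] sc_sc m_def)
  qed
  have grade: "m k = m i + 1 \<and> w k = w i"
    if "i \<in> idx" "k \<in> idx" "coord k (?P (Psi i)) \<noteq> 0" for i k
    using raise_grade[OF that] by (simp add: m_def w_def)
  note lad = ladder_trace[of ?P ?M m w, OF coord_Psi lin_hop lin_hop hop_Psi_ker hop_Psi_ker comm grade]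
  have "ftrace Ms ((?S \<circ> expN \<mu>) \<circ> zero_proj Ms hamiltonian) = (\<Sum>i\<in>idx. coord i ((?S \<circ> expN \<mu>) (Psi i)))"
    by (rule trace_on_kernel[OF lin_comp[OF linS lin_expN] Tk])
  also have "\<dots> = (\<Sum>i\<in>idx. w i * m i ^ 2 + 1/2 * (w i * coord i (?P (?M (Psi i)))) + 1/2 * (w i * coord i (?M (?P (Psi i)))))"
  proof (intro sum.cong refl)
    fix i assume i: "i \<in> idx"
    have "coord i ((?S \<circ> expN \<mu>) (Psi i)) = w i * (m i * m i * coord i (Psi i)
        + 1/2 * (coord i (?P (?M (Psi i))) + coord i (?M (?P (Psi i)))))"
      by (simp only: Tb[OF i] S[OF i] coord_sc coord_add)
    also have "coord i (Psi i) = 1" using coord_Psi[OF i i] by simp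
    also have "w i * (m i * m i * 1 + 1/2 * (coord i (?P (?M (Psi i))) + coord i (?M (?P (Psi i)))))
      = w i * m i ^ 2 + 1/2 * (w i * coord i (?P (?M (Psi i)))) + 1/2 * (w i * coord i (?M (?P (Psi i))))"
      by (simp add: power2_eq_square algebra_simps)
    finally show "coord i ((?S \<circ> expN \<mu>) (Psi i))
      = w i * m i ^ 2 + 1/2 * (w i * coord i (?P (?M (Psi i)))) + 1/2 * (w i * coord i (?M (?P (Psi i))))" .
  qed
  also have "\<dots> = (\<Sum>i\<in>idx. w i * m i ^ 2) + 1/2 * (\<Sum>i\<in>idx. w i * coord i (?P (?M (Psi i))))
      + 1/2 * (\<Sum>i\<in>idx. w i * coord i (?M (?P (Psi i))))"
    by (simp only: sum.distrib sum_distrib_left)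
  also have "\<dots> = (\<Sum>i\<in>idx. w i * m i ^ 2) + (\<Sum>i\<in>idx. 2 * w i * m i ^ 2)" using lad by simp
  also have "\<dots> = (\<Sum>i\<in>idx. complex_of_real (exp (\<mu> * card (fst i)) * (3 * (magn i)\<^sup>2)))"
    unfolding sum.distrib[symmetric] by (intro sum.cong refl) (simp add: w_def m_def)
  finally show ?thesis by (simp only: of_real_sum)
qed

end

section \<open>Moments of independent uniform variables\<close>

lemma centred_uniform_sums:
  fixes n :: nat
  shows "(\<Sum>y\<in>{0..n}. real y - real n / 2) = 0"
    and "(\<Sum>y\<in>{0..n}. (real y - real n / 2)\<^sup>2) = real (n + 1) * (real n * (n + 2) / 12)"
proof -
  have s1: "(\<Sum>y\<in>{0..n}. real y) = real n * (n + 1) / 2"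
    by (induction n) (simp_all add: field_simps)
  have s2: "(\<Sum>y\<in>{0..n}. (real y)\<^sup>2) = real n * (n + 1) * (2 * n + 1) / 6"
    by (induction n) (simp_all add: field_simps power2_eq_square)
  show "(\<Sum>y\<in>{0..n}. real y - real n / 2) = 0" using s1 by (simp add: sum_subtractf)
  have "(\<Sum>y\<in>{0..n}. (real y - real n / 2)\<^sup>2)
      = (\<Sum>y\<in>{0..n}. (real y)\<^sup>2) - real n * (\<Sum>y\<in>{0..n}. real y) + real (n + 1) * (real n / 2)\<^sup>2"
    by (simp add: power2_diff sum.distrib sum_subtractf sum_distrib_left mult_ac)
  then show "(\<Sum>y\<in>{0..n}. (real y - real n / 2)\<^sup>2) = real (n + 1) * (real n * (n + 2) / 12)"
    unfolding s1 s2 by (simp add: field_simps power2_eq_square)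
qed

text \<open>Both moments are proved together, since the vanishing mean removes the cross terms when
  a variable is added. The value n (n + 2) / 12 is the variance of the uniform distribution on n + 1
  consecutive integers.\<close>

lemma independent_uniform_moments:
  fixes n :: "'b \<Rightarrow> nat"
  assumes "finite J"
  shows "(\<Sum>j\<in>PiE J (\<lambda>i. {0..n i}). \<Sum>i\<in>J. real (j i) - real (n i) / 2) = 0"
    and "(\<Sum>j\<in>PiE J (\<lambda>i. {0..n i}). (\<Sum>i\<in>J. real (j i) - real (n i) / 2)\<^sup>2)
      = real (\<Prod>i\<in>J. n i + 1) * (\<Sum>i\<in>J. real (n i) * (n i + 2) / 12)"
proof -
  have "(\<Sum>j\<in>PiE J (\<lambda>i. {0..n i}). \<Sum>i\<in>J. real (j i) - real (n i) / 2) = 0 \<and>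
    (\<Sum>j\<in>PiE J (\<lambda>i. {0..n i}). (\<Sum>i\<in>J. real (j i) - real (n i) / 2)\<^sup>2)
      = real (\<Prod>i\<in>J. n i + 1) * (\<Sum>i\<in>J. real (n i) * (n i + 2) / 12)"
    using assms
  proof (induction rule: finite_induct)
    case (insert a J)
    let ?B = "\<lambda>i. {0..n i}"
    let ?x = "\<lambda>g. \<Sum>i\<in>J. real (g i) - real (n i) / 2"
    let ?u = "\<lambda>y. real y - real (n a) / 2"
    have split: "(\<Sum>j\<in>PiE (insert a J) ?B. F (\<Sum>i\<in>insert a J. real (j i) - real (n i) / 2))
        = (\<Sum>y\<in>?B a. \<Sum>g\<in>PiE J ?B. F (?u y + ?x g))" for F :: "real \<Rightarrow> real"
    proof -
      have "(\<Sum>j\<in>PiE (insert a J) ?B. F (\<Sum>i\<in>insert a J. real (j i) - real (n i) / 2))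
          = (\<Sum>(y, g)\<in>?B a \<times> PiE J ?B. F (\<Sum>i\<in>insert a J. real ((g(a := y)) i) - real (n i) / 2))"
        unfolding PiE_insert_eq
        by (subst sum.reindex[OF inj_combinator[OF insert(2)]]) (simp add: split_def o_def)
      also have "\<dots> = (\<Sum>(y, g)\<in>?B a \<times> PiE J ?B. F (?u y + ?x g))"
      proof (intro sum.cong refl, clarify)
        fix y g
        have "(\<Sum>i\<in>J. real ((g(a := y)) i) - real (n i) / 2) = ?x g"
          using insert(2) by (intro sum.cong) auto
        then show "F (\<Sum>i\<in>insert a J. real ((g(a := y)) i) - real (n i) / 2) = F (?u y + ?x g)"
          using insert(1,2) by simp
      qed
      finally show ?thesis by (simp add: sum.cartesian_product)
    qed
    have card: "card (PiE J ?B) = (\<Prod>i\<in>J. n i + 1)" using insert(1) by (simp add: card_PiE)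
    have IH: "(\<Sum>g\<in>PiE J ?B. ?x g) = 0"
      "(\<Sum>g\<in>PiE J ?B. (?x g)\<^sup>2) = real (\<Prod>i\<in>J. n i + 1) * (\<Sum>i\<in>J. real (n i) * (n i + 2) / 12)"
      using insert.IH by auto
    have one: "(\<Sum>g\<in>PiE J ?B. ?u y + ?x g) = real (card (PiE J ?B)) * ?u y" for y
      using IH(1) by (simp add: sum.distrib)
    have two: "(\<Sum>g\<in>PiE J ?B. (?u y + ?x g)\<^sup>2) = real (card (PiE J ?B)) * (?u y)\<^sup>2 + (\<Sum>g\<in>PiE J ?B. (?x g)\<^sup>2)" for y
    proof -
      have "(\<Sum>g\<in>PiE J ?B. (?u y + ?x g)\<^sup>2) = (\<Sum>g\<in>PiE J ?B. (?u y)\<^sup>2 + (?x g)\<^sup>2 + 2 * ?u y * ?x g)"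
        by (intro sum.cong refl) (rule power2_sum)
      also have "\<dots> = real (card (PiE J ?B)) * (?u y)\<^sup>2 + (\<Sum>g\<in>PiE J ?B. (?x g)\<^sup>2) + 2 * ?u y * (\<Sum>g\<in>PiE J ?B. ?x g)"
        unfolding sum.distrib sum_distrib_left by simp
      finally show ?thesis using IH(1) by simp
    qed
    have "(\<Sum>j\<in>PiE (insert a J) ?B. \<Sum>i\<in>insert a J. real (j i) - real (n i) / 2) = 0"
      unfolding split[of "\<lambda>x. x"] one sum_distrib_left[symmetric] centred_uniform_sums by simp
    moreover have "(\<Sum>j\<in>PiE (insert a J) ?B. (\<Sum>i\<in>insert a J. real (j i) - real (n i) / 2)\<^sup>2)
        = real (\<Prod>i\<in>insert a J. n i + 1) * (\<Sum>i\<in>insert a J. real (n i) * (n i + 2) / 12)"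
    proof -
      have "(\<Sum>j\<in>PiE (insert a J) ?B. (\<Sum>i\<in>insert a J. real (j i) - real (n i) / 2)\<^sup>2)
          = real (card (PiE J ?B)) * (\<Sum>y\<in>?B a. (?u y)\<^sup>2) + real (n a + 1) * (\<Sum>g\<in>PiE J ?B. (?x g)\<^sup>2)"
        unfolding split[of "\<lambda>x. x\<^sup>2"] two sum.distrib sum_distrib_left[symmetric] by simp
      also have "\<dots> = real (\<Prod>i\<in>insert a J. n i + 1) * (\<Sum>i\<in>insert a J. real (n i) * (n i + 2) / 12)"
        unfolding centred_uniform_sums IH card using insert(1,2) by (simp add: algebra_simps)
      finally show ?thesis .
    qed
    ultimately show ?case by blast
  qed simp
  then show "(\<Sum>j\<in>PiE J (\<lambda>i. {0..n i}). \<Sum>i\<in>J. real (j i) - real (n i) / 2) = 0"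
    and "(\<Sum>j\<in>PiE J (\<lambda>i. {0..n i}). (\<Sum>i\<in>J. real (j i) - real (n i) / 2)\<^sup>2)
      = real (\<Prod>i\<in>J. n i + 1) * (\<Sum>i\<in>J. real (n i) * (n i + 2) / 12)" by blast+
qed

section \<open>The decorated hypercubic lattice\<close>

lemma card_ccomps_index:
  assumes "finite A"
  shows "card (PiE (ccomps R A) (\<lambda>C. {0..card C})) = cweight R A"
  using assms by (simp add: card_PiE cweight_def)

lemma (in decorated_lists) idx_sum:
  "(\<Sum>i\<in>idx. f i) = (\<Sum>A\<in>Pow V. \<Sum>j\<in>PiE (ccomps adj A) (\<lambda>C. {0..card C}). f (A, j))"
proof -
  have "finite (PiE (ccomps adj A) (\<lambda>C. {0..card C}))" if "A \<in> Pow V" for A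
    using that finite_subset[OF _ finV] by (intro finite_PiE) auto
  then show ?thesis unfolding idx_def using finV by (subst sum.Sigma) auto
qed

lemma (in decorated_lists) partition_sum:
  fixes \<mu> :: real and g :: "nat \<Rightarrow> real"
  shows "(\<Sum>i\<in>idx. exp (\<mu> * card (fst i)) * g (card (fst i))) = (\<Sum>A\<in>Pow V. gibbs adj \<mu> A * g (card A))"
  unfolding idx_sum
proof (intro sum.cong refl)
  fix A assume "A \<in> Pow V"
  then have "finite A" using finV finite_subset by auto
  then show "(\<Sum>j\<in>PiE (ccomps adj A) (\<lambda>C. {0..card C}). exp (\<mu> * card (fst (A, j))) * g (card (fst (A, j))))
      = gibbs adj \<mu> A * g (card A)"
    using card_ccomps_index[of A adj] by (simp add: gibbs_def)
qed

text \<open>The magnetization is a sum of independent centred uniform variables, one per component.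
  Three times the variance, |C| (|C| + 2) / 4, is s (s + 1) for s = |C| / 2.\<close>

lemma (in decorated_lists) spin_sum:
  fixes \<mu> :: real
  shows "(\<Sum>i\<in>idx. exp (\<mu> * card (fst i)) * (3 * (magn i)\<^sup>2))
    = (\<Sum>A\<in>Pow V. gibbs adj \<mu> A * (\<Sum>C\<in>ccomps adj A. real (card C) * (card C + 2))) / 4"
  unfolding idx_sum sum_divide_distrib
proof (intro sum.cong refl)
  fix A assume "A \<in> Pow V"
  then have fin: "finite A" using finV finite_subset by auto
  let ?J = "ccomps adj A"
  have cA: "real (card A) = (\<Sum>C\<in>?J. real (card C))"
    using sum_card_ccomps[OF sym_adj fin] by (metis of_nat_sum)
  have magn: "magn (A, j) = (\<Sum>C\<in>?J. real (j C) - real (card C) / 2)" for j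
    by (simp add: magn_def nup_def cA sum_subtractf sum_divide_distrib)
  have "(\<Sum>j\<in>PiE ?J (\<lambda>C. {0..card C}). exp (\<mu> * card (fst (A, j))) * (3 * (magn (A, j))\<^sup>2))
      = 3 * exp (\<mu> * card A) * (\<Sum>j\<in>PiE ?J (\<lambda>C. {0..card C}). (\<Sum>C\<in>?J. real (j C) - real (card C) / 2)\<^sup>2)"
    by (simp add: magn sum_distrib_left mult_ac)
  also have "\<dots> = 3 * exp (\<mu> * card A) * (real (cweight adj A) * (\<Sum>C\<in>?J. real (card C) * (card C + 2) / 12))"
    unfolding cweight_def using independent_uniform_moments(2)[of ?J card] fin by simp
  also have "\<dots> = gibbs adj \<mu> A * (\<Sum>C\<in>?J. real (card C) * (card C + 2)) / 4"
    by (simp add: gibbs_def sum_divide_distrib[symmetric])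
  finally show "(\<Sum>j\<in>PiE ?J (\<lambda>C. {0..card C}). exp (\<mu> * card (fst (A, j))) * (3 * (magn (A, j))\<^sup>2))
      = gibbs adj \<mu> A * (\<Sum>C\<in>?J. real (card C) * (card C + 2)) / 4" .
qed

context torus
begin

lemma nbr_neq:
  assumes "v \<in> V" "j < d" shows "N j v \<noteq> v"
proof
  assume "N j v = v"
  then have "Suc (v ! j) mod L = v ! j" using assms nbr_nth_eq[of j v L] by (simp add: verts_def)
  then show False using L2 verts_nth[OF assms] by (auto simp: mod_Suc split: if_splits)
qed

lemma decorated_lists_hypercubic:
  assumes "t > 0" "lam > 0" "U > 0" "U' > 0"
  shows "decorated_lists V (V \<times> {..<d}) fst (\<lambda>(v, j). N j v) vmode (\<lambda>(v, j). mmode v j) t lam U U'"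
proof
  show "vmode v s = vmode w r \<longleftrightarrow> v = w \<and> s = r" for v w s r by (auto simp: vmode_def sp_def)
  show "(case e of (v, j) \<Rightarrow> mmode v j) s = (case f of (v, j) \<Rightarrow> mmode v j) r \<longleftrightarrow> e = f \<and> s = r" for e f s r
    by (auto simp: mmode_def sp_def split: prod.splits)
  show "vmode v s \<noteq> (case e of (v, j) \<Rightarrow> mmode v j) r" for v e s r
    by (auto simp: vmode_def mmode_def split: prod.splits)
  show "fst e \<noteq> (case e of (v, j) \<Rightarrow> N j v)" if "e \<in> V \<times> {..<d}" for e
    using that nbr_neq by (auto split: prod.splits) metis
qed (use assms nbr_verts in auto)

text \<open>The traces are real numbers, so taking \<open>Re\<close> loses nothing.\<close>

lemma expectations:
  assumes par: "t > 0" "lam > 0" "U > 0" "U' > 0"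
  defines "Z \<equiv> (\<lambda>\<mu>. \<Sum>A\<in>Pow V. gibbs adj \<mu> A)"
  shows "Re (gexp (modes d L) (Ham d L t lam U U') \<mu> (Nel d L)) = (\<Sum>A\<in>Pow V. gibbs adj \<mu> A * real (card A)) / Z \<mu>"
    and "Re (gexp (modes d L) (Ham d L t lam U U') \<mu> (Stot_sq d L))
      = (\<Sum>A\<in>Pow V. gibbs adj \<mu> A * (\<Sum>C\<in>ccomps adj A. real (card C) * (card C + 2))) / 4 / Z \<mu>"
proof -
  interpret D: decorated_lists V "V \<times> {..<d}" fst "\<lambda>(v, j). N j v" vmode "\<lambda>(v, j). mmode v j" t lam U U'
    by (rule decorated_lists_hypercubic[OF par])
  have sites: "D.sites_set = sites d L"
    unfolding D.sites_set_def sites_def by (auto simp: image_iff)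
  have Ms: "D.Ms = modes d L" unfolding D.Ms_sites sites modes_def by simp
  have adj: "D.adj = adj" unfolding D.adj_def adjT_def using nbr_verts by fastforce
  have H: "D.hamiltonian = Ham d L t lam U U'"
    unfolding D.hamiltonian_def Ham_def Hhop_def Hint_def D.cop_def D.aop_def
    by (simp add: sum.cartesian_product split_def)
  have N: "Nel d L = (\<Sum>x\<in>D.Ms. numop x)" by (simp only: Nel_def Ms)
  have S: "Stot_sq d L = (\<Sum>a\<in>{1,2,3}. D.spin_tot a \<circ> D.spin_tot a)"
    by (simp only: Stot_sq_def Stot_def D.spin_tot_def sites[symmetric])
  have Z: "ftrace (modes d L) (expN \<mu> \<circ> zero_proj (modes d L) (Ham d L t lam U U')) = complex_of_real (Z \<mu>)"
    using D.trace_exp[of \<mu>] D.partition_sum[where \<mu> = \<mu> and g = "\<lambda>_. 1"] by (simp only: Ms H adj Z_def mult_1_right)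
  have "ftrace (modes d L) (Nel d L \<circ> expN \<mu> \<circ> zero_proj (modes d L) (Ham d L t lam U U'))
      = complex_of_real (\<Sum>A\<in>Pow V. gibbs adj \<mu> A * real (card A))"
    using D.trace_number[of \<mu>] unfolding N D.partition_sum[where \<mu> = \<mu> and g = real] by (simp only: Ms H adj)
  then show "Re (gexp (modes d L) (Ham d L t lam U U') \<mu> (Nel d L)) = (\<Sum>A\<in>Pow V. gibbs adj \<mu> A * real (card A)) / Z \<mu>"
    unfolding gexp_def Z by (simp only: of_real_divide[symmetric] Re_complex_of_real)
  have "ftrace (modes d L) (Stot_sq d L \<circ> expN \<mu> \<circ> zero_proj (modes d L) (Ham d L t lam U U'))
      = complex_of_real ((\<Sum>A\<in>Pow V. gibbs adj \<mu> A * (\<Sum>C\<in>ccomps adj A. real (card C) * (card C + 2))) / 4)"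
    using D.trace_spin[of \<mu>] unfolding S D.spin_sum by (simp only: Ms H adj)
  then show "Re (gexp (modes d L) (Ham d L t lam U U') \<mu> (Stot_sq d L))
      = (\<Sum>A\<in>Pow V. gibbs adj \<mu> A * (\<Sum>C\<in>ccomps adj A. real (card C) * (card C + 2))) / 4 / Z \<mu>"
    unfolding gexp_def Z by (simp only: of_real_divide[symmetric] Re_complex_of_real)
qed

lemma sum_spin_le:
  assumes A: "A \<subseteq> V"
  shows "(\<Sum>C\<in>ccomps adj A. real (card C) * (card C + 2)) \<le> real (card V) * (card V + 2)"
proof -
  have fin: "finite A" using A by (rule finite_subset) simp
  have le: "card A \<le> card V" using A by (intro card_mono) auto
  have "(\<Sum>C\<in>ccomps adj A. card C ^ 2) \<le> (\<Sum>C\<in>ccomps adj A. card C) ^ 2"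
    using fin by (intro sum_power_le_power_sum) auto
  also have "\<dots> \<le> card V ^ 2" unfolding sum_card_ccomps[OF sym_adjT fin] using le by (intro power_mono) auto
  finally have "(\<Sum>C\<in>ccomps adj A. card C ^ 2) + 2 * (\<Sum>C\<in>ccomps adj A. card C) \<le> card V ^ 2 + 2 * card V"
    unfolding sum_card_ccomps[OF sym_adjT fin] using le by simp
  moreover have "(\<Sum>C\<in>ccomps adj A. card C * (card C + 2))
      = (\<Sum>C\<in>ccomps adj A. card C ^ 2) + 2 * (\<Sum>C\<in>ccomps adj A. card C)"
    unfolding sum_distrib_left sum.distrib[symmetric]
    by (intro sum.cong) (auto simp: power2_eq_square algebra_simps)
  ultimately have "(\<Sum>C\<in>ccomps adj A. card C * (card C + 2)) \<le> card V * (card V + 2)"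
    by (simp add: power2_eq_square algebra_simps)
  then have "real (\<Sum>C\<in>ccomps adj A. card C * (card C + 2)) \<le> real (card V * (card V + 2))"
    by (rule of_nat_mono)
  then show ?thesis by (simp add: algebra_simps)
qed

lemma hypercubic_high_density:
  assumes par: "t > 0" "lam > 0" "U > 0" "U' > 0"
    and \<mu>: "real (2 * d + 4 * d ^ 2) ^ 2 * exp (4 * real d ^ 2 - \<mu>) \<le> 1/2"
  defines "S2 \<equiv> Re (gexp (modes d L) (Ham d L t lam U U') \<mu> (Stot_sq d L))"
    and "Smax \<equiv> real (L ^ d) / 2"
  shows "S2 \<le> Smax * (Smax + 1)"
    and "Smax * (Smax + 1) * (1 - 10 * real (2 * d + 4 * d ^ 2) ^ 2 * exp (4 * real d ^ 2) * exp (- \<mu>)) \<le> S2"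
proof -
  define Z where "Z = (\<Sum>A\<in>Pow V. gibbs adj \<mu> A)"
  define Q where "Q = (\<Sum>A\<in>Pow V. gibbs adj \<mu> A * (\<Sum>C\<in>ccomps adj A. real (card C) * (card C + 2)))"
  define n where "n = real (card V) * (card V + 2)"
  have Z: "Z > 0" unfolding Z_def by (intro sum_pos gibbs_pos) auto
  have S2: "S2 = Q / 4 / Z" unfolding S2_def Q_def Z_def by (rule expectations(2)[OF par])
  have Smax: "Smax * (Smax + 1) = n / 4" by (simp add: Smax_def n_def card_verts field_simps)
  have "Q \<le> (\<Sum>A\<in>Pow V. gibbs adj \<mu> A * n)"
    unfolding Q_def n_def using sum_spin_le less_imp_le[OF gibbs_pos] by (intro sum_mono mult_left_mono) auto
  then have "Q \<le> n * Z" by (simp add: Z_def sum_distrib_left mult.commute)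
  then show "S2 \<le> Smax * (Smax + 1)" unfolding S2 Smax using Z by (simp add: pos_divide_le_eq)
  have r: "real (2 * d + 4 * d ^ 2) ^ 2 * exp (4 * real d ^ 2 - \<mu>)
      = real (2 * d + 4 * d ^ 2) ^ 2 * exp (4 * real d ^ 2) * exp (- \<mu>)"
    by (simp add: exp_diff exp_minus field_simps)
  have "Z * (n * (1 - 10 * (real (2 * d + 4 * d ^ 2) ^ 2 * exp (4 * real d ^ 2) * exp (- \<mu>)))) \<le> Q"
    using high_density_spin[OF refl \<mu>] unfolding r Z_def n_def Q_def .
  then show "Smax * (Smax + 1) * (1 - 10 * real (2 * d + 4 * d ^ 2) ^ 2 * exp (4 * real d ^ 2) * exp (- \<mu>)) \<le> S2"
    unfolding S2 Smax using Z by (simp add: pos_le_divide_eq mult_ac)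
qed

text \<open>In n (n + 2) = 3 n + n (n - 1), the first part sums to three times the electron number,
  and the second counts pairs for \<open>low_density_pairs\<close>. Degree 2 d and the overall 1/4
  give 8 * 2 d / 4 = 4 d.\<close>

lemma hypercubic_low_density:
  assumes par: "t > 0" "lam > 0" "U > 0" "U' > 0"
    and \<mu>: "real (2 * d) * (2 * exp \<mu>) \<le> 1/2"
  defines "S2 \<equiv> Re (gexp (modes d L) (Ham d L t lam U U') \<mu> (Stot_sq d L))"
    and "Ne \<equiv> Re (gexp (modes d L) (Ham d L t lam U U') \<mu> (Nel d L))"
  shows "3/4 * Ne \<le> S2" and "S2 \<le> 3/4 * Ne + 4 * real d * real (card V) * exp (2 * \<mu>)"
proof -
  define Z where "Z = (\<Sum>A\<in>Pow V. gibbs adj \<mu> A)"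
  define X where "X = (\<Sum>A\<in>Pow V. gibbs adj \<mu> A * (\<Sum>C\<in>ccomps adj A. real (card C * (card C - 1))))"
  define n where "n = (\<Sum>A\<in>Pow V. gibbs adj \<mu> A * real (card A))"
  have Z: "Z > 0" unfolding Z_def by (intro sum_pos gibbs_pos) auto
  have Ne: "Ne = n / Z" unfolding Ne_def n_def Z_def by (rule expectations(1)[OF par])
  have split: "(\<Sum>C\<in>ccomps adj A. real (card C) * (card C + 2))
      = 3 * real (card A) + (\<Sum>C\<in>ccomps adj A. real (card C * (card C - 1)))" if "A \<subseteq> V" for A
  proof -
    have fin: "finite A" using that by (rule finite_subset) simp
    have "real c * (c + 2) = 3 * real c + real (c * (c - 1))" for c :: nat
      by (cases c) (simp_all add: algebra_simps)
    then have "(\<Sum>C\<in>ccomps adj A. real (card C) * (card C + 2))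
        = 3 * (\<Sum>C\<in>ccomps adj A. real (card C)) + (\<Sum>C\<in>ccomps adj A. real (card C * (card C - 1)))"
      by (simp only: sum.distrib sum_distrib_left)
    also have "(\<Sum>C\<in>ccomps adj A. real (card C)) = real (card A)"
      using sum_card_ccomps[OF sym_adjT fin] by (metis of_nat_sum)
    finally show ?thesis .
  qed
  have "(\<Sum>A\<in>Pow V. gibbs adj \<mu> A * (\<Sum>C\<in>ccomps adj A. real (card C) * (card C + 2)))
      = (\<Sum>A\<in>Pow V. 3 * (gibbs adj \<mu> A * real (card A)) + gibbs adj \<mu> A * (\<Sum>C\<in>ccomps adj A. real (card C * (card C - 1))))"
  proof (intro sum.cong refl)
    fix A assume "A \<in> Pow V"
    then have "A \<subseteq> V" by simp
    then show "gibbs adj \<mu> A * (\<Sum>C\<in>ccomps adj A. real (card C) * (card C + 2))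
      = 3 * (gibbs adj \<mu> A * real (card A)) + gibbs adj \<mu> A * (\<Sum>C\<in>ccomps adj A. real (card C * (card C - 1)))"
      by (simp only: split distrib_left mult.left_commute)
  qed
  also have "\<dots> = 3 * n + X" by (simp only: sum.distrib sum_distrib_left n_def X_def)
  finally have S2: "S2 = 3/4 * Ne + X / 4 / Z"
    unfolding S2_def expectations(2)[OF par] Ne Z_def[symmetric] by (simp add: add_divide_distrib)
  have "X \<ge> 0" unfolding X_def by (intro sum_nonneg mult_nonneg_nonneg less_imp_le[OF gibbs_pos]) auto
  then show "3/4 * Ne \<le> S2" unfolding S2 using Z by simp
  have "X \<le> Z * (8 * real (2 * d) * real (card V) * exp (2 * \<mu>))"
    unfolding X_def Z_def by (rule low_density_pairs[OF sym_adjT adjT_subset finite_verts adj_degree \<mu>])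
  then have "X / 4 / Z \<le> 4 * real d * real (card V) * exp (2 * \<mu>)"
    using Z by (simp add: pos_divide_le_eq mult_ac)
  then show "S2 \<le> 3/4 * Ne + 4 * real d * real (card V) * exp (2 * \<mu>)" unfolding S2 by simp
qed

end

theorem theorem2p5:
  fixes d :: nat
  assumes "d \<ge> 2"
  shows "\<exists>c2 c3 \<mu>1 \<mu>2 :: real. c2 > 0 \<and> c3 > 0 \<and> \<mu>1 > 0 \<and> \<mu>2 < 0 \<and>
    (\<forall>(L::nat) (t::real) (lam::real) (U::real) (U'::real).
       even L \<and> L \<ge> 4 \<and> t > 0 \<and> lam > 0 \<and> U > 0 \<and> U' > 0 \<longrightarrow>
       (let H = Ham d L t lam U U'; Ms = modes d L;
            Smax = real (L ^ d) / 2;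
            S2 = (\<lambda>\<mu>. Re (gexp Ms H \<mu> (Stot_sq d L)));
            Ne = (\<lambda>\<mu>. Re (gexp Ms H \<mu> (Nel d L)))
        in (\<forall>\<mu>::real. \<mu> \<ge> \<mu>1 \<longrightarrow>
              Smax * (Smax + 1) \<ge> S2 \<mu> \<and> S2 \<mu> \<ge> Smax * (Smax + 1) * (1 - c2 * exp (- \<mu>))) \<and>
           (\<forall>\<mu>::real. \<mu> \<le> \<mu>2 \<longrightarrow>
              3/4 * Ne \<mu> \<le> S2 \<mu> \<and> S2 \<mu> \<le> 3/4 * Ne \<mu> + c3 * real (card (verts d L)) * exp (2 * \<mu>))))"
proof -
  define m where "m = real (2 * d + 4 * d ^ 2)"
  define c2 where "c2 = 10 * m ^ 2 * exp (4 * real d ^ 2)"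
  define c3 where "c3 = 4 * real d"
  \<comment> \<open>At this value the ratio m^2 exp (4 d^2 - mu) of the animal sum equals
    1/2.\<close>
  define \<mu>1 where "\<mu>1 = ln (2 * m ^ 2) + 4 * real d ^ 2"
  \<comment> \<open>At this value the ratio 2 d * 2 exp mu of the path sum equals 1/2.\<close>
  define \<mu>2 where "\<mu>2 = - ln (8 * real d)"
  have "1 \<le> 2 * d + 4 * d ^ 2" using assms by simp
  then have "real 1 \<le> m" unfolding m_def by (rule of_nat_mono)
  then have "1 \<le> m" by simp
  then have m: "m > 0" "m ^ 2 \<ge> 1" by (simp_all add: one_le_power)
  have c: "c2 > 0" "c3 > 0" using m assms by (simp_all add: c2_def c3_def)
  have "ln (2 * m ^ 2) \<ge> 0" using m by (intro ln_ge_zero) linarith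
  then have \<mu>1: "\<mu>1 > 0" using assms by (simp add: \<mu>1_def add_nonneg_pos)
  have \<mu>2: "\<mu>2 < 0" using assms by (simp add: \<mu>2_def)
  have high: "m ^ 2 * exp (4 * real d ^ 2 - \<mu>) \<le> 1/2" if "\<mu> \<ge> \<mu>1" for \<mu>
  proof -
    have "exp (4 * real d ^ 2 - \<mu>) \<le> exp (- ln (2 * m ^ 2))" using that by (simp add: \<mu>1_def)
    also have "exp (- ln (2 * m ^ 2)) = 1 / (2 * m ^ 2)"
    proof -
      have "2 * m ^ 2 > 0" using m by simp
      then show ?thesis by (simp only: exp_minus exp_ln inverse_eq_divide)
    qed
    finally have "m ^ 2 * exp (4 * real d ^ 2 - \<mu>) \<le> m ^ 2 * (1 / (2 * m ^ 2))"
      by (rule mult_left_mono) simp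
    also have "\<dots> = 1/2" using m by simp
    finally show ?thesis .
  qed
  have low: "real (2 * d) * (2 * exp \<mu>) \<le> 1/2" if "\<mu> \<le> \<mu>2" for \<mu>
  proof -
    have "exp \<mu> \<le> exp (- ln (8 * real d))" using that by (simp add: \<mu>2_def)
    also have "exp (- ln (8 * real d)) = 1 / (8 * real d)"
    proof -
      have "8 * real d > 0" using assms by simp
      then show ?thesis by (simp only: exp_minus exp_ln inverse_eq_divide)
    qed
    finally have "4 * real d * exp \<mu> \<le> 4 * real d * (1 / (8 * real d))" by (rule mult_left_mono) simp
    also have "\<dots> = 1/2" using assms by simp
    finally show ?thesis by simp
  qed
  show ?thesis
    unfolding Let_def
  proof (rule exI[of _ c2], rule exI[of _ c3], rule exI[of _ \<mu>1], rule exI[of _ \<mu>2],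
      intro conjI c \<mu>1 \<mu>2 allI impI)
    fix L :: nat and t lam U U' \<mu> :: real
    assume h: "even L \<and> L \<ge> 4 \<and> t > 0 \<and> lam > 0 \<and> U > 0 \<and> U' > 0"
    then interpret torus d L using assms by unfold_locales auto
    have par: "t > 0" "lam > 0" "U > 0" "U' > 0" using h by auto
    let ?S2 = "Re (gexp (modes d L) (Ham d L t lam U U') \<mu> (Stot_sq d L))"
    let ?Ne = "Re (gexp (modes d L) (Ham d L t lam U U') \<mu> (Nel d L))"
    {
      assume "\<mu> \<ge> \<mu>1"
      note hd = hypercubic_high_density[OF par high[OF this, unfolded m_def]]
      show "?S2 \<le> real (L ^ d) / 2 * (real (L ^ d) / 2 + 1)" by (rule hd(1))
      show "real (L ^ d) / 2 * (real (L ^ d) / 2 + 1) * (1 - c2 * exp (- \<mu>)) \<le> ?S2"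
        using hd(2) unfolding c2_def m_def .
    next
      assume "\<mu> \<le> \<mu>2"
      note ld = hypercubic_low_density[OF par low[OF this]]
      show "3/4 * ?Ne \<le> ?S2" by (rule ld(1))
      show "?S2 \<le> 3/4 * ?Ne + c3 * real (card (verts d L)) * exp (2 * \<mu>)"
        using ld(2) unfolding c3_def .
    }
  qed
qed

end
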